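(* Let $\varphi$ be a $G_2$-structure on a $7$-manifold $M$. For any $x\in M$ and nonzero $\xi\in T_x^*M$, $$\ker\big(\sigma_\xi(D_\varphi F)\big)=\{(\xi\otimes V+V\otimes\xi,\,X):V,X\in T_x^*M\}.$$ Moreover, the operator $\sigma_\xi(D_\varphi F\oplus 0_{T_x^*M})$ on $\mathrm{Sym}^2(T_x^*M)\oplus T_x^*M$ preserves the subspace $\{(h,0):h(\xi)=0\}$, and there is an orthogonal decomposition $$\mathrm{Sym}^2(T_x^*M)\oplus T_x^*M=\ker(\sigma_\xi(D_\varphi F))\oplus E^+\oplus E^-,$$ where $E^\pm\subset\{(h,0):h(\xi)=0\}$ and $$E^+=\ker\big(4|\xi|^2-\sigma_\xi(D_\varphi F\oplus0_{T_x^*M})\big),\qquad E^-=\ker\big(4|\xi|^2+\sigma_\xi(D_\varphi F\oplus0_{T_x^*M})\big),$$ so that $\sigma_\xi(D_\varphi F)(h,0)=\pm4|\xi|^2h$ for $(h,0)\in E^\pm$. In particular, for any $(h,X)\in\mathrm{Sym}^2(T_x^*M)\oplus T_x^*M$, $$\big|\langle\sigma_\xi(D_\varphi F\oplus0_{T_x^*M})(h,X),(h,X)\rangle\big|\le4|\xi|^2\,|(h,X)|^2.$$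
   Context: A $G_2$-structure on a smooth $7$-manifold $M$ is a smooth $3$-form $\varphi$ which is nondegenerate: it determines a Riemannian metric $g$ and volume form $\mathrm{vol}$ by $(X\lrcorner\varphi)\wedge(Y\lrcorner\varphi)\wedge\varphi=-6\,g(X,Y)\,\mathrm{vol}$. Let $\nabla$ be the Levi-Civita connection of $g$ and $\psi=\star\varphi$. Indices refer to a local $g$-orthonormal frame, repeated indices are summed, and $\varphi_{ijk}\varphi_{abk}=g_{ia}g_{jb}-g_{ib}g_{ja}-\psi_{ijab}$. Vectors and covectors are identified by $g$; $h(\xi)_i=h_{ij}\xi_j$. The curvature is $R_{ijkl}=g(\nabla_{e_i}\nabla_{e_j}e_k-\nabla_{e_j}\nabla_{e_i}e_k-\nabla_{[e_i,e_j]}e_k,e_l)$ and $F=F(\varphi)$ is the symmetric $2$-tensor $F_{pq}=R_{ijkl}\varphi_{ijp}\varphi_{klq}$. For a $2$-tensor $A$, $(A\diamond\varphi)_{ijk}=A_{ip}\varphi_{pjk}+A_{jp}\varphi_{ipk}+A_{kp}\varphi_{ijp}$; $(X\lrcorner\psi)_{ijk}=X_m\psi_{mijk}$. The map $(h,X)\mapsto h\diamond\varphi+X\lrcorner\psi$ identifies $\mathrm{Sym}^2(T^*M)\oplus T^*M$ with $\Lambda^3(T^*M)$; the linearization $D_\varphi F$ is $D_\varphi F(h,X)=\frac{d}{ds}\big|_{s=0}F(\varphi_s)$ with $\frac{d}{ds}|_{s=0}\varphi_s=h\diamond\varphi+X\lrcorner\psi$, a second-order linear operator from pairs $(h,X)$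 to symmetric $2$-tensors. Its principal symbol $\sigma_\xi(D_\varphi F):\mathrm{Sym}^2(T_x^*M)\oplus T_x^*M\to\mathrm{Sym}^2(T_x^*M)$ is obtained by keeping only second-order terms and replacing $\nabla_i\nabla_j$ by $\xi_i\xi_j$. $\sigma_\xi(D_\varphi F\oplus0_{T_x^*M})$ is the endomorphism $(h,X)\mapsto(\sigma_\xi(D_\varphi F)(h,X),0)$ of $\mathrm{Sym}^2(T_x^*M)\oplus T_x^*M$. The inner product is $\langle(h_1,X_1),(h_2,X_2)\rangle=(h_1)_{ij}(h_2)_{ij}+(X_1)_i(X_2)_i$. *)

theory Defs
  imports "HOL-Analysis.Analysis" "HOL-Combinatorics.Permutations"
begin

section \<open>Smooth maps and partial derivatives\<close>

fun C_k_on :: "nat \<Rightarrow> 'a::real_normed_vector set \<Rightarrow> ('a \<Rightarrow> 'b::real_normed_vector) \<Rightarrow> bool" where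
  "C_k_on 0 S f \<longleftrightarrow> continuous_on S f"
| "C_k_on (Suc k) S f \<longleftrightarrow>
     (\<forall>x\<in>S. f differentiable (at x)) \<and> (\<forall>v. C_k_on k S (\<lambda>x. frechet_derivative f (at x) v))"

text \<open>Only used for open \<open>S\<close>.\<close>
definition smooth_on :: "'a::real_normed_vector set \<Rightarrow> ('a \<Rightarrow> 'b::real_normed_vector) \<Rightarrow> bool" where
  "smooth_on S f \<longleftrightarrow> (\<forall>k. C_k_on k S f)"

definition pd :: "7 \<Rightarrow> (real^7 \<Rightarrow> 'b::real_normed_vector) \<Rightarrow> real^7 \<Rightarrow> 'b" where
  "pd i f = (\<lambda>y. frechet_derivative f (at y) (axis i 1))"


section \<open>Smooth 7-manifolds and 3-forms\<close>

text \<open>A chart is a pair of its domain and its coordinate map; the values of the coordinate map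
  outside the domain are irrelevant. The atlas need not be maximal.\<close>
type_synonym 'm chart = "'m set \<times> ('m \<Rightarrow> real^7)"

definition transition :: "'m chart \<Rightarrow> 'm chart \<Rightarrow> real^7 \<Rightarrow> real^7" where
  "transition c c' = snd c' \<circ> inv_into (fst c) (snd c)"

definition smooth_7_manifold :: "'m topology \<Rightarrow> 'm chart set \<Rightarrow> bool" where
  "smooth_7_manifold M \<A> \<longleftrightarrow>
     Hausdorff_space M \<and> second_countable M \<and>
     (\<Union>c\<in>\<A>. fst c) = topspace M \<and>
     (\<forall>(U, \<kappa>)\<in>\<A>. openin M U \<and> open (\<kappa> ` U) \<and>
        homeomorphic_map (subtopology M U) (top_of_set (\<kappa> ` U)) \<kappa>) \<and>
     (\<forall>c\<in>\<A>. \<forall>c'\<in>\<A>. smooth_on (snd c ` (fst c \<inter> fst c')) (transition c c'))"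

text \<open>Covariant tensors are represented by their component arrays with respect to the coordinate
  coframe \<open>dx\<^sup>1, \<dots>, dx\<^sup>7\<close>. The elements of the index type are \<open>1, \<dots>, 7\<close> (where \<open>7 = 0\<close>).\<close>
type_synonym covec = "real^7"
type_synonym ten2 = "real^7^7"
type_synonym ten3 = "real^7^7^7"
type_synonym ten4 = "real^7^7^7^7"

definition alternating3 :: "ten3 \<Rightarrow> bool" where
  "alternating3 a \<longleftrightarrow> (\<forall>i j k. a$i$j$k = - a$j$i$k \<and> a$i$j$k = - a$i$k$j)"

definition pullback3 :: "real^7^7 \<Rightarrow> ten3 \<Rightarrow> ten3" where
  "pullback3 J a = (\<chi> i j k. \<Sum>l\<in>UNIV. \<Sum>m\<in>UNIV. \<Sum>n\<in>UNIV. J$l$i * J$m$j * J$n$k * a$l$m$n)"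

text \<open>A 3-form on the manifold is given by its component functions in all charts of the atlas
  (as functions of the coordinates), related by the tensor transformation law.\<close>
definition smooth_3_form :: "'m chart set \<Rightarrow> ('m chart \<Rightarrow> real^7 \<Rightarrow> ten3) \<Rightarrow> bool" where
  "smooth_3_form \<A> \<phi> \<longleftrightarrow>
     (\<forall>c\<in>\<A>. smooth_on (snd c ` fst c) (\<phi> c) \<and> (\<forall>y\<in>snd c ` fst c. alternating3 (\<phi> c y))) \<and>
     (\<forall>c\<in>\<A>. \<forall>c'\<in>\<A>. \<forall>p\<in>fst c \<inter> fst c'.
        \<phi> c (snd c p) =
        pullback3 (matrix (frechet_derivative (transition c c') (at (snd c p)))) (\<phi> c' (snd c' p)))"


section \<open>G2-structures\<close>

text \<open>\<open>contract3 X a\<close> is \<open>X \<lrcorner> a\<close> for a vector \<open>X\<close> with components \<open>X\<^sup>i\<close>.\<close>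
definition contract3 :: "real^7 \<Rightarrow> ten3 \<Rightarrow> ten2" where
  "contract3 X a = (\<chi> j k. \<Sum>i\<in>UNIV. X$i * a$i$j$k)"

text \<open>The coefficient of \<open>dx\<^sup>1 \<and> \<dots> \<and> dx\<^sup>7\<close> in \<open>\<alpha> \<and> \<beta> \<and> \<gamma>\<close>, for 2-forms \<open>\<alpha>\<close>, \<open>\<beta>\<close> and a 3-form \<open>\<gamma>\<close>;
  the factor is \<open>1 / (2! 2! 3!)\<close>.\<close>
definition wedge223 :: "ten2 \<Rightarrow> ten2 \<Rightarrow> ten3 \<Rightarrow> real" where
  "wedge223 \<alpha> \<beta> \<gamma> =
     (\<Sum>p | p permutes (UNIV :: 7 set).
        of_int (sign p) * \<alpha>$(p 1)$(p 2) * \<beta>$(p 3)$(p 4) * \<gamma>$(p 5)$(p 6)$(p 7)) / 24"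

text \<open>\<open>g\<close> is an inner product, \<open>v dx\<^sup>1 \<and> \<dots> \<and> dx\<^sup>7\<close> is the volume form of \<open>g\<close> for one of the two
  orientations, and \<open>(X \<lrcorner> \<phi>) \<and> (Y \<lrcorner> \<phi>) \<and> \<phi> = -6 g(X,Y) vol\<close>. The pair \<open>(g, v)\<close> is unique if it
  exists.\<close>
definition G2_metric_vol :: "ten3 \<Rightarrow> ten2 \<Rightarrow> real \<Rightarrow> bool" where
  "G2_metric_vol a g v \<longleftrightarrow>
     transpose g = g \<and> (\<forall>X. X \<noteq> 0 \<longrightarrow> X \<bullet> (g *v X) > 0) \<and> v\<^sup>2 = det g \<and>
     (\<forall>X Y. wedge223 (contract3 X a) (contract3 Y a) a = - 6 * (X \<bullet> (g *v Y)) * v)"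

definition nondegenerate3 :: "ten3 \<Rightarrow> bool" where
  "nondegenerate3 a \<longleftrightarrow> (\<exists>g v. G2_metric_vol a g v)"

definition G2_metric :: "ten3 \<Rightarrow> ten2" where
  "G2_metric a = (THE g. \<exists>v. G2_metric_vol a g v)"

definition G2_vol :: "ten3 \<Rightarrow> real" where
  "G2_vol a = (THE v. \<exists>g. G2_metric_vol a g v)"

definition G2_structure :: "'m chart set \<Rightarrow> ('m chart \<Rightarrow> real^7 \<Rightarrow> ten3) \<Rightarrow> bool" where
  "G2_structure \<A> \<phi> \<longleftrightarrow>
     smooth_3_form \<A> \<phi> \<and> (\<forall>c\<in>\<A>. \<forall>y\<in>snd c ` fst c. nondegenerate3 (\<phi> c y))"


section \<open>Pointwise tensor algebra\<close>

text \<open>Contractions over a \<open>g\<close>-orthonormal frame are written as contractions with the inverse metric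
  \<open>g\<^sup>i\<^sup>j\<close> in the coordinate frame.\<close>

abbreviation ginv :: "ten2 \<Rightarrow> real^7^7" where
  "ginv g \<equiv> matrix_inv g"

text \<open>\<open>(\<star>a)\<^sub>i\<^sub>j\<^sub>k\<^sub>l = 1/3! a\<^sup>p\<^sup>q\<^sup>r vol\<^sub>p\<^sub>q\<^sub>r\<^sub>i\<^sub>j\<^sub>k\<^sub>l\<close>, i.e. \<open>b \<and> \<star>a = \<langle>b, a\<rangle> vol\<close>.\<close>
definition hodge_star3 :: "ten2 \<Rightarrow> real \<Rightarrow> ten3 \<Rightarrow> ten4" where
  "hodge_star3 g v a = (\<chi> i j k l. v / 6 *
     (\<Sum>p | p permutes (UNIV :: 7 set) \<and> p 4 = i \<and> p 5 = j \<and> p 6 = k \<and> p 7 = l.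
        of_int (sign p) *
        (\<Sum>q\<in>UNIV. \<Sum>r\<in>UNIV. \<Sum>s\<in>UNIV.
           ginv g $ (p 1) $ q * ginv g $ (p 2) $ r * ginv g $ (p 3) $ s * a$q$r$s)))"

definition G2_psi :: "ten3 \<Rightarrow> ten4" where
  "G2_psi a = hodge_star3 (G2_metric a) (G2_vol a) a"

definition diamond :: "ten2 \<Rightarrow> ten2 \<Rightarrow> ten3 \<Rightarrow> ten3" where
  "diamond g h a = (\<chi> i j k. \<Sum>p\<in>UNIV. \<Sum>q\<in>UNIV. ginv g $ p $ q *
     (h$i$p * a$q$j$k + h$j$p * a$i$q$k + h$k$p * a$i$j$q))"

definition contract4 :: "ten2 \<Rightarrow> covec \<Rightarrow> ten4 \<Rightarrow> ten3" where
  "contract4 g X b = (\<chi> i j k. \<Sum>m\<in>UNIV. \<Sum>n\<in>UNIV. ginv g $ m $ n * X$m * b$n$i$j$k)"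

definition covec_inner :: "ten2 \<Rightarrow> covec \<Rightarrow> covec \<Rightarrow> real" where
  "covec_inner g X Y = (\<Sum>i\<in>UNIV. \<Sum>j\<in>UNIV. ginv g $ i $ j * X$i * Y$j)"

definition ten2_inner :: "ten2 \<Rightarrow> ten2 \<Rightarrow> ten2 \<Rightarrow> real" where
  "ten2_inner g h k = (\<Sum>i\<in>UNIV. \<Sum>j\<in>UNIV. \<Sum>p\<in>UNIV. \<Sum>q\<in>UNIV.
     ginv g $ i $ p * ginv g $ j $ q * h$i$j * k$p$q)"

definition pair_inner :: "ten2 \<Rightarrow> ten2 \<times> covec \<Rightarrow> ten2 \<times> covec \<Rightarrow> real" where
  "pair_inner g u w = ten2_inner g (fst u) (fst w) + covec_inner g (snd u) (snd w)"

text \<open>\<open>h(\<xi>)\<^sub>i = h\<^sub>i\<^sub>j \<xi>\<^sup>j\<close>\<close>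
definition ten2_apply :: "ten2 \<Rightarrow> ten2 \<Rightarrow> covec \<Rightarrow> covec" where
  "ten2_apply g h \<xi> = (\<chi> i. \<Sum>j\<in>UNIV. \<Sum>k\<in>UNIV. ginv g $ j $ k * h$i$j * \<xi>$k)"

definition tensor_prod :: "covec \<Rightarrow> covec \<Rightarrow> ten2" where
  "tensor_prod X Y = (\<chi> i j. X$i * Y$j)"

text \<open>\<open>Sym\<^sup>2 \<oplus> T\<^sup>*\<close>\<close>
definition sym2_covec :: "(ten2 \<times> covec) set" where
  "sym2_covec = {(h, X). transpose h = h}"


section \<open>Levi-Civita connection, curvature, and the tensor F\<close>

text \<open>\<open>christoffel G y $ k $ i $ j = \<Gamma>\<^sup>k\<^sub>i\<^sub>j\<close>\<close>
definition christoffel :: "(real^7 \<Rightarrow> ten2) \<Rightarrow> real^7 \<Rightarrow> real^7^7^7" where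
  "christoffel G y = (\<chi> k i j. (\<Sum>l\<in>UNIV. ginv (G y) $ k $ l *
     (pd i G y $ j $ l + pd j G y $ i $ l - pd l G y $ i $ j)) / 2)"

text \<open>\<open>\<nabla>\<^sub>\<partial>\<^sub>i Y\<close> for a vector field \<open>Y\<close>\<close>
definition cov_deriv :: "(real^7 \<Rightarrow> ten2) \<Rightarrow> 7 \<Rightarrow> (real^7 \<Rightarrow> real^7) \<Rightarrow> real^7 \<Rightarrow> real^7" where
  "cov_deriv G i Y = (\<lambda>y. pd i Y y + (\<chi> k. \<Sum>j\<in>UNIV. christoffel G y $ k $ i $ j * Y y $ j))"

abbreviation coord_field :: "7 \<Rightarrow> real^7 \<Rightarrow> real^7" where
  "coord_field k \<equiv> (\<lambda>_. axis k 1)"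

text \<open>\<open>R\<^sub>i\<^sub>j\<^sub>k\<^sub>l\<close> in the coordinate frame, whose fields commute.\<close>
definition riemann :: "(real^7 \<Rightarrow> ten2) \<Rightarrow> real^7 \<Rightarrow> ten4" where
  "riemann G y = (\<chi> i j k l.
     (cov_deriv G i (cov_deriv G j (coord_field k)) y
      - cov_deriv G j (cov_deriv G i (coord_field k)) y) \<bullet> (G y *v axis l 1))"

text \<open>\<open>raise12 g a $ i $ j $ p = a\<^sup>i\<^sup>j\<^sub>p\<close>\<close>
definition raise12 :: "ten2 \<Rightarrow> ten3 \<Rightarrow> real^7^7^7" where
  "raise12 g a = (\<chi> i j p. \<Sum>k\<in>UNIV. \<Sum>l\<in>UNIV. ginv g $ i $ k * ginv g $ j $ l * a$k$l$p)"

definition F_tensor :: "(real^7 \<Rightarrow> ten3) \<Rightarrow> real^7 \<Rightarrow> ten2" where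
  "F_tensor \<Phi> y =
     (let G = (\<lambda>z. G2_metric (\<Phi> z)); R = riemann G y; a = raise12 (G y) (\<Phi> y)
      in \<chi> p q. \<Sum>i\<in>UNIV. \<Sum>j\<in>UNIV. \<Sum>k\<in>UNIV. \<Sum>l\<in>UNIV. R$i$j$k$l * a$i$j$p * a$k$l$q)"


section \<open>Linearization and principal symbol\<close>

text \<open>The 3-form \<open>h \<diamond> \<phi> + X \<lrcorner> \<psi>\<close> corresponding to the pair \<open>(h, X)\<close>\<close>
definition pair_to_3_form :: "ten3 \<Rightarrow> ten2 \<times> covec \<Rightarrow> ten3" where
  "pair_to_3_form a u =
     diamond (G2_metric a) (fst u) a + contract4 (G2_metric a) (snd u) (G2_psi a)"

text \<open>\<open>d/ds F(\<phi>\<^sub>s)\<close> at \<open>s = 0\<close> along \<open>\<phi>\<^sub>s = \<phi> + s (h \<diamond> \<phi> + X \<lrcorner> \<psi>)\<close>. Near a given point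
  \<open>\<phi>\<^sub>s\<close> is nondegenerate for small \<open>s\<close>, which suffices as \<open>F(\<phi>\<^sub>s)\<close> at that point depends on the germ
  of \<open>\<phi>\<^sub>s\<close> only.\<close>
definition DF :: "(real^7 \<Rightarrow> ten3) \<Rightarrow> (real^7 \<Rightarrow> ten2 \<times> covec) \<Rightarrow> real^7 \<Rightarrow> ten2" where
  "DF \<Phi> u y =
     vector_derivative (\<lambda>s. F_tensor (\<lambda>z. \<Phi> z + s *\<^sub>R pair_to_3_form (\<Phi> z) (u z)) y) (at 0)"

text \<open>The principal symbol at \<open>y\<close> of a second-order linear operator \<open>P\<close> acting on smooth sections
  over \<open>\<Omega>\<close> of the trivial bundle whose fibre is the subspace \<open>E\<close>: if
  \<open>P u y = a\<^sup>i\<^sup>j \<partial>\<^sub>i \<partial>\<^sub>j u(y) + b\<^sup>i \<partial>\<^sub>i u(y) + c u(y)\<close>, the symbol is \<open>\<xi>\<^sub>i \<xi>\<^sub>j a\<^sup>i\<^sup>j\<close>. (Covariant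
  derivatives \<open>\<nabla>\<^sub>i \<nabla>\<^sub>j\<close> differ from \<open>\<partial>\<^sub>i \<partial>\<^sub>j\<close> by terms of lower order.) The value is meaningful
  for arguments in \<open>E\<close> only.\<close>
definition principal_symbol ::
  "(real^7) set \<Rightarrow> 'a::real_normed_vector set \<Rightarrow> ((real^7 \<Rightarrow> 'a) \<Rightarrow> real^7 \<Rightarrow> 'b::real_normed_vector)
     \<Rightarrow> real^7 \<Rightarrow> covec \<Rightarrow> 'a \<Rightarrow> 'b" where
  "principal_symbol \<Omega> E P y \<xi> e = (THE t. \<exists>a b c.
     (\<forall>i j. linear (a i j)) \<and> (\<forall>i. linear (b i)) \<and> linear c \<and>
     (\<forall>u. smooth_on \<Omega> u \<and> (\<forall>z\<in>\<Omega>. u z \<in> E) \<longrightarrow>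
        P u y = (\<Sum>i\<in>UNIV. \<Sum>j\<in>UNIV. a i j (pd i (pd j u) y)) + (\<Sum>i\<in>UNIV. b i (pd i u y)) + c (u y)) \<and>
     t = (\<Sum>i\<in>UNIV. \<Sum>j\<in>UNIV. (\<xi>$i * \<xi>$j) *\<^sub>R a i j e))"

definition symbol_DF ::
  "(real^7) set \<Rightarrow> (real^7 \<Rightarrow> ten3) \<Rightarrow> real^7 \<Rightarrow> covec \<Rightarrow> ten2 \<times> covec \<Rightarrow> ten2" where
  "symbol_DF \<Omega> \<Phi> y \<xi> = principal_symbol \<Omega> sym2_covec (DF \<Phi>) y \<xi>"

definition symbol_DF_0 ::
  "(real^7) set \<Rightarrow> (real^7 \<Rightarrow> ten3) \<Rightarrow> real^7 \<Rightarrow> covec \<Rightarrow> ten2 \<times> covec \<Rightarrow> ten2 \<times> covec" where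
  "symbol_DF_0 \<Omega> \<Phi> y \<xi> u = (symbol_DF \<Omega> \<Phi> y \<xi> u, 0)"

definition orthogonal_decomposition3 ::
  "('a::real_vector \<Rightarrow> 'a \<Rightarrow> real) \<Rightarrow> 'a set \<Rightarrow> 'a set \<Rightarrow> 'a set \<Rightarrow> 'a set \<Rightarrow> bool" where
  "orthogonal_decomposition3 ip W A B C \<longleftrightarrow>
     subspace A \<and> subspace B \<and> subspace C \<and> A \<subseteq> W \<and> B \<subseteq> W \<and> C \<subseteq> W \<and>
     (\<forall>a\<in>A. \<forall>b\<in>B. ip a b = 0) \<and> (\<forall>a\<in>A. \<forall>c\<in>C. ip a c = 0) \<and> (\<forall>b\<in>B. \<forall>c\<in>C. ip b c = 0) \<and>
     (\<forall>w\<in>W. \<exists>!(a, b, c). a \<in> A \<and> b \<in> B \<and> c \<in> C \<and> w = a + b + c)"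

end

theory Submission
  imports Defs
begin

text \<open>Writing \<open>B(X, Y)\<close> for the coefficient of \<open>(X \<lrcorner> \<phi>) \<and> (Y \<lrcorner> \<phi>) \<and> \<phi> = -6 g(X, Y) vol\<close>, one has \<open>det B = (-6)\<^sup>7 v\<^sup>9\<close>, so
  \<open>v\<close> and \<open>g\<close> are explicit smooth functions of \<open>\<phi>\<close>, equivariant under linear maps. The form \<open>h \<diamond> \<phi>\<close> is the
  infinitesimal action of \<open>g\<^sup>-\<^sup>1 h\<close> on \<open>\<phi>\<close>, and \<open>X \<lrcorner> \<psi>\<close> is that of a \<open>g\<close>-skew endomorphism (checked in the normal
  form of \<open>\<phi>\<close>, which is found by maximising \<open>\<phi>\<close> over unit vectors). Hence the metric varies by \<open>2 h\<close>, and the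
  second-order part of the linearized curvature gives \<open>\<sigma>(h, X) = 4 M\<^sup>T h M\<close> with \<open>M = \<xi>\<^sup>\<sharp> \<lrcorner> \<phi>\<close>. The normal form also
  shows \<open>M\<^sup>2 = \<xi>\<^sup>\<sharp> \<otimes> \<xi> - |\<xi>|\<^sup>2\<close>, so that \<open>\<sigma>\<^sup>3 = (4 |\<xi>|\<^sup>2)\<^sup>2 \<sigma>\<close>; as \<open>\<sigma>\<close> is self-adjoint, the space is the orthogonal
  sum of the eigenspaces for \<open>0\<close> and \<open>\<plusminus> 4 |\<xi>|\<^sup>2\<close>.\<close>

section \<open>Maps of class \<open>C\<^sup>k\<close>\<close>

text \<open>The determinant identity comes from \<open>B = - 6 v g\<close> and
  \<open>v^2 = det g\<close>; since the exponent 9 is odd, a root recovers \<open>v\<close> with its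
  sign, hence the orientation. The obstacle is that the metric and the symbol are definite
  descriptions and \<open>DF\<close> is a \<open>vector_derivative\<close>: they say nothing until
  the described object is exhibited and the derivative is shown to exist. So the metric is replaced
  by its closed formula on an open set of pairs \<open>(s, z)\<close>, F becomes a differentiable
  function \<open>F_jet\<close> of the 2-jet of the metric and of \<open>\<phi>\<close>, and
  symmetry of second derivatives lets d/ds pass through the coordinate derivatives. The derivative
  of the closed formula is never computed by hand: equivariance determines it on the directions
  tangent to an orbit of the linear group, and
  \<open>h \<diamond> \<phi> + X \<lrcorner> \<psi>\<close> is such a direction. The factor 4 in the
  symbol counts four equal terms, produced by the antisymmetry of the curvature and of
  \<open>\<phi>\<close> in two index pairs. The cubic identity holds because \<open>M\<close>
  annihilates \<open>\<xi>\<^sup>\<sharp>\<close>, so the rank-one part of \<open>M^2\<close>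
  disappears in \<open>M^3\<close>.\<close>

lemma C_k_on_cong:
  assumes "open S" "\<And>x. x \<in> S \<Longrightarrow> f x = g x"
  shows "C_k_on k S f \<longleftrightarrow> C_k_on k S g"
  using assms(2)
proof (induction k arbitrary: f g)
  case 0
  then show ?case by (simp cong: continuous_on_cong)
next
  case (Suc k)
  have d: "(f has_derivative D) (at x) \<longleftrightarrow> (g has_derivative D) (at x)" if "x \<in> S" for D x
    using has_derivative_transform_within_open[OF _ assms(1) that] Suc.prems by metis
  have f: "frechet_derivative f (at x) = frechet_derivative g (at x)" if "x \<in> S" for x
    using d[OF that] by (simp add: frechet_derivative_def)
  show ?case
    using Suc.IH[of "\<lambda>x. frechet_derivative f (at x) v" "\<lambda>x. frechet_derivative g (at x) v" for v] d f
    by (auto simp: differentiable_def)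
qed

text \<open>The working form of the recursion: any explicit derivative may stand in for the one
  chosen by \<open>frechet_derivative\<close>.\<close>

lemma C_k_on_Suc_I:
  assumes "open S" "\<And>x. x \<in> S \<Longrightarrow> (f has_derivative f' x) (at x)" "\<And>v. C_k_on k S (\<lambda>x. f' x v)"
  shows "C_k_on (Suc k) S f"
proof -
  have "C_k_on k S (\<lambda>x. frechet_derivative f (at x) v)" for v
    using C_k_on_cong[OF assms(1), of "\<lambda>x. frechet_derivative f (at x) v" "\<lambda>x. f' x v" k]
      frechet_derivative_at[OF assms(2)] assms(3) by simp
  then show ?thesis using assms(2) by (auto simp: differentiable_def)
qed

lemma C_k_on_has_derivative:
  "C_k_on (Suc k) S f \<Longrightarrow> x \<in> S \<Longrightarrow> (f has_derivative frechet_derivative f (at x)) (at x)"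
  by (simp add: frechet_derivative_works[symmetric])

lemma C_k_on_SucD: "C_k_on (Suc k) S f \<Longrightarrow> C_k_on k S f"
proof (induction k arbitrary: f)
  case 0
  then show ?case
    by (auto intro!: continuous_at_imp_continuous_on differentiable_imp_continuous_within)
next
  case (Suc k)
  show ?case using Suc.IH Suc.prems by (metis C_k_on.simps(2))
qed

lemma C_k_on_le: "C_k_on n S f \<Longrightarrow> m \<le> n \<Longrightarrow> C_k_on m S f"
  by (induction n) (auto simp: le_Suc_eq dest: C_k_on_SucD simp del: C_k_on.simps)

lemma C_k_on_continuous: "C_k_on k S f \<Longrightarrow> continuous_on S f"
  using C_k_on_le[of k S f 0] by simp

lemma C_k_on_subset: "C_k_on k S f \<Longrightarrow> T \<subseteq> S \<Longrightarrow> C_k_on k T f"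
  by (induction k arbitrary: f) (auto intro: continuous_on_subset)

lemma C_k_on_const [simp]: "C_k_on k S (\<lambda>_. c)"
  by (induction k arbitrary: c) (auto simp: frechet_derivative_const)

lemma C_k_on_bounded_linear: "bounded_linear L \<Longrightarrow> C_k_on k S L"
proof (induction k)
  case 0 then show ?case by (simp add: linear_continuous_on)
next
  case (Suc k)
  have "frechet_derivative L (at x) = L" for x
    using Suc.prems bounded_linear_imp_has_derivative frechet_derivative_at by metis
  moreover have "L differentiable (at x)" for x
    using Suc.prems by (auto simp: differentiable_def intro: bounded_linear_imp_has_derivative)
  ultimately show ?case using Suc.prems by simp
qed

lemma C_k_on_add:
  assumes "open S" shows "C_k_on k S f \<Longrightarrow> C_k_on k S g \<Longrightarrow> C_k_on k S (\<lambda>x. f x + g x)"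
proof (induction k arbitrary: f g)
  case 0 then show ?case by (simp add: continuous_on_add)
next
  case (Suc k)
  show ?case
    by (rule C_k_on_Suc_I[OF assms has_derivative_add[OF C_k_on_has_derivative[OF Suc.prems(1)] C_k_on_has_derivative[OF Suc.prems(2)]]])
       (use Suc in auto)
qed

lemma C_k_on_bilinear:
  assumes "open S" "bounded_bilinear prd"
  shows "C_k_on k S f \<Longrightarrow> C_k_on k S g \<Longrightarrow> C_k_on k S (\<lambda>x. prd (f x) (g x))"
proof (induction k arbitrary: f g)
  case 0 then show ?case using assms(2) by (simp add: bounded_bilinear.continuous_on)
next
  case (Suc k)
  show ?case
    by (rule C_k_on_Suc_I[OF assms(1) bounded_bilinear.FDERIV[OF assms(2) C_k_on_has_derivative[OF Suc.prems(1)] C_k_on_has_derivative[OF Suc.prems(2)]]])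
       (use Suc.prems in \<open>auto intro!: C_k_on_add[OF assms(1)] Suc.IH intro: C_k_on_SucD[OF Suc.prems(1)] C_k_on_SucD[OF Suc.prems(2)]\<close>)
qed

lemmas C_k_on_mult = C_k_on_bilinear[OF _ bounded_bilinear_mult]
lemmas C_k_on_scaleR = C_k_on_bilinear[OF _ bounded_bilinear_scaleR]

lemma C_k_on_linear_comp:
  assumes "open S" "bounded_linear L"
  shows "C_k_on k S f \<Longrightarrow> C_k_on k S (\<lambda>x. L (f x))"
proof (induction k arbitrary: f)
  case 0 then show ?case using bounded_linear.continuous_on[OF assms(2)] by simp
next
  case (Suc k)
  show ?case
    by (rule C_k_on_Suc_I[OF assms(1) bounded_linear.has_derivative[OF assms(2) C_k_on_has_derivative[OF Suc.prems(1)]]])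
       (use Suc in auto)
qed

lemma C_k_on_minus: "open S \<Longrightarrow> C_k_on k S f \<Longrightarrow> C_k_on k S (\<lambda>x. - f x)"
  by (rule C_k_on_linear_comp[OF _ bounded_linear_minus[OF bounded_linear_ident]])

lemma C_k_on_diff: "open S \<Longrightarrow> C_k_on k S f \<Longrightarrow> C_k_on k S g \<Longrightarrow> C_k_on k S (\<lambda>x. f x - g x)"
  using C_k_on_add[of S k f "\<lambda>x. - g x"] C_k_on_minus[of S k g] by simp

lemma C_k_on_sum:
  "open S \<Longrightarrow> (\<And>i. i \<in> I \<Longrightarrow> C_k_on k S (f i)) \<Longrightarrow> C_k_on k S (\<lambda>x. \<Sum>i\<in>I. f i x)"
  by (induction I rule: infinite_finite_induct) (auto intro: C_k_on_add)

lemma C_k_on_prod: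
  fixes f :: "'i \<Rightarrow> 'a::real_normed_vector \<Rightarrow> real"
  shows "open S \<Longrightarrow> (\<And>i. i \<in> I \<Longrightarrow> C_k_on k S (f i)) \<Longrightarrow> C_k_on k S (\<lambda>x. \<Prod>i\<in>I. f i x)"
  by (induction I rule: infinite_finite_induct) (auto intro: C_k_on_mult)

lemma C_k_on_power:
  fixes f :: "'a::real_normed_vector \<Rightarrow> real"
  shows "open S \<Longrightarrow> C_k_on k S f \<Longrightarrow> C_k_on k S (\<lambda>x. f x ^ n)"
  by (induction n) (auto intro: C_k_on_mult)

lemma C_k_on_inverse:
  fixes f :: "'a::real_normed_vector \<Rightarrow> real"
  assumes "open S" "\<And>x. x \<in> S \<Longrightarrow> f x \<noteq> 0"
  shows "C_k_on k S f \<Longrightarrow> C_k_on k S (\<lambda>x. inverse (f x))"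
proof (induction k)
  case 0 then show ?case using assms by (auto intro: continuous_on_inverse)
next
  case (Suc k)
  show ?case
    by (rule C_k_on_Suc_I[OF assms(1) Deriv.has_derivative_inverse[OF _ C_k_on_has_derivative[OF Suc.prems]]])
       (use Suc.prems assms in \<open>auto intro!: C_k_on_mult C_k_on_minus Suc.IH C_k_on_SucD[OF Suc.prems]\<close>)
qed

lemma C_k_on_divide:
  fixes f :: "'a::real_normed_vector \<Rightarrow> real"
  assumes "open S" "\<And>x. x \<in> S \<Longrightarrow> g x \<noteq> 0"
  shows "C_k_on k S f \<Longrightarrow> C_k_on k S g \<Longrightarrow> C_k_on k S (\<lambda>x. f x / g x)"
  by (simp add: divide_inverse C_k_on_mult C_k_on_inverse assms)

text \<open>The derivative of the root is a rational expression in the root itself, so the induction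
  hypothesis applies to it. Oddness of \<open>n\<close> admits negative values of \<open>f\<close>,
  which occur for one of the two orientations.\<close>

lemma C_k_on_odd_root:
  fixes f :: "'a::real_normed_vector \<Rightarrow> real"
  assumes "open S" "\<And>x. x \<in> S \<Longrightarrow> f x \<noteq> 0" "odd n"
  shows "C_k_on k S f \<Longrightarrow> C_k_on k S (\<lambda>x. root n (f x))"
proof (induction k)
  case 0 then show ?case using assms by (auto intro: continuous_on_real_root)
next
  case (Suc k)
  have n: "n > 0" using assms(3) by (auto elim: oddE)
  have r: "root n (f x) \<noteq> 0" if "x \<in> S" for x using assms(2)[OF that] n by simp
  have "((\<lambda>x. root n (f x)) has_derivative
      (\<lambda>v. frechet_derivative f (at x) v * inverse (real n * root n (f x) ^ (n - 1)))) (at x)"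
    if "x \<in> S" for x
    by (rule DERIV_compose_FDERIV[OF DERIV_odd_real_root[OF assms(3) assms(2)[OF that], unfolded One_nat_def[symmetric]]
          C_k_on_has_derivative[OF Suc.prems that]])
  moreover have "C_k_on k S (\<lambda>x. frechet_derivative f (at x) v * inverse (real n * root n (f x) ^ (n - 1)))" for v
    using Suc C_k_on_SucD[OF Suc.prems] r n assms(1)
    by (intro C_k_on_mult C_k_on_inverse C_k_on_power) auto
  ultimately show ?case by (rule C_k_on_Suc_I[OF assms(1)])
qed

text \<open>Affine substitutions are all that the sequel composes with: the projection from
  \<open>(s, z)\<close> to \<open>z\<close> and the inclusion of a slice of constant
  \<open>s\<close>.\<close>

lemma C_k_on_affine_comp:
  assumes "open T" "bounded_linear L" "\<And>x. x \<in> T \<Longrightarrow> c + L x \<in> S"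
  shows "C_k_on k S f \<Longrightarrow> C_k_on k T (\<lambda>x. f (c + L x))"
proof (induction k arbitrary: f)
  case 0
  have "continuous_on T (\<lambda>x. c + L x)"
    by (intro continuous_intros linear_continuous_on assms(2))
  from continuous_on_compose2[OF _ this, of S f] show ?case using 0 assms(3) by (simp add: image_subset_iff)
next
  case (Suc k)
  have "((\<lambda>x. f (c + L x)) has_derivative (\<lambda>v. frechet_derivative f (at (c + L x)) (L v))) (at x)" if "x \<in> T" for x
  proof -
    have "((\<lambda>x. c + L x) has_derivative L) (at x)"
      using bounded_linear_imp_has_derivative[OF assms(2)] by (auto intro!: derivative_eq_intros)
    from has_derivative_compose[OF this C_k_on_has_derivative[OF Suc.prems assms(3)[OF that]]]
    show ?thesis .
  qed
  moreover have "C_k_on k T (\<lambda>x. frechet_derivative f (at (c + L x)) (L v))" for v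
    using Suc.IH[of "\<lambda>y. frechet_derivative f (at y) (L v)"] Suc.prems by simp
  ultimately show ?case by (rule C_k_on_Suc_I[OF assms(1)])
qed

lemma C_k_on_vec_nth:
  fixes f :: "'a::real_normed_vector \<Rightarrow> 'b::real_normed_vector^'n"
  shows "open S \<Longrightarrow> C_k_on k S f \<Longrightarrow> C_k_on k S (\<lambda>x. f x $ i)"
  by (rule C_k_on_linear_comp[OF _ bounded_linear_vec_nth])

lemma bounded_linear_axis: "bounded_linear (axis i :: 'b::real_normed_vector \<Rightarrow> 'b^'n)"
proof (rule bounded_linear_intro[where K = 1])
  fix x :: 'b
  have "norm (axis i x :: 'b^'n) \<le> (\<Sum>j\<in>UNIV. norm ((axis i x :: 'b^'n) $ j))"
    unfolding norm_vec_def by (rule L2_set_le_sum) simp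
  also have "\<dots> = (\<Sum>j\<in>UNIV. if j = i then norm x else 0)"
    by (rule sum.cong) (auto simp: axis_def)
  finally show "norm (axis i x :: 'b^'n) \<le> norm x * 1" by simp
qed (auto simp: axis_def vec_eq_iff)

lemma C_k_on_vec_lambda:
  fixes f :: "'n::finite \<Rightarrow> 'a::real_normed_vector \<Rightarrow> 'b::real_normed_vector"
  assumes "open S" "\<And>i. C_k_on k S (f i)"
  shows "C_k_on k S (\<lambda>x. \<chi> i. f i x)"
proof -
  have "(\<lambda>x. \<chi> i. f i x) = (\<lambda>x. \<Sum>i\<in>UNIV. axis i (f i x))"
    by (simp add: fun_eq_iff vec_eq_iff axis_def sum_component)
  moreover have "C_k_on k S (\<lambda>x. axis i (f i x))" for i
    by (rule C_k_on_linear_comp[OF assms(1) bounded_linear_axis assms(2)])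
  ultimately show ?thesis by (simp add: C_k_on_sum[OF assms(1)])
qed

lemma C_k_on_ident: "C_k_on k S (\<lambda>x. x)"
  by (rule C_k_on_bounded_linear) (rule bounded_linear_ident)

lemma C_k_on_fst: "open S \<Longrightarrow> C_k_on k S f \<Longrightarrow> C_k_on k S (\<lambda>x. fst (f x))"
  by (rule C_k_on_linear_comp[OF _ bounded_linear_fst])

lemma C_k_on_snd: "open S \<Longrightarrow> C_k_on k S f \<Longrightarrow> C_k_on k S (\<lambda>x. snd (f x))"
  by (rule C_k_on_linear_comp[OF _ bounded_linear_snd])

lemma frechet_derivative_cong_open:
  assumes "open S" "x \<in> S" "\<And>y. y \<in> S \<Longrightarrow> f y = g y"
  shows "frechet_derivative f (at x) = frechet_derivative g (at x)"
proof -
  have "(f has_derivative D) (at x) \<longleftrightarrow> (g has_derivative D) (at x)" for D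
    using has_derivative_transform_within_open[OF _ assms(1,2)] assms(3) by metis
  then show ?thesis by (simp add: frechet_derivative_def)
qed

text \<open>The second difference of \<open>f\<close> over the parallelogram spanned by
  \<open>t u\<close> and \<open>t v\<close> does not depend on the order of the two directions,
  while two applications of the mean value theorem turn it into \<open>t^2\<close> times one or the
  other mixed derivative at a nearby point. Continuity then contradicts a gap between the
  two.\<close>

lemma second_derivative_symmetric_real:
  fixes f :: "'a::real_normed_vector \<Rightarrow> real"
  assumes "open S" "C_k_on 2 S f" "x \<in> S"
  shows "frechet_derivative (\<lambda>y. frechet_derivative f (at y) u) (at x) v =
         frechet_derivative (\<lambda>y. frechet_derivative f (at y) v) (at x) u"
    (is "?D u v = ?D v u")
proof (rule ccontr)
  define D where "D u v y = frechet_derivative (\<lambda>y. frechet_derivative f (at y) u) (at y) v" for u v y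
  assume "\<not> ?thesis"
  then have ne: "D u v x \<noteq> D v u x" by (simp add: D_def)
  \<comment> \<open>Numbers that lie strictly within half the gap of the two mixed derivatives
    cannot coincide.\<close>
  define e where "e = \<bar>D u v x - D v u x\<bar> / 2"
  have e: "e > 0" using ne by (simp add: e_def)
  have cont: "continuous_on S (D u v)" for u v
    using assms(2) by (simp add: D_def numeral_2_eq_2)
  have fd: "(f has_derivative frechet_derivative f (at y)) (at y)" if "y \<in> S" for y
    by (rule C_k_on_has_derivative[OF assms(2)[folded Suc_1] that])
  have fdd: "((\<lambda>y. frechet_derivative f (at y) u) has_derivative (\<lambda>v. D u v y)) (at y)" if "y \<in> S" for y u
    using assms(2) that C_k_on_has_derivative[of 0 S "\<lambda>y. frechet_derivative f (at y) u" y]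
    by (auto simp: numeral_2_eq_2 D_def)
  obtain d1 where d1: "d1 > 0" "\<And>y. y \<in> S \<Longrightarrow> dist y x < d1 \<Longrightarrow> dist (D u v y) (D u v x) < e"
    using cont[of u v] assms(3) e unfolding continuous_on_iff by metis
  obtain d2 where d2: "d2 > 0" "\<And>y. y \<in> S \<Longrightarrow> dist y x < d2 \<Longrightarrow> dist (D v u y) (D v u x) < e"
    using cont[of v u] assms(3) e unfolding continuous_on_iff by metis
  obtain d3 where d3: "d3 > 0" "\<And>y. dist y x < d3 \<Longrightarrow> y \<in> S"
    using assms(1,3) unfolding open_dist by metis
  define d where "d = min d1 (min d2 d3)"
  \<comment> \<open>Small enough that the whole parallelogram with sides \<open>t u\<close> and
    \<open>t v\<close> stays within \<open>d / 2\<close> of \<open>x\<close>; the \<open>+ 1\<close>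
    avoids a division by zero.\<close>
  define t where "t = d / (2 * (norm u + norm v + 1))"
  have d: "d > 0" using d1 d2 d3 by (simp add: d_def)
  have t: "t > 0" using d by (simp add: t_def add_nonneg_pos)
  have near: "dist (x + r *\<^sub>R u + s *\<^sub>R v) x < d" if "0 \<le> r" "r \<le> t" "0 \<le> s" "s \<le> t" for r s
  proof -
    have "norm (r *\<^sub>R u + s *\<^sub>R v) \<le> t * norm u + t * norm v"
      using that by (intro norm_triangle_le add_mono) (auto intro: mult_right_mono)
    also have "\<dots> \<le> t * (norm u + norm v + 1)" using t by (simp add: algebra_simps)
    also have "\<dots> = d / 2" 
    proof -
      have "norm u + norm v + 1 > 0" by (simp add: add_nonneg_pos)
      then show ?thesis unfolding t_def by (simp add: field_simps del: distrib_left_numeral)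
    qed
    also have "\<dots> < d" using d by simp
    finally show ?thesis by (simp add: dist_norm add.assoc)
  qed
  have key: "\<exists>r s. 0 \<le> r \<and> r \<le> t \<and> 0 \<le> s \<and> s \<le> t \<and>
      f (x + t *\<^sub>R a + t *\<^sub>R b) - f (x + t *\<^sub>R a) - f (x + t *\<^sub>R b) + f x = t * t * D a b (x + r *\<^sub>R a + s *\<^sub>R b)"
    if inS: "\<And>r s. 0 \<le> r \<Longrightarrow> r \<le> t \<Longrightarrow> 0 \<le> s \<Longrightarrow> s \<le> t \<Longrightarrow> x + r *\<^sub>R a + s *\<^sub>R b \<in> S" for a b
  proof -
    \<comment> \<open>The second difference is \<open>h t - h 0\<close>; the mean value theorem in
      \<open>r\<close> and then in \<open>s\<close> produces the two factors
      \<open>t\<close>.\<close>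
    define h where "h r = f (x + r *\<^sub>R a + t *\<^sub>R b) - f (x + r *\<^sub>R a + 0 *\<^sub>R b)" for r
    have fr1: "((\<lambda>r. f (x + r *\<^sub>R a + s *\<^sub>R b)) has_real_derivative
         frechet_derivative f (at (x + r *\<^sub>R a + s *\<^sub>R b)) a) (at r)"
      if "0 \<le> r" "r \<le> t" "0 \<le> s" "s \<le> t" for r s
    proof -
      note y = inS[OF that]
      have "((\<lambda>r. f (x + r *\<^sub>R a + s *\<^sub>R b)) has_derivative
         (\<lambda>k. frechet_derivative f (at (x + r *\<^sub>R a + s *\<^sub>R b)) (k *\<^sub>R a))) (at r)"
      proof (rule has_derivative_compose[of "\<lambda>r. x + r *\<^sub>R a + s *\<^sub>R b" "\<lambda>k. k *\<^sub>R a"])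
        show "((\<lambda>r. x + r *\<^sub>R a + s *\<^sub>R b) has_derivative (\<lambda>k. k *\<^sub>R a)) (at r)"
          by (auto intro!: derivative_eq_intros)
      qed (rule fd[OF y])
      then show ?thesis unfolding has_field_derivative_def
        using linear_scale[OF has_derivative_linear[OF fd[OF y]]]
        by (simp add: mult_commute_abs)
    qed
    have hd: "(h has_real_derivative (frechet_derivative f (at (x + r *\<^sub>R a + t *\<^sub>R b)) a
          - frechet_derivative f (at (x + r *\<^sub>R a + 0 *\<^sub>R b)) a)) (at r)" if "0 \<le> r" "r \<le> t" for r
      unfolding h_def by (rule DERIV_diff[OF fr1 fr1]) (use that t in auto)
    obtain r where r: "0 < r" "r < t" "h t - h 0 = (t - 0) * (frechet_derivative f (at (x + r *\<^sub>R a + t *\<^sub>R b)) a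
          - frechet_derivative f (at (x + r *\<^sub>R a + 0 *\<^sub>R b)) a)"
      using MVT2[OF t hd] by blast
    define k where "k s = frechet_derivative f (at (x + r *\<^sub>R a + s *\<^sub>R b)) a" for s
    have kd: "(k has_real_derivative D a b (x + r *\<^sub>R a + s *\<^sub>R b)) (at s)" if "0 \<le> s" "s \<le> t" for s
    proof -
      have y: "x + r *\<^sub>R a + s *\<^sub>R b \<in> S" using r that by (intro inS) auto
      have "(k has_derivative (\<lambda>c. D a (c *\<^sub>R b) (x + r *\<^sub>R a + s *\<^sub>R b))) (at s)"
        unfolding k_def
      proof (rule has_derivative_compose[of "\<lambda>s. x + r *\<^sub>R a + s *\<^sub>R b" "\<lambda>c. c *\<^sub>R b"])
        show "((\<lambda>s. x + r *\<^sub>R a + s *\<^sub>R b) has_derivative (\<lambda>c. c *\<^sub>R b)) (at s)"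
          by (auto intro!: derivative_eq_intros)
      qed (rule fdd[OF y])
      then show ?thesis unfolding has_field_derivative_def
        using linear_scale[OF has_derivative_linear[OF fdd[OF y]]]
        by (simp add: mult_commute_abs)
    qed
    obtain s where s: "0 < s" "s < t" "k t - k 0 = (t - 0) * D a b (x + r *\<^sub>R a + s *\<^sub>R b)"
      using MVT2[OF t kd] by blast
    have "f (x + t *\<^sub>R a + t *\<^sub>R b) - f (x + t *\<^sub>R a) - f (x + t *\<^sub>R b) + f x = h t - h 0"
      by (simp add: h_def)
    also have "\<dots> = t * (k t - k 0)" using r(3) by (simp add: k_def)
    also have "\<dots> = t * t * D a b (x + r *\<^sub>R a + s *\<^sub>R b)" using s(3) by simp
    finally show ?thesis using r s by (intro exI[of _ r] exI[of _ s]) auto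
  qed
  have S1: "x + r *\<^sub>R u + s *\<^sub>R v \<in> S" if "0 \<le> r" "r \<le> t" "0 \<le> s" "s \<le> t" for r s
    using near[OF that] d3(2) by (simp add: d_def)
  have S2: "x + r *\<^sub>R v + s *\<^sub>R u \<in> S" if "0 \<le> r" "r \<le> t" "0 \<le> s" "s \<le> t" for r s
    using S1[of s r] that by (simp add: algebra_simps)
  obtain r s where 1: "0 \<le> r" "r \<le> t" "0 \<le> s" "s \<le> t"
      "f (x + t *\<^sub>R u + t *\<^sub>R v) - f (x + t *\<^sub>R u) - f (x + t *\<^sub>R v) + f x = t * t * D u v (x + r *\<^sub>R u + s *\<^sub>R v)"
    using key[OF S1] by blast
  obtain r' s' where 2: "0 \<le> r'" "r' \<le> t" "0 \<le> s'" "s' \<le> t"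
      "f (x + t *\<^sub>R v + t *\<^sub>R u) - f (x + t *\<^sub>R v) - f (x + t *\<^sub>R u) + f x = t * t * D v u (x + r' *\<^sub>R v + s' *\<^sub>R u)"
    using key[OF S2] by blast
  have "t * t * D u v (x + r *\<^sub>R u + s *\<^sub>R v) = t * t * D v u (x + r' *\<^sub>R v + s' *\<^sub>R u)"
    using 1(5) 2(5) by (simp add: algebra_simps)
  then have eq: "D u v (x + r *\<^sub>R u + s *\<^sub>R v) = D v u (x + s' *\<^sub>R u + r' *\<^sub>R v)"
    using t by (simp add: algebra_simps)
  have "dist (D u v (x + r *\<^sub>R u + s *\<^sub>R v)) (D u v x) < e"
    using 1 near[of r s] S1 by (intro d1(2)) (auto simp: d_def)
  moreover have "dist (D v u (x + s' *\<^sub>R u + r' *\<^sub>R v)) (D v u x) < e"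
    using 2 near[of s' r'] S1 by (intro d2(2)) (auto simp: d_def)
  ultimately show False using eq ne unfolding e_def dist_real_def by (auto simp: abs_if split: if_splits)
qed

lemma frechet_derivative_linear_comp:
  assumes "bounded_linear L" "f differentiable (at x)"
  shows "frechet_derivative (\<lambda>y. L (f y)) (at x) v = L (frechet_derivative f (at x) v)"
  using frechet_derivative_at[OF bounded_linear.has_derivative[OF assms(1)
      assms(2)[unfolded frechet_derivative_works]]] by metis

lemma second_derivative_symmetric:
  fixes f :: "'a::real_normed_vector \<Rightarrow> 'b::euclidean_space"
  assumes "open S" "C_k_on 2 S f" "x \<in> S"
  shows "frechet_derivative (\<lambda>y. frechet_derivative f (at y) u) (at x) v =
         frechet_derivative (\<lambda>y. frechet_derivative f (at y) v) (at x) u"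
proof (rule euclidean_eqI)
  fix b :: 'b assume "b \<in> Basis"
  have bl: "bounded_linear (\<lambda>z. z \<bullet> b)" by (rule bounded_linear_inner_left)
  have 2: "C_k_on 2 S (\<lambda>y. f y \<bullet> b)" using C_k_on_linear_comp[OF assms(1) bl assms(2)] .
  have d: "f differentiable (at y)" if "y \<in> S" for y using assms(2) that by (simp add: numeral_2_eq_2)
  have dd: "(\<lambda>y. frechet_derivative f (at y) u) differentiable (at x)" for u
    using assms(2,3) by (simp add: numeral_2_eq_2)
  have *: "frechet_derivative (\<lambda>y. frechet_derivative (\<lambda>y. f y \<bullet> b) (at y) u) (at x) v
      = frechet_derivative (\<lambda>y. frechet_derivative f (at y) u) (at x) v \<bullet> b" for u v
  proof -
    have "frechet_derivative (\<lambda>y. frechet_derivative (\<lambda>y. f y \<bullet> b) (at y) u) (at x)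
       = frechet_derivative (\<lambda>y. frechet_derivative f (at y) u \<bullet> b) (at x)"
      by (rule frechet_derivative_cong_open[OF assms(1,3)]) (rule frechet_derivative_linear_comp[OF bl d])
    then show ?thesis using frechet_derivative_linear_comp[OF bl dd] by simp
  qed
  show "frechet_derivative (\<lambda>y. frechet_derivative f (at y) u) (at x) v \<bullet> b =
        frechet_derivative (\<lambda>y. frechet_derivative f (at y) v) (at x) u \<bullet> b"
    using second_derivative_symmetric_real[OF assms(1) 2 assms(3), of u v] * by simp
qed

section \<open>Determinants and the wedge product\<close>

lemma exhaust_7:
  fixes x :: 7
  shows "x = 1 \<or> x = 2 \<or> x = 3 \<or> x = 4 \<or> x = 5 \<or> x = 6 \<or> x = 7"
proof (induct x)
  case (of_int z)
  \<comment> \<open>The representatives are 0, ..., 6; the first of them is the index 7, since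
    \<open>7 = 0\<close> in this type.\<close>
  then have "z = 0 \<or> z = 1 \<or> z = 2 \<or> z = 3 \<or> z = 4 \<or> z = 5 \<or> z = 6" by fastforce
  then show ?case by auto
qed

lemma forall_7: "(\<forall>i::7. P i) \<longleftrightarrow> P 1 \<and> P 2 \<and> P 3 \<and> P 4 \<and> P 5 \<and> P 6 \<and> P 7"
  by (metis exhaust_7)

lemma UNIV_7: "UNIV = {1, 2, 3, 4, 5, 6, 7::7}"
  using exhaust_7 by auto

lemma sum_7: "sum f (UNIV::7 set) = f 1 + f 2 + f 3 + f 4 + f 5 + f 6 + f 7"
  unfolding UNIV_7 by (simp add: ac_simps)

lemma prod_7: "prod f (UNIV::7 set) = f 1 * f 2 * f 3 * f 4 * f 5 * f 6 * f 7"
  unfolding UNIV_7 by (simp add: ac_simps)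

text \<open>Applied to covectors this is the coefficient of their wedge product, applied to vectors
  the standard volume form. Separate arguments let multilinearity be used as seven instances of
  \<open>linear\<close>.\<close>

definition det7 :: "real^7 \<Rightarrow> real^7 \<Rightarrow> real^7 \<Rightarrow> real^7 \<Rightarrow> real^7 \<Rightarrow> real^7 \<Rightarrow> real^7 \<Rightarrow> real" where
  "det7 a b c d e f h = det (\<chi> i. if i = 1 then a else if i = 2 then b else if i = 3 then c
     else if i = 4 then d else if i = 5 then e else if i = 6 then f else h)"

lemma det7_expand:
  "det7 a b c d e f h = (\<Sum>p | p permutes (UNIV :: 7 set). of_int (sign p) *
     (a$(p 1) * b$(p 2) * c$(p 3) * d$(p 4) * e$(p 5) * f$(p 6) * h$(p 7)))"
  unfolding det7_def det_def prod_7 by (rule sum.cong) simp_all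

lemma det7_linear:
  "linear (\<lambda>x. det7 x b c d e f h)" "linear (\<lambda>x. det7 a x c d e f h)"
  "linear (\<lambda>x. det7 a b x d e f h)" "linear (\<lambda>x. det7 a b c x e f h)"
  "linear (\<lambda>x. det7 a b c d x f h)" "linear (\<lambda>x. det7 a b c d e x h)"
  "linear (\<lambda>x. det7 a b c d e f x)"
  by (rule linearI; simp add: det7_expand sum.distrib[symmetric] sum_distrib_left algebra_simps)+

lemma det7_vector_matrix_mult:
  "det7 (a v* P) (b v* P) (c v* P) (d v* P) (e v* P) (f v* P) (h v* P) = det7 a b c d e f h * det P"
proof -
  let ?A = "\<lambda>a b c d e f h. (\<chi> i. if i = (1::7) then a else if i = 2 then b else if i = 3 then c
     else if i = 4 then d else if i = 5 then e else if i = 6 then f else h) :: real^7^7"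
  have "?A (a v* P) (b v* P) (c v* P) (d v* P) (e v* P) (f v* P) (h v* P) = ?A a b c d e f h ** P"
    by (auto simp: vec_eq_iff matrix_matrix_mult_def vector_matrix_mult_def mult.commute)
  then show ?thesis unfolding det7_def by (simp add: det_mul)
qed

lemma axis_vector_matrix_mult: "axis l (1::real) v* P = P $ l"
  by (simp add: vec_eq_iff vector_matrix_mult_def axis_def if_distrib[of "\<lambda>x. x * _"] cong: if_cong)

lemma det7_rows:
  "det7 (P$l) (P$m) (P$n) (P$k) (P$q) (P$r) (P$s) =
   det7 (axis l 1) (axis m 1) (axis n 1) (axis k 1) (axis q 1) (axis r 1) (axis s 1) * det P"
  using det7_vector_matrix_mult[of "axis l 1" P "axis m 1" "axis n 1" "axis k 1" "axis q 1" "axis r 1" "axis s 1"]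
  by (simp add: axis_vector_matrix_mult)

section \<open>Pullback of forms and of the wedge product\<close>

definition tensor_prod3 :: "covec \<Rightarrow> covec \<Rightarrow> covec \<Rightarrow> ten3" where
  "tensor_prod3 X Y Z = (\<chi> i j k. X$i * Y$j * Z$k)"

definition pullback2 :: "real^7^7 \<Rightarrow> ten2 \<Rightarrow> ten2" where
  "pullback2 J a = (\<chi> i j. \<Sum>l\<in>UNIV. \<Sum>m\<in>UNIV. J$l$i * J$m$j * a$l$m)"

lemma pullback2_tensor_prod:
  "pullback2 P a = (\<Sum>l\<in>UNIV. \<Sum>m\<in>UNIV. a$l$m *\<^sub>R tensor_prod (P$l) (P$m))"
  by (simp add: pullback2_def tensor_prod_def vec_eq_iff sum_component mult_ac)

lemma pullback3_tensor_prod: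
  "pullback3 P a = (\<Sum>l\<in>UNIV. \<Sum>m\<in>UNIV. \<Sum>n\<in>UNIV. a$l$m$n *\<^sub>R tensor_prod3 (P$l) (P$m) (P$n))"
  by (simp add: pullback3_def tensor_prod3_def vec_eq_iff sum_component mult_ac)

lemma wedge223_linear:
  "linear (\<lambda>x. wedge223 x b c)" "linear (\<lambda>x. wedge223 a x c)" "linear (\<lambda>x. wedge223 a b x)"
  by (rule linearI; simp add: wedge223_def sum.distrib[symmetric] sum_distrib_left sum_divide_distrib algebra_simps add_divide_distrib)+

lemma wedge223_tensor_prod:
  "wedge223 (tensor_prod a b) (tensor_prod c d) (tensor_prod3 e f h) = det7 a b c d e f h / 24"
  by (simp add: wedge223_def tensor_prod_def tensor_prod3_def det7_expand mult_ac)

lemma wedge223_pullback_expand: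
  "wedge223 (pullback2 P a) (pullback2 P b) (pullback3 P c) =
   (\<Sum>q\<in>UNIV. \<Sum>r\<in>UNIV. \<Sum>s\<in>UNIV. c$q$r$s * (\<Sum>n\<in>UNIV. \<Sum>k\<in>UNIV. b$n$k *
     (\<Sum>l\<in>UNIV. \<Sum>m\<in>UNIV. a$l$m *
       (det7 (P$l) (P$m) (P$n) (P$k) (P$q) (P$r) (P$s) / 24))))"
  unfolding pullback2_tensor_prod pullback3_tensor_prod
    linear_sum[OF wedge223_linear(1)] linear_scale[OF wedge223_linear(1)]
    linear_sum[OF wedge223_linear(2)] linear_scale[OF wedge223_linear(2)]
    linear_sum[OF wedge223_linear(3)] linear_scale[OF wedge223_linear(3)] wedge223_tensor_prod
    real_scaleR_def ..

lemma pullback_mat_1 [simp]: "pullback2 (mat 1) a = a" "pullback3 (mat 1) c = c"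
  by (simp_all add: pullback2_def pullback3_def vec_eq_iff mat_def if_distrib[of "(*) _"]
      if_distrib[of "\<lambda>x. x * _"] cong: if_cong)

text \<open>Expanding all three forms into products of covectors makes each term a determinant of
  rows of \<open>P\<close>, which is \<open>det P\<close> times the determinant of the corresponding
  unit rows; the latter sum up to the same expansion at \<open>P = mat 1\<close>.\<close>

lemma wedge223_pullback:
  "wedge223 (pullback2 P a) (pullback2 P b) (pullback3 P c) = det P * wedge223 a b c"
proof -
  have "wedge223 a b c = (\<Sum>q\<in>UNIV. \<Sum>r\<in>UNIV. \<Sum>s\<in>UNIV. c$q$r$s * (\<Sum>n\<in>UNIV. \<Sum>k\<in>UNIV. b$n$k *
     (\<Sum>l\<in>UNIV. \<Sum>m\<in>UNIV. a$l$m *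
       (det7 (axis l 1) (axis m 1) (axis n 1) (axis k 1) (axis q 1) (axis r 1) (axis s 1) / 24))))"
    using wedge223_pullback_expand[of "mat 1" a b c]
      det7_rows[of "mat 1"] by simp
  then show ?thesis
    unfolding wedge223_pullback_expand det7_rows[of P]
    by (simp add: sum_distrib_left mult_ac)
qed

lemma sum_rotate4:
  "(\<Sum>i\<in>A. \<Sum>l\<in>B. \<Sum>m\<in>C. \<Sum>n\<in>D. f i l m n) = (\<Sum>m\<in>C. \<Sum>n\<in>D. \<Sum>l\<in>B. \<Sum>i\<in>A. f i l m n)"
proof -
  have "(\<Sum>i\<in>A. \<Sum>l\<in>B. \<Sum>m\<in>C. \<Sum>n\<in>D. f i l m n) = (\<Sum>i\<in>A. \<Sum>m\<in>C. \<Sum>n\<in>D. \<Sum>l\<in>B. f i l m n)"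
    by (subst sum.swap[of _ C B]) (subst sum.swap[of _ D B], rule refl)
  also have "\<dots> = (\<Sum>m\<in>C. \<Sum>n\<in>D. \<Sum>l\<in>B. \<Sum>i\<in>A. f i l m n)"
    by (subst sum.swap[of _ C A], subst sum.swap[of _ D A], subst sum.swap[of _ B A]) (rule refl)
  finally show ?thesis .
qed

lemma contract3_pullback3: "contract3 X (pullback3 P a) = pullback2 P (contract3 (P *v X) a)"
proof -
  have "(\<Sum>i\<in>UNIV. \<Sum>l\<in>UNIV. \<Sum>m\<in>UNIV. \<Sum>n\<in>UNIV. X$i * (P$l$i * P$m$j * P$n$k * a$l$m$n))
     = (\<Sum>m\<in>UNIV. \<Sum>n\<in>UNIV. \<Sum>l\<in>UNIV. \<Sum>i\<in>UNIV. X$i * (P$l$i * P$m$j * P$n$k * a$l$m$n))" for j k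
    by (rule sum_rotate4)
  then show ?thesis
    by (simp add: vec_eq_iff contract3_def pullback3_def pullback2_def matrix_vector_mult_def
        sum_distrib_left sum_distrib_right mult_ac)
qed

lemma pos_def_invertible:
  fixes g :: "real^'n^'n"
  assumes "\<And>X. X \<noteq> 0 \<Longrightarrow> X \<bullet> (g *v X) > 0"
  shows "invertible g" "det g \<noteq> 0"
proof -
  have "\<forall>x. g *v x = 0 \<longrightarrow> x = 0"
    using assms by (metis inner_zero_right less_irrefl)
  then show "invertible g"
    unfolding invertible_left_inverse matrix_left_invertible_ker .
  then show "det g \<noteq> 0" using invertible_det_nz by blast
qed

text \<open>Equivariance under the general linear group. Matrices of negative determinant are
  covered as well, because \<open>v^2 = det g\<close> leaves both orientations open and
  \<open>v\<close> absorbs the sign.\<close>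

lemma G2_metric_vol_pullback:
  assumes "G2_metric_vol a g v" "det P \<noteq> 0"
  shows "G2_metric_vol (pullback3 P a) (transpose P ** g ** P) (det P * v)"
proof -
  have inner: "X \<bullet> ((transpose P ** g ** P) *v Y) = (P *v X) \<bullet> (g *v (P *v Y))" for X Y
    by (metis dot_lmul_matrix inner_commute matrix_vector_mul_assoc transpose_matrix_vector)
  have "\<forall>X. P *v X = 0 \<longrightarrow> X = 0"
    using assms(2) unfolding invertible_det_nz[symmetric] invertible_left_inverse matrix_left_invertible_ker .
  then have "P *v X \<noteq> 0" if "X \<noteq> 0" for X
    using that by blast
  moreover have "transpose (transpose P ** g ** P) = transpose P ** g ** P"
    using assms(1) by (simp add: G2_metric_vol_def matrix_transpose_mul matrix_mul_assoc)
  moreover have "wedge223 (contract3 X (pullback3 P a)) (contract3 Y (pullback3 P a)) (pullback3 P a)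
     = - 6 * (X \<bullet> ((transpose P ** g ** P) *v Y)) * (det P * v)" for X Y
    using assms(1) unfolding contract3_pullback3 wedge223_pullback inner by (simp add: G2_metric_vol_def)
  ultimately show ?thesis
    using assms(1) by (simp add: G2_metric_vol_def inner det_mul power_mult_distrib power2_eq_square)
qed

text \<open>The signed sum of \<open>f\<close> over the rearrangements of the first \<open>n\<close> entries of a list, evaluated by
  choosing the entries of the rearrangement one after the other.\<close>
primrec alt_sum :: "nat \<Rightarrow> 'a list \<Rightarrow> ('a list \<Rightarrow> real) \<Rightarrow> real" where
  "alt_sum 0 xs f = f []"
| "alt_sum (Suc n) xs f =
     (\<Sum>k<Suc n. (- 1) ^ k * alt_sum n (take k xs @ drop (Suc k) xs) (\<lambda>ys. f (xs ! k # ys)))"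

text \<open>The cycle that sends the head of the list to \<open>xs ! k\<close> and each of the next
  \<open>k\<close> entries to its predecessor, written as a product of \<open>k\<close> adjacent
  transpositions so that its sign can be read off.\<close>

primrec front_cycle :: "'a list \<Rightarrow> nat \<Rightarrow> 'a \<Rightarrow> 'a" where
  "front_cycle xs 0 = id"
| "front_cycle xs (Suc k) = Transposition.transpose (xs ! k) (xs ! Suc k) \<circ> front_cycle xs k"

lemma front_cycle_Suc:
  "front_cycle xs (Suc k) = Transposition.transpose (xs ! k) (xs ! Suc k) \<circ> front_cycle xs k"
  by (simp add: fun_eq_iff)

declare front_cycle.simps(2) [simp del]

lemma map_front_cycle:
  assumes "distinct xs"
  shows "k < length xs \<Longrightarrow> map (front_cycle xs k) xs = xs ! k # take k xs @ drop (Suc k) xs"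
proof (induction k)
  case 0
  then show ?case by (simp add: Cons_nth_drop_Suc)
next
  case (Suc k)
  let ?t = "Transposition.transpose (xs ! k) (xs ! Suc k)"
  have d: "drop (Suc k) xs = xs ! Suc k # drop (Suc (Suc k)) xs"
    using Suc.prems by (simp add: Cons_nth_drop_Suc)
  have xs: "xs = take k xs @ [xs ! k] @ [xs ! Suc k] @ drop (Suc (Suc k)) xs"
    using Suc.prems d id_take_nth_drop[of k xs] by simp
  have "distinct (take k xs @ [xs ! k] @ [xs ! Suc k] @ drop (Suc (Suc k)) xs)"
    using assms xs by argo
  then have fix1: "map ?t (take k xs) = take k xs" "map ?t (drop (Suc (Suc k)) xs) = drop (Suc (Suc k)) xs"
    by (auto intro!: map_idI simp: Transposition.transpose_def)
  have "map (front_cycle xs (Suc k)) xs = map ?t (map (front_cycle xs k) xs)"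
    by (simp add: front_cycle_Suc)
  also have "\<dots> = xs ! Suc k # take k xs @ xs ! k # drop (Suc (Suc k)) xs"
    using Suc d fix1 by simp
  finally show ?case using Suc.prems by (simp add: take_Suc_conv_app_nth)
qed

lemma front_cycle_permutes: "k < length xs \<Longrightarrow> front_cycle xs k permutes set xs"
  by (induction k) (auto simp: permutes_id front_cycle_Suc intro!: permutes_compose permutes_swap_id)

lemma sign_front_cycle:
  assumes "distinct xs"
  shows "k < length xs \<Longrightarrow> sign (front_cycle xs k) = (- 1) ^ k"
proof (induction k)
  case (Suc k)
  have "permutation (front_cycle xs k)"
    using Suc.prems front_cycle_permutes[of k xs] by (auto simp: permutation_permutes)
  moreover have "xs ! k \<noteq> xs ! Suc k" using Suc.prems assms by (simp add: nth_eq_iff_index_eq)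
  ultimately show ?case using Suc
    unfolding front_cycle_Suc by (subst sign_compose) (simp_all add: permutation_swap_id sign_swap_id)
qed simp

text \<open>A Laplace expansion: the permutations are split by the image of the first entry, and
  composition with \<open>front_cycle xs k\<close> removes that entry at the price of the sign
  \<open>(- 1) ^ k\<close>. It makes sums over the permutations of seven indices accessible to
  rewriting.\<close>

lemma sum_permutes_eq_alt_sum:
  "distinct xs \<Longrightarrow> length xs = n \<Longrightarrow>
   (\<Sum>p | p permutes set xs. of_int (sign p) * f (map p xs)) = alt_sum n xs f"
proof (induction n arbitrary: xs f)
  case 0
  have "{p. p permutes ({} :: 'a set)} = {id}" by auto
  then show ?case using 0 by simp
next
  case (Suc n)
  obtain x xs' where xs: "xs = x # xs'" using Suc.prems by (cases xs) auto
  let ?P = "\<lambda>k. {p. p permutes set xs \<and> p x = xs ! k}"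
  let ?ys = "\<lambda>k. take k xs @ drop (Suc k) xs"
  have fin: "finite {p. p permutes set xs}" by (simp add: finite_permutations)
  have un: "{p. p permutes set xs} = (\<Union>k<Suc n. ?P k)"
  proof -
    have "\<exists>k<Suc n. p x = xs ! k" if "p permutes set xs" for p
    proof -
      have "p x \<in> set xs" using permutes_in_image[OF that] xs by simp
      then show ?thesis using Suc.prems by (auto simp: in_set_conv_nth)
    qed
    then show ?thesis by auto
  qed
  have "(\<Sum>p | p permutes set xs. of_int (sign p) * f (map p xs))
      = (\<Sum>k<Suc n. \<Sum>p\<in>?P k. of_int (sign p) * f (map p xs))"
    unfolding un
  proof (rule sum.UNION_disjoint)
    show "\<forall>k\<in>{..<Suc n}. finite (?P k)" using fin by (auto intro: finite_subset)
    show "\<forall>i\<in>{..<Suc n}. \<forall>j\<in>{..<Suc n}. i \<noteq> j \<longrightarrow> ?P i \<inter> ?P j = {}"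
      using Suc.prems by (auto simp: nth_eq_iff_index_eq)
  qed simp
  also have "(\<Sum>p\<in>?P k. of_int (sign p) * f (map p xs))
      = (- 1) ^ k * alt_sum n (?ys k) (\<lambda>ys. f (xs ! k # ys))" if "k < Suc n" for k
  proof -
    have k: "k < length xs" using that Suc.prems by simp
    let ?c = "front_cycle xs k"
    have xs_split: "xs = take k xs @ xs ! k # drop (Suc k) xs" using k by (rule id_take_nth_drop)
    have "distinct (take k xs @ xs ! k # drop (Suc k) xs)" using Suc.prems xs_split by argo
    then have dist: "distinct (?ys k)" and nin: "xs ! k \<notin> set (?ys k)" by auto
    have "set xs = set (take k xs @ xs ! k # drop (Suc k) xs)" using xs_split by argo
    then have set: "set xs = insert (xs ! k) (set (?ys k))" by simp
    have cmap: "map ?c xs = xs ! k # ?ys k" by (rule map_front_cycle[OF Suc.prems(1) k])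
    have cx: "?c x = xs ! k" using cmap xs by simp
    have cp: "?c permutes set xs" by (rule front_cycle_permutes[OF k])
    have bij: "bij_betw (\<lambda>r. r \<circ> ?c) {r. r permutes set (?ys k)} (?P k)"
    proof (rule bij_betw_byWitness[where f' = "\<lambda>p. p \<circ> inv ?c"])
      show "\<forall>a\<in>{r. r permutes set (?ys k)}. (a \<circ> ?c) \<circ> inv ?c = a"
        using permutes_inv_o(1)[OF cp] by (simp add: o_assoc[symmetric])
      show "\<forall>a\<in>?P k. (a \<circ> inv ?c) \<circ> ?c = a"
        using permutes_inv_o(2)[OF cp] by (simp add: o_assoc[symmetric])
      show "(\<lambda>r. r \<circ> ?c) ` {r. r permutes set (?ys k)} \<subseteq> ?P k"
      proof safe
        fix r assume r: "r permutes set (?ys k)"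
        then have "r permutes set xs" unfolding set by (rule permutes_subset) auto
        then show "(r \<circ> ?c) permutes set xs" using cp by (rule permutes_compose[rotated])
        show "(r \<circ> ?c) x = xs ! k" using cx permutes_not_in[OF r nin] by simp
      qed
      show "(\<lambda>p. p \<circ> inv ?c) ` ?P k \<subseteq> {r. r permutes set (?ys k)}"
      proof safe
        fix p assume p: "p permutes set xs" "p x = xs ! k"
        have q: "(p \<circ> inv ?c) permutes insert (xs ! k) (set (?ys k))"
          unfolding set[symmetric] by (rule permutes_compose[OF permutes_inv[OF cp] p(1)])
        have "(p \<circ> inv ?c) (xs ! k) = xs ! k"
          using p(2) cx permutes_inverses(2)[OF cp, of x] by simp
        with q show "(p \<circ> inv ?c) permutes set (?ys k)"
          by (auto intro: permutes_superset)
      qed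
    qed
    have "(\<Sum>p\<in>?P k. of_int (sign p) * f (map p xs))
        = (\<Sum>r | r permutes set (?ys k). of_int (sign (r \<circ> ?c)) * f (map (r \<circ> ?c) xs))"
      by (rule sum.reindex_bij_betw[OF bij, symmetric])
    also have "\<dots> = (\<Sum>r | r permutes set (?ys k). (- 1) ^ k * (of_int (sign r) * f (xs ! k # map r (?ys k))))"
    proof (rule sum.cong[OF refl], clarify)
      fix r assume r: "r permutes set (?ys k)"
      have "map (r \<circ> ?c) xs = map r (map ?c xs)" by simp
      also have "\<dots> = xs ! k # map r (?ys k)" unfolding cmap using permutes_not_in[OF r nin] by simp
      finally have m: "map (r \<circ> ?c) xs = xs ! k # map r (?ys k)" .
      have "sign (r \<circ> ?c) = sign r * (- 1) ^ k"
        using r cp sign_front_cycle[OF Suc.prems(1) k]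
        by (subst sign_compose) (auto simp: permutation_permutes)
      with m show "of_int (sign (r \<circ> ?c)) * f (map (r \<circ> ?c) xs)
          = (- 1) ^ k * (of_int (sign r) * f (xs ! k # map r (?ys k)))" by simp
    qed
    also have "\<dots> = (- 1) ^ k * alt_sum n (?ys k) (\<lambda>ys. f (xs ! k # ys))"
      unfolding sum_distrib_left[symmetric]
      using Suc.IH[OF dist, of "\<lambda>ys. f (xs ! k # ys)"] k Suc.prems by simp
    finally show ?thesis .
  qed
  then have "(\<Sum>k<Suc n. \<Sum>p\<in>?P k. of_int (sign p) * f (map p xs)) = alt_sum (Suc n) xs f"
    unfolding alt_sum.simps by (intro sum.cong) auto
  finally show ?case .
qed

section \<open>The wedge product as a sum over shuffles\<close>

lemma alternating3_swap:
  assumes "alternating3 a"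
  shows "a$i$j$k = - a$j$i$k" "a$i$j$k = - a$i$k$j" "a$i$i$k = 0" "a$i$k$k = 0"
proof -
  have *: "a$i$j$k = - a$j$i$k" "a$i$j$k = - a$i$k$j" for i j k
    using assms unfolding alternating3_def by blast+
  show "a$i$j$k = - a$j$i$k" "a$i$j$k = - a$i$k$j" by (rule *)+
  show "a$i$i$k = 0" "a$i$k$k = 0" using *(1)[of i i k] *(2)[of i k k] by simp_all
qed

text \<open>Oriented rewrite rules that sort numeral indices into increasing order. The indices are
  spelled out because the general antisymmetry laws, used as rewrite rules, would loop.\<close>

lemma alternating3_sort:
  assumes "alternating3 a"
  shows
  "a$2$1$k = - a$1$2$k" "a$k$2$1 = - a$k$1$2" "a$3$1$k = - a$1$3$k" "a$k$3$1 = - a$k$1$3"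
  "a$4$1$k = - a$1$4$k" "a$k$4$1 = - a$k$1$4" "a$5$1$k = - a$1$5$k" "a$k$5$1 = - a$k$1$5"
  "a$6$1$k = - a$1$6$k" "a$k$6$1 = - a$k$1$6" "a$7$1$k = - a$1$7$k" "a$k$7$1 = - a$k$1$7"
  "a$3$2$k = - a$2$3$k" "a$k$3$2 = - a$k$2$3" "a$4$2$k = - a$2$4$k" "a$k$4$2 = - a$k$2$4"
  "a$5$2$k = - a$2$5$k" "a$k$5$2 = - a$k$2$5" "a$6$2$k = - a$2$6$k" "a$k$6$2 = - a$k$2$6"
  "a$7$2$k = - a$2$7$k" "a$k$7$2 = - a$k$2$7" "a$4$3$k = - a$3$4$k" "a$k$4$3 = - a$k$3$4"
  "a$5$3$k = - a$3$5$k" "a$k$5$3 = - a$k$3$5" "a$6$3$k = - a$3$6$k" "a$k$6$3 = - a$k$3$6"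
  "a$7$3$k = - a$3$7$k" "a$k$7$3 = - a$k$3$7" "a$5$4$k = - a$4$5$k" "a$k$5$4 = - a$k$4$5"
  "a$6$4$k = - a$4$6$k" "a$k$6$4 = - a$k$4$6" "a$7$4$k = - a$4$7$k" "a$k$7$4 = - a$k$4$7"
  "a$6$5$k = - a$5$6$k" "a$k$6$5 = - a$k$5$6" "a$7$5$k = - a$5$7$k" "a$k$7$5 = - a$k$5$7"
  "a$7$6$k = - a$6$7$k" "a$k$7$6 = - a$k$6$7" "a$1$1$k = 0" "a$k$1$1 = 0"
  "a$2$2$k = 0" "a$k$2$2 = 0" "a$3$3$k = 0" "a$k$3$3 = 0"
  "a$4$4$k = 0" "a$k$4$4 = 0" "a$5$5$k = 0" "a$k$5$5 = 0"
  "a$6$6$k = 0" "a$k$6$6 = 0" "a$7$7$k = 0" "a$k$7$7 = 0"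
  by (rule alternating3_swap[OF assms])+

text \<open>The component of the 5-form \<open>\<beta> \<and> \<gamma>\<close> at the given indices,
  with one signed term for each of the ten (2,3)-shuffles.\<close>

definition wedge23 :: "ten2 \<Rightarrow> ten3 \<Rightarrow> 7 \<Rightarrow> 7 \<Rightarrow> 7 \<Rightarrow> 7 \<Rightarrow> 7 \<Rightarrow> real" where
  "wedge23 \<beta> \<gamma> a b c d e =
     \<beta>$a$b * \<gamma>$c$d$e - \<beta>$a$c * \<gamma>$b$d$e + \<beta>$a$d * \<gamma>$b$c$e - \<beta>$a$e * \<gamma>$b$c$d + \<beta>$b$c * \<gamma>$a$d$e
     - \<beta>$b$d * \<gamma>$a$c$e + \<beta>$b$e * \<gamma>$a$c$d + \<beta>$c$d * \<gamma>$a$b$e - \<beta>$c$e * \<gamma>$a$b$d + \<beta>$d$e * \<gamma>$a$b$c"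

text \<open>The recursion for explicit numerals and lists, here and up to length 7. It can be
  stopped at an intermediate length, where \<open>alt_sum_3\<close> or \<open>alt_sum_5\<close>
  collapses the remaining sum, so that the 5040 terms never appear.\<close>

lemma alt_sum_step_2:
  "alt_sum 2 [a, b] F = alt_sum 1 [b] (\<lambda>l. F (a # l)) - alt_sum 1 [a] (\<lambda>l. F (b # l))"
proof -
  have "Suc 1 = 2" "{..<2::nat} = {0, 1}" by auto
  then show ?thesis by (simp add: alt_sum.simps(2)[of 1, unfolded \<open>Suc 1 = 2\<close> \<open>{..<2} = _\<close>])
qed

lemma alt_sum_step_3:
  "alt_sum 3 [a, b, c] F = alt_sum 2 [b, c] (\<lambda>l. F (a # l)) - alt_sum 2 [a, c] (\<lambda>l. F (b # l)) + alt_sum 2 [a, b] (\<lambda>l. F (c # l))"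
proof -
  have "Suc 2 = 3" "{..<3::nat} = {0, 1, 2}" by auto
  then show ?thesis by (simp add: alt_sum.simps(2)[of 2, unfolded \<open>Suc 2 = 3\<close> \<open>{..<3} = _\<close>])
qed

lemma alt_sum_step_4:
  "alt_sum 4 [a, b, c, d] F = alt_sum 3 [b, c, d] (\<lambda>l. F (a # l)) - alt_sum 3 [a, c, d] (\<lambda>l. F (b # l)) + alt_sum 3 [a, b, d] (\<lambda>l. F (c # l)) - alt_sum 3 [a, b, c] (\<lambda>l. F (d # l))"
proof -
  have "Suc 3 = 4" "{..<4::nat} = {0, 1, 2, 3}" by auto
  then show ?thesis by (simp add: alt_sum.simps(2)[of 3, unfolded \<open>Suc 3 = 4\<close> \<open>{..<4} = _\<close>])
qed

lemma alt_sum_step_5: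
  "alt_sum 5 [a, b, c, d, e] F = alt_sum 4 [b, c, d, e] (\<lambda>l. F (a # l)) - alt_sum 4 [a, c, d, e] (\<lambda>l. F (b # l)) + alt_sum 4 [a, b, d, e] (\<lambda>l. F (c # l)) - alt_sum 4 [a, b, c, e] (\<lambda>l. F (d # l)) + alt_sum 4 [a, b, c, d] (\<lambda>l. F (e # l))"
proof -
  have "Suc 4 = 5" "{..<5::nat} = {0, 1, 2, 3, 4}" by auto
  then show ?thesis by (simp add: alt_sum.simps(2)[of 4, unfolded \<open>Suc 4 = 5\<close> \<open>{..<5} = _\<close>])
qed

lemma alt_sum_step_6:
  "alt_sum 6 [a, b, c, d, e, f] F = alt_sum 5 [b, c, d, e, f] (\<lambda>l. F (a # l)) - alt_sum 5 [a, c, d, e, f] (\<lambda>l. F (b # l)) + alt_sum 5 [a, b, d, e, f] (\<lambda>l. F (c # l)) - alt_sum 5 [a, b, c, e, f] (\<lambda>l. F (d # l)) + alt_sum 5 [a, b, c, d, f] (\<lambda>l. F (e # l)) - alt_sum 5 [a, b, c, d, e] (\<lambda>l. F (f # l))"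
proof -
  have "Suc 5 = 6" "{..<6::nat} = {0, 1, 2, 3, 4, 5}" by auto
  then show ?thesis by (simp add: alt_sum.simps(2)[of 5, unfolded \<open>Suc 5 = 6\<close> \<open>{..<6} = _\<close>])
qed

lemma alt_sum_step_7:
  "alt_sum 7 [a, b, c, d, e, f, g] F = alt_sum 6 [b, c, d, e, f, g] (\<lambda>l. F (a # l)) - alt_sum 6 [a, c, d, e, f, g] (\<lambda>l. F (b # l)) + alt_sum 6 [a, b, d, e, f, g] (\<lambda>l. F (c # l)) - alt_sum 6 [a, b, c, e, f, g] (\<lambda>l. F (d # l)) + alt_sum 6 [a, b, c, d, f, g] (\<lambda>l. F (e # l)) - alt_sum 6 [a, b, c, d, e, g] (\<lambda>l. F (f # l)) + alt_sum 6 [a, b, c, d, e, f] (\<lambda>l. F (g # l))"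
proof -
  have "Suc 6 = 7" "{..<7::nat} = {0, 1, 2, 3, 4, 5, 6}" by auto
  then show ?thesis by (simp add: alt_sum.simps(2)[of 6, unfolded \<open>Suc 6 = 7\<close> \<open>{..<7} = _\<close>])
qed

lemma alt_sum_3:
  assumes "alternating3 \<gamma>"
  shows "alt_sum 3 [a, b, c] (\<lambda>l. C * \<gamma>$(l ! 0)$(l ! 1)$(l ! 2)) = 6 * (C * \<gamma>$a$b$c)"
proof -
  have *: "\<gamma>$a$c$b = - \<gamma>$a$b$c" "\<gamma>$b$a$c = - \<gamma>$a$b$c" "\<gamma>$b$c$a = \<gamma>$a$b$c"
    "\<gamma>$c$a$b = \<gamma>$a$b$c" "\<gamma>$c$b$a = - \<gamma>$a$b$c"
    using assms unfolding alternating3_def by (metis add.inverse_inverse)+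
  show ?thesis by (simp add: alt_sum_step_3 alt_sum_step_2 *)
qed

lemma alt_sum_3':
  assumes "alternating3 \<gamma>"
  shows "alt_sum 3 [a, b, c] (\<lambda>l. C * (D * \<gamma>$(l ! 0)$(l ! Suc 0)$(l ! 2))) = 6 * (C * (D * \<gamma>$a$b$c))"
  using alt_sum_3[OF assms, of a b c "C * D"] by (simp add: mult.assoc)

text \<open>Each of the ten shuffles occurs \<open>2! 3! = 12\<close> times among the 120
  rearrangements.\<close>

lemma alt_sum_5:
  assumes "transpose \<beta> = - \<beta>" "alternating3 \<gamma>"
  shows "alt_sum 5 [a, b, c, d, e] (\<lambda>l. C * (\<beta>$(l ! 0)$(l ! Suc 0) * \<gamma>$(l ! 2)$(l ! 3)$(l ! 4)))
     = 12 * (C * wedge23 \<beta> \<gamma> a b c d e)"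
proof -
  have sk: "\<beta>$i$j = - \<beta>$j$i" for i j
    using arg_cong[OF assms(1), of "\<lambda>M. M$j$i"] by (simp add: transpose_def)
  show ?thesis
    by (simp add: alt_sum_step_5 alt_sum_step_4 alt_sum_3'[OF assms(2)])
      (simp add: wedge23_def sk[of b a]
       sk[of c a] sk[of d a] sk[of e a] sk[of c b] sk[of d b] sk[of e b] sk[of d c] sk[of e c] sk[of e d] algebra_simps)
qed

text \<open>The 42 ordered choices of the indices of \<open>\<alpha>\<close> pair up to 21, and the
  resulting 2 together with the 12 of \<open>alt_sum_5\<close> cancels the normalisation 24 in
  \<open>wedge223\<close>.\<close>

lemma wedge223_expand:
  assumes "transpose \<alpha> = - \<alpha>" "transpose \<beta> = - \<beta>" "alternating3 \<gamma>"
  shows "wedge223 \<alpha> \<beta> \<gamma> =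
     \<alpha>$1$2 * wedge23 \<beta> \<gamma> 3 4 5 6 7 - \<alpha>$1$3 * wedge23 \<beta> \<gamma> 2 4 5 6 7 + \<alpha>$1$4 * wedge23 \<beta> \<gamma> 2 3 5 6 7
     - \<alpha>$1$5 * wedge23 \<beta> \<gamma> 2 3 4 6 7 + \<alpha>$1$6 * wedge23 \<beta> \<gamma> 2 3 4 5 7 - \<alpha>$1$7 * wedge23 \<beta> \<gamma> 2 3 4 5 6
     + \<alpha>$2$3 * wedge23 \<beta> \<gamma> 1 4 5 6 7 - \<alpha>$2$4 * wedge23 \<beta> \<gamma> 1 3 5 6 7 + \<alpha>$2$5 * wedge23 \<beta> \<gamma> 1 3 4 6 7
     - \<alpha>$2$6 * wedge23 \<beta> \<gamma> 1 3 4 5 7 + \<alpha>$2$7 * wedge23 \<beta> \<gamma> 1 3 4 5 6 + \<alpha>$3$4 * wedge23 \<beta> \<gamma> 1 2 5 6 7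
     - \<alpha>$3$5 * wedge23 \<beta> \<gamma> 1 2 4 6 7 + \<alpha>$3$6 * wedge23 \<beta> \<gamma> 1 2 4 5 7 - \<alpha>$3$7 * wedge23 \<beta> \<gamma> 1 2 4 5 6
     + \<alpha>$4$5 * wedge23 \<beta> \<gamma> 1 2 3 6 7 - \<alpha>$4$6 * wedge23 \<beta> \<gamma> 1 2 3 5 7 + \<alpha>$4$7 * wedge23 \<beta> \<gamma> 1 2 3 5 6
     + \<alpha>$5$6 * wedge23 \<beta> \<gamma> 1 2 3 4 7 - \<alpha>$5$7 * wedge23 \<beta> \<gamma> 1 2 3 4 6 + \<alpha>$6$7 * wedge23 \<beta> \<gamma> 1 2 3 4 5"
proof -
  have sk: "\<alpha>$i$j = - \<alpha>$j$i" for i j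
    using arg_cong[OF assms(1), of "\<lambda>M. M$j$i"] by (simp add: transpose_def)
  have U: "UNIV = set [1, 2, 3, 4, 5, 6, 7 :: 7]" by (simp add: UNIV_7)
  have "wedge223 \<alpha> \<beta> \<gamma> = (\<Sum>p | p permutes (UNIV :: 7 set). of_int (sign p) *
       (\<lambda>l. \<alpha>$(l ! 0)$(l ! Suc 0) * (\<beta>$(l ! 2)$(l ! 3) * \<gamma>$(l ! 4)$(l ! 5)$(l ! 6))) (map p [1, 2, 3, 4, 5, 6, 7])) / 24"
    by (simp add: wedge223_def mult.assoc)
  also have "\<dots> = alt_sum 7 [1, 2, 3, 4, 5, 6, 7]
       (\<lambda>l. \<alpha>$(l ! 0)$(l ! Suc 0) * (\<beta>$(l ! 2)$(l ! 3) * \<gamma>$(l ! 4)$(l ! 5)$(l ! 6))) / 24"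
    unfolding U by (subst sum_permutes_eq_alt_sum) simp_all
  finally show ?thesis
    by (simp add: alt_sum_step_7 alt_sum_step_6 alt_sum_5[OF assms(2,3)])
      (simp add: sk[of 2 1]
       sk[of 3 1] sk[of 4 1] sk[of 5 1] sk[of 6 1] sk[of 7 1] sk[of 3 2] sk[of 4 2] sk[of 5 2] sk[of 6 2] sk[of 7 2]
       sk[of 4 3] sk[of 5 3] sk[of 6 3] sk[of 7 3] sk[of 5 4] sk[of 6 4] sk[of 7 4] sk[of 6 5] sk[of 7 5] sk[of 7 6])
qed

text \<open>Prescribing the last four values of the permutation amounts to unit rows in a
  determinant: the product of their entries is 1 for the prescribed values and 0 otherwise. In this
  form multilinearity and the product formula for \<open>det\<close> apply.\<close>

lemma hodge_star3_det7:
  "hodge_star3 g v a $ i $ j $ k $ l = v / 6 * (\<Sum>q\<in>UNIV. \<Sum>r\<in>UNIV. \<Sum>s\<in>UNIV. a$q$r$s *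
     det7 (column q (ginv g)) (column r (ginv g)) (column s (ginv g)) (axis i 1) (axis j 1) (axis k 1) (axis l 1))"
proof -
  let ?I = "ginv g" and ?P = "{p. p permutes (UNIV :: 7 set)}"
  let ?t = "\<lambda>p q r s. of_int (sign p) * (?I $ p 1 $ q * ?I $ p 2 $ r * ?I $ p 3 $ s * a$q$r$s)"
  let ?d = "\<lambda>p. axis i (1::real) $ p 4 * axis j 1 $ p 5 * axis k 1 $ p 6 * axis l 1 $ p 7"
  have fin: "finite ?P" by (simp add: finite_permutations)
  have "(\<Sum>p | p permutes (UNIV :: 7 set) \<and> p 4 = i \<and> p 5 = j \<and> p 6 = k \<and> p 7 = l.
        of_int (sign p) * (\<Sum>q\<in>UNIV. \<Sum>r\<in>UNIV. \<Sum>s\<in>UNIV. ?I $ (p 1) $ q * ?I $ (p 2) $ r * ?I $ (p 3) $ s * a$q$r$s))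
      = (\<Sum>p\<in>{p\<in>?P. p 4 = i \<and> p 5 = j \<and> p 6 = k \<and> p 7 = l}. \<Sum>q\<in>UNIV. \<Sum>r\<in>UNIV. \<Sum>s\<in>UNIV. ?t p q r s)"
    by (simp add: sum_distrib_left)
  also have "\<dots> = (\<Sum>p\<in>?P. \<Sum>q\<in>UNIV. \<Sum>r\<in>UNIV. \<Sum>s\<in>UNIV. ?t p q r s * ?d p)"
    unfolding sum.inter_filter[OF fin] by (rule sum.cong) (auto simp: axis_def)
  also have "\<dots> = (\<Sum>q\<in>UNIV. \<Sum>r\<in>UNIV. \<Sum>s\<in>UNIV. \<Sum>p\<in>?P. ?t p q r s * ?d p)"
    by (subst sum.swap[of _ UNIV ?P], subst sum.swap[of _ UNIV ?P], subst sum.swap[of _ UNIV ?P]) (rule refl)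
  also have "\<dots> = (\<Sum>q\<in>UNIV. \<Sum>r\<in>UNIV. \<Sum>s\<in>UNIV. a$q$r$s *
     det7 (column q ?I) (column r ?I) (column s ?I) (axis i 1) (axis j 1) (axis k 1) (axis l 1))"
    unfolding det7_expand sum_distrib_left by (intro sum.cong refl) (simp add: column_def mult_ac)
  finally show ?thesis by (simp add: hodge_star3_def)
qed

section \<open>Normal form of a nondegenerate 3-form\<close>

lemma exists_unit_orthogonal:
  fixes S :: "(real^7) set"
  assumes "finite S" "card S < 7"
  shows "\<exists>u. norm u = 1 \<and> (\<forall>s\<in>S. s \<bullet> u = 0)"
proof -
  have "dim S < DIM(real^7)" using dim_le_card'[OF assms(1)] assms(2) by simp
  then obtain x where x: "x \<noteq> 0" "\<And>y. y \<in> span S \<Longrightarrow> orthogonal x y"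
    using orthogonal_to_subspace_exists by metis
  then have "\<forall>s\<in>S. s \<bullet> x = 0" by (simp add: span_base orthogonal_def inner_commute)
  then show ?thesis using x(1) by (intro exI[of _ "x /\<^sub>R norm x"]) simp
qed

lemma linear_functional_on_subspace:
  fixes l :: "'a::euclidean_space \<Rightarrow> real"
  assumes "linear l" "subspace V"
  shows "\<exists>n\<in>V. \<forall>k\<in>V. l k = n \<bullet> k"
proof -
  define w where "w = (\<Sum>b\<in>Basis. l b *\<^sub>R b)"
  have w: "l k = w \<bullet> k" for k
  proof -
    have "l k = l (\<Sum>b\<in>Basis. (k \<bullet> b) *\<^sub>R b)" by (simp add: euclidean_representation)
    also have "\<dots> = w \<bullet> k"
      by (simp add: w_def linear_sum[OF assms(1)] linear_scale[OF assms(1)] inner_sum_left inner_commute[of k] mult.commute)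
    finally show ?thesis .
  qed
  obtain n z where nz: "n \<in> span V" "\<And>k. k \<in> span V \<Longrightarrow> orthogonal z k" "w = n + z"
    using orthogonal_subspace_decomp_exists[of V w] by metis
  have "l k = n \<bullet> k" if "k \<in> V" for k
    using nz(2)[OF span_base[OF that]] by (simp add: w nz(3) inner_add_left orthogonal_def)
  moreover have "n \<in> V" using nz(1) assms(2) span_eq_iff by blast
  ultimately show ?thesis by blast
qed

text \<open>The Lagrange condition at a maximum over the unit ball, by linear algebra: if
  \<open>n\<close> represents \<open>l\<close> on \<open>V\<close>, maximality gives
  \<open>norm n \<le> l x\<close>, which forces equality in Cauchy-Schwarz, so \<open>n\<close> is
  \<open>l x\<close> times \<open>x\<close>.\<close>

lemma linear_functional_max:
  fixes l :: "'a::euclidean_space \<Rightarrow> real"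
  assumes "linear l" "subspace V" "x \<in> V" "norm x \<le> 1"
    and max: "\<And>y. y \<in> V \<Longrightarrow> norm y \<le> 1 \<Longrightarrow> l y \<le> l x" and "k \<in> V"
  shows "l k = l x * (x \<bullet> k)"
proof -
  obtain n where n: "n \<in> V" "\<And>k. k \<in> V \<Longrightarrow> l k = n \<bullet> k"
    using linear_functional_on_subspace[OF assms(1,2)] by blast
  have nm: "norm n \<le> l x"
  proof (cases "n = 0")
    case True
    then show ?thesis using n(2)[OF assms(3)] by simp
  next
    case False
    have "l (n /\<^sub>R norm n) \<le> l x"
      by (rule max) (use False n(1) subspace_scale[OF assms(2)] in auto)
    moreover have "l (n /\<^sub>R norm n) = norm n"
      using False n subspace_scale[OF assms(2)]
      by (simp add: n(2) power2_norm_eq_inner[symmetric] power2_eq_square)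
    ultimately show ?thesis by simp
  qed
  have m: "n \<bullet> x = l x" using n(2)[OF assms(3)] by simp
  have "(norm (n - l x *\<^sub>R x))\<^sup>2 = (norm n)\<^sup>2 - 2 * (l x)\<^sup>2 + (l x)\<^sup>2 * (norm x)\<^sup>2"
    unfolding power2_norm_eq_inner
    by (simp add: inner_diff_left inner_diff_right inner_commute[of x n] m power2_eq_square algebra_simps)
  also have "\<dots> \<le> (l x)\<^sup>2 - 2 * (l x)\<^sup>2 + (l x)\<^sup>2 * 1"
    by (intro add_mono diff_right_mono power_mono mult_left_mono) (use nm assms(4) in \<open>auto simp: power_le_one\<close>)
  finally have "n = l x *\<^sub>R x" by simp
  then show ?thesis using n(2)[OF assms(6)] by simp
qed

definition eval3 :: "ten3 \<Rightarrow> real^7 \<Rightarrow> real^7 \<Rightarrow> real^7 \<Rightarrow> real" where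
  "eval3 a x y z = (\<Sum>i\<in>UNIV. \<Sum>j\<in>UNIV. \<Sum>k\<in>UNIV. x$i * y$j * z$k * a$i$j$k)"

lemma eval3_linear:
  "linear (\<lambda>x. eval3 a x y z)" "linear (\<lambda>y. eval3 a x y z)" "linear (eval3 a x y)"
  by (rule linearI; simp add: eval3_def sum.distrib sum_distrib_left algebra_simps)+

lemma eval3_alternating:
  assumes "alternating3 a"
  shows "eval3 a x z y = - eval3 a x y z" "eval3 a y x z = - eval3 a x y z"
    "eval3 a x x z = 0" "eval3 a x y y = 0"
proof -
  note sw = alternating3_swap(1,2)[OF assms]
  show 1: "eval3 a x z y = - eval3 a x y z" for x y z
  proof -
    have "eval3 a x z y = (\<Sum>i\<in>UNIV. \<Sum>k\<in>UNIV. \<Sum>j\<in>UNIV. x$i * z$j * y$k * a$i$j$k)"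
      unfolding eval3_def by (rule sum.cong[OF refl], rule sum.swap)
    also have "\<dots> = - eval3 a x y z"
      unfolding eval3_def sum_negf[symmetric]
      by (intro sum.cong refl) (subst sw(2), simp add: mult_ac)
    finally show ?thesis .
  qed
  show 2: "eval3 a y x z = - eval3 a x y z" for x y z
  proof -
    have "eval3 a y x z = (\<Sum>j\<in>UNIV. \<Sum>i\<in>UNIV. \<Sum>k\<in>UNIV. y$i * x$j * z$k * a$i$j$k)"
      unfolding eval3_def by (rule sum.swap)
    also have "\<dots> = - eval3 a x y z"
      unfolding eval3_def sum_negf[symmetric]
      by (intro sum.cong refl) (subst sw(1), simp add: mult_ac)
    finally show ?thesis .
  qed
  show "eval3 a x x z = 0" "eval3 a x y y = 0" using 1[of x y y] 2[of x x z] by simp_all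
qed

lemma eval3_axis: "eval3 a (axis i 1) (axis j 1) (axis k 1) = a$i$j$k"
proof -
  have "axis i (1::real) $ p * axis j 1 $ q * axis k 1 $ r * a$p$q$r
      = (if r = k then if q = j then if p = i then a$i$j$k else 0 else 0 else 0)" for p q r
    by (simp add: axis_def)
  then show ?thesis by (simp add: eval3_def)
qed

lemma continuous_on_eval3:
  "continuous_on S f \<Longrightarrow> continuous_on S g \<Longrightarrow> continuous_on S h \<Longrightarrow> continuous_on S (\<lambda>x. eval3 a (f x) (g x) (h x))"
  unfolding eval3_def by (intro continuous_intros)

lemma linear_norm_bound_eq_0:
  fixes l :: "'a::real_normed_vector \<Rightarrow> real"
  assumes "linear l" "\<And>y. y \<in> V \<Longrightarrow> norm y \<le> 1 \<Longrightarrow> l y = 0" "subspace V" "y \<in> V"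
  shows "l y = 0"
proof (cases "y = 0")
  case True then show ?thesis using linear_0[OF assms(1)] by simp
next
  case False
  have "l (y /\<^sub>R norm y) = 0" using False subspace_scale[OF assms(3,4)] by (intro assms(2)) auto
  then show ?thesis using False by (simp add: linear_scale[OF assms(1)])
qed

text \<open>A maximiser over the product of three unit balls exists by compactness, and
  \<open>linear_functional_max\<close> in each slot gives the three functional identities.
  Orthogonality follows by inserting one of the vectors for \<open>k\<close>, since the form
  vanishes on repeated arguments.\<close>

lemma alternating3_max:
  assumes alt: "alternating3 a" and "a \<noteq> 0"
  shows "\<exists>x y z L. L > 0 \<and> norm x = 1 \<and> norm y = 1 \<and> norm z = 1 \<and> x \<bullet> y = 0 \<and> x \<bullet> z = 0 \<and> y \<bullet> z = 0 \<and>
    (\<forall>k. eval3 a k y z = L * (x \<bullet> k)) \<and> (\<forall>k. eval3 a x k z = L * (y \<bullet> k)) \<and> (\<forall>k. eval3 a x y k = L * (z \<bullet> k))"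
proof -
  let ?B = "cball (0 :: real^7) 1"
  have "compact (?B \<times> ?B \<times> ?B)" by (intro compact_Times compact_cball)
  moreover have "continuous_on (?B \<times> ?B \<times> ?B) (\<lambda>p. eval3 a (fst p) (fst (snd p)) (snd (snd p)))"
    by (intro continuous_on_eval3 continuous_intros)
  ultimately obtain p where p: "p \<in> ?B \<times> ?B \<times> ?B" "\<forall>q\<in>?B \<times> ?B \<times> ?B.
      eval3 a (fst q) (fst (snd q)) (snd (snd q)) \<le> eval3 a (fst p) (fst (snd p)) (snd (snd p))"
    using continuous_attains_sup[of "?B \<times> ?B \<times> ?B"] by (metis (no_types, lifting) SigmaI centre_in_cball empty_iff zero_le_one)
  define x y z where "x = fst p" and "y = fst (snd p)" and "z = snd (snd p)"
  define L where "L = eval3 a x y z"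
  have n: "norm x \<le> 1" "norm y \<le> 1" "norm z \<le> 1" using p(1) by (auto simp: x_def y_def z_def)
  have max: "eval3 a x' y' z' \<le> L" if "norm x' \<le> 1" "norm y' \<le> 1" "norm z' \<le> 1" for x' y' z'
    using p(2)[rule_format, of "(x', y', z')"] that by (simp add: L_def x_def y_def z_def)
  have k1: "eval3 a k y z = L * (x \<bullet> k)" for k
    unfolding L_def
    by (rule linear_functional_max[OF eval3_linear(1) subspace_UNIV]) (use n max L_def in auto)
  have k2: "eval3 a x k z = L * (y \<bullet> k)" for k
    unfolding L_def
    by (rule linear_functional_max[OF eval3_linear(2) subspace_UNIV]) (use n max L_def in auto)
  have k3: "eval3 a x y k = L * (z \<bullet> k)" for k
    unfolding L_def
    by (rule linear_functional_max[OF eval3_linear(3) subspace_UNIV]) (use n max L_def in auto)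
  \<comment> \<open>Changing the sign of one argument turns the bound by 0 into equality, so a
    vanishing maximum would make \<open>a\<close> vanish.\<close>
  have "L \<noteq> 0"
  proof
    assume "L = 0"
    then have le: "eval3 a x' y' z' \<le> 0" if "norm x' \<le> 1" "norm y' \<le> 1" "norm z' \<le> 1" for x' y' z'
      using max[OF that] by simp
    have "eval3 a x' y' z' = 0" if "norm x' \<le> 1" "norm y' \<le> 1" "norm z' \<le> 1" for x' y' z'
      using le[OF that] le[of "- x'" y' z'] that linear_neg[OF eval3_linear(1)[of a y' z'], of x'] by simp
    then have "a $ i $ j $ k = 0" for i j k
      using eval3_axis[of a i j k] by simp
    then show False using assms(2) by (simp add: vec_eq_iff)
  qed
  moreover have "L \<ge> 0" using max[of 0 0 0] by (simp add: linear_0[OF eval3_linear(1)])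
  ultimately have L: "L > 0" by simp
  have "norm x = 1" "norm y = 1" "norm z = 1"
    using k1[of x] k2[of y] k3[of z] L by (simp_all add: L_def[symmetric] norm_eq_1)
  moreover have "x \<bullet> y = 0" "x \<bullet> z = 0" "y \<bullet> z = 0"
    using k1[of y] k1[of z] k2[of z] L eval3_alternating(1)[OF alt, of z z y] eval3_alternating(3,4)[OF alt]
    by simp_all
  ultimately show ?thesis using L k1 k2 k3
    by (intro exI[of _ x] exI[of _ y] exI[of _ z] exI[of _ L] conjI) simp_all
qed

text \<open>The analogue of \<open>alternating3_max\<close> on the orthogonal complement of
  \<open>S\<close>. If the maximum is zero, then \<open>w\<close> vanishes there and any orthonormal
  pair serves; the bound on \<open>card S\<close> leaves room for one.\<close>

lemma alternating2_max:
  fixes w :: "real^7 \<Rightarrow> real^7 \<Rightarrow> real"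
  assumes "\<And>y. linear (w y)" "\<And>z. linear (\<lambda>y. w y z)" "\<And>y. w y y = 0"
    and "continuous_on UNIV (\<lambda>p. w (fst p) (snd p))"
    and "finite S" "card S < 6" and V: "V = {k. \<forall>s\<in>S. s \<bullet> k = 0}"
  shows "\<exists>y\<in>V. \<exists>z\<in>V. \<exists>p\<ge>0. norm y = 1 \<and> norm z = 1 \<and> y \<bullet> z = 0 \<and>
    (\<forall>k\<in>V. w k z = p * (y \<bullet> k)) \<and> (\<forall>k\<in>V. w y k = p * (z \<bullet> k))"
proof -
  let ?B = "V \<inter> cball 0 1"
  have sub: "subspace V" by (simp add: V subspace_def inner_add_right)
  have "closed V" by (rule closed_subspace[OF sub])
  then have "compact (?B \<times> ?B)" by (intro compact_Times closed_Int_compact compact_cball)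
  moreover have "continuous_on (?B \<times> ?B) (\<lambda>p. w (fst p) (snd p))"
    by (rule continuous_on_subset[OF assms(4)]) simp
  moreover have "0 \<in> ?B" using subspace_0[OF sub] by simp
  ultimately obtain q where q: "q \<in> ?B \<times> ?B" "\<forall>r\<in>?B \<times> ?B. w (fst r) (snd r) \<le> w (fst q) (snd q)"
    using continuous_attains_sup[of "?B \<times> ?B"] by (metis (no_types, lifting) SigmaI empty_iff)
  define y z where "y = fst q" and "z = snd q"
  define p where "p = w y z"
  have n: "y \<in> V" "z \<in> V" "norm y \<le> 1" "norm z \<le> 1" using q(1) by (auto simp: y_def z_def)
  have max: "w y' z' \<le> p" if "y' \<in> V" "z' \<in> V" "norm y' \<le> 1" "norm z' \<le> 1" for y' z'
    using q(2)[rule_format, of "(y', z')"] that by (simp add: p_def y_def z_def)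
  have k1: "w k z = p * (y \<bullet> k)" if "k \<in> V" for k
    unfolding p_def
    by (rule linear_functional_max[OF assms(2) sub]) (use n max p_def that in auto)
  have k2: "w y k = p * (z \<bullet> k)" if "k \<in> V" for k
    unfolding p_def
    by (rule linear_functional_max[OF assms(1) sub]) (use n max p_def that in auto)
  have p0: "p \<ge> 0" using max[of 0 0] subspace_0[OF sub] by (simp add: linear_0[OF assms(1)])
  show ?thesis
  proof (cases "p = 0")
    case False
    then have "norm y = 1" "norm z = 1"
      using k1[OF n(1)] k2[OF n(2)] by (simp_all add: p_def[symmetric] norm_eq_1)
    moreover have "y \<bullet> z = 0" using k1[OF n(2)] assms(3)[of z] False by simp
    ultimately show ?thesis using n k1 k2 p0
      by (intro bexI[of _ y] bexI[of _ z] exI[of _ p] conjI) simp_all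
  next
    case True
    have le: "w y' z' \<le> 0" if "y' \<in> V" "z' \<in> V" "norm y' \<le> 1" "norm z' \<le> 1" for y' z'
      using max[OF that] True by simp
    have z1: "w y' z' = 0" if "y' \<in> V" "z' \<in> V" "norm y' \<le> 1" "norm z' \<le> 1" for y' z'
      using le[OF that] le[of "- y'" z'] that subspace_neg[OF sub] linear_neg[OF assms(2)[of z'], of y'] by simp
    have z2: "w y' z' = 0" if "y' \<in> V" "z' \<in> V" "norm z' \<le> 1" for y' z'
      by (rule linear_norm_bound_eq_0[OF assms(2) _ sub that(1)]) (use z1 that in auto)
    have z3: "w y' z' = 0" if "y' \<in> V" "z' \<in> V" for y' z'
      by (rule linear_norm_bound_eq_0[OF assms(1) _ sub that(2)]) (use z2 that in auto)
    obtain y' where y': "norm y' = 1" "\<forall>s\<in>S. s \<bullet> y' = 0"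
      using exists_unit_orthogonal[OF assms(5)] assms(6) by force
    have "card (insert y' S) < 7" using assms(5,6) by (simp add: card_insert_if)
    with exists_unit_orthogonal[of "insert y' S"] assms(5)
    obtain z' where z': "norm z' = 1" "\<forall>s\<in>insert y' S. s \<bullet> z' = 0" by blast
    show ?thesis using y' z' z3 V
      by (intro bexI[of _ y'] bexI[of _ z'] exI[of _ "0::real"]) auto
  qed
qed

lemma linear_functional_unit:
  fixes l :: "real^7 \<Rightarrow> real"
  assumes "linear l" "finite S" "card S < 7" and V: "V = {k. \<forall>s\<in>S. s \<bullet> k = 0}"
  shows "\<exists>u\<in>V. \<exists>b\<ge>0. norm u = 1 \<and> (\<forall>k\<in>V. l k = b * (u \<bullet> k))"
proof -
  have sub: "subspace V" by (simp add: V subspace_def inner_add_right)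
  obtain n where n: "n \<in> V" "\<And>k. k \<in> V \<Longrightarrow> l k = n \<bullet> k"
    using linear_functional_on_subspace[OF assms(1) sub] by blast
  show ?thesis
  proof (cases "n = 0")
    case True
    obtain u where "norm u = 1" "\<forall>s\<in>S. s \<bullet> u = 0"
      using exists_unit_orthogonal[OF assms(2,3)] by blast
    then show ?thesis using True n(2) V by (intro bexI[of _ u] exI[of _ "0::real"]) auto
  next
    case False
    then show ?thesis using n subspace_scale[OF sub n(1)]
      by (intro bexI[of _ "n /\<^sub>R norm n"] exI[of _ "norm n"]) auto
  qed
qed

text \<open>The form \<open>e123 + e145 - e167 + e246 + e257 + e347 - e356\<close> of the octonionic
  cross product; its seven index triples are the lines of a Fano plane. A predicate listing all 35
  components serves directly as a set of rewrite rules.\<close>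

definition G2_standard :: "ten3 \<Rightarrow> bool" where
  "G2_standard a \<longleftrightarrow> alternating3 a \<and>
     a$1$2$3 = 1 \<and> a$1$2$4 = 0 \<and> a$1$2$5 = 0 \<and> a$1$2$6 = 0 \<and> a$1$2$7 = 0 \<and>
     a$1$3$4 = 0 \<and> a$1$3$5 = 0 \<and> a$1$3$6 = 0 \<and> a$1$3$7 = 0 \<and> a$1$4$5 = 1 \<and>
     a$1$4$6 = 0 \<and> a$1$4$7 = 0 \<and> a$1$5$6 = 0 \<and> a$1$5$7 = 0 \<and> a$1$6$7 = -1 \<and>
     a$2$3$4 = 0 \<and> a$2$3$5 = 0 \<and> a$2$3$6 = 0 \<and> a$2$3$7 = 0 \<and> a$2$4$5 = 0 \<and>
     a$2$4$6 = 1 \<and> a$2$4$7 = 0 \<and> a$2$5$6 = 0 \<and> a$2$5$7 = 1 \<and> a$2$6$7 = 0 \<and>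
     a$3$4$5 = 0 \<and> a$3$4$6 = 0 \<and> a$3$4$7 = 1 \<and> a$3$5$6 = -1 \<and> a$3$5$7 = 0 \<and>
     a$3$6$7 = 0 \<and> a$4$5$6 = 0 \<and> a$4$5$7 = 0 \<and> a$4$6$7 = 0 \<and> a$5$6$7 = 0"

lemma contract3_axis: "contract3 (axis i 1) a = a $ i"
proof -
  have "axis i (1::real) $ l * a$l$j$k = (if l = i then a$i$j$k else 0)" for l j k
    by (simp add: axis_def)
  then show ?thesis by (simp add: contract3_def vec_eq_iff)
qed

lemma skew_slice:
  assumes "alternating3 a"
  shows "transpose (a $ i) = - (a $ i)"
  by (simp add: vec_eq_iff transpose_def) (intro allI alternating3_swap(2)[OF assms])

text \<open>The vanishing components are those of an orthonormal frame whose vectors are chosen at successive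
  maxima of \<open>a\<close>.\<close>
lemma G2_adapted_frame_standard:
  assumes alt: "alternating3 a" and g: "G2_metric_vol a (mat 1) v"
    and zero: "a$1$2$4 = 0" "a$1$2$5 = 0" "a$1$2$6 = 0" "a$1$2$7 = 0" "a$1$3$4 = 0" "a$1$3$5 = 0"
    "a$1$3$6 = 0" "a$1$3$7 = 0" "a$2$3$4 = 0" "a$2$3$5 = 0" "a$2$3$6 = 0" "a$2$3$7 = 0"
    "a$1$4$6 = 0" "a$1$4$7 = 0" "a$1$5$6 = 0" "a$1$5$7 = 0" "a$2$4$7 = 0"
    and sgn: "a$1$2$3 > 0" "a$1$4$5 \<ge> 0" "a$2$4$6 \<ge> 0" "a$3$4$7 \<ge> 0"
  shows "G2_standard a" "v = 1"
proof -
  have W: "wedge223 (a $ i) (a $ j) a = (if i = j then - 6 * v else 0)" for i j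
  proof -
    have "wedge223 (contract3 (axis i 1) a) (contract3 (axis j 1) a) a
        = - 6 * (axis i (1::real) \<bullet> (mat 1 *v axis j 1)) * v"
      using g by (simp add: G2_metric_vol_def)
    then show ?thesis by (simp add: contract3_axis inner_axis_axis)
  qed
  have v2: "v\<^sup>2 = 1" using g by (simp add: G2_metric_vol_def)
  note eqs = W wedge223_expand[OF skew_slice[OF alt] skew_slice[OF alt] alt] wedge23_def
    alternating3_sort[OF alt] zero
  \<comment> \<open>The letters \<open>b\<close> and \<open>c\<close> carry the indices after 2 and
    after 3, and \<open>r4\<close>, ..., \<open>r7\<close> are the components inside {4, 5, 6, 7},
    labelled by the missing index.\<close>
  define L p q b45 b46 b56 b57 b67 c45 c46 c47 c56 c57 c67 r4 r5 r6 r7 where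
    d: "L = a$1$2$3" "p = a$1$4$5" "q = a$1$6$7" "b45 = a$2$4$5" "b46 = a$2$4$6" "b56 = a$2$5$6" "b57 = a$2$5$7"
      "b67 = a$2$6$7" "c45 = a$3$4$5" "c46 = a$3$4$6" "c47 = a$3$4$7" "c56 = a$3$5$6" "c57 = a$3$5$7" "c67 = a$3$6$7"
      "r4 = a$5$6$7" "r5 = a$4$6$7" "r6 = a$4$5$7" "r7 = a$4$5$6"
  note ds = d[symmetric]
  \<comment> \<open>As \<open>v\<close> is nonzero, the diagonal equations make each of their
    factors nonzero, and the off-diagonal equations can then be divided by these factors.\<close>
  have e11: "L * p * q = - v" using W[of 1 1] by (simp add: eqs(2-) ds)
  have e14: "L * p * r5 = 0" using W[of 1 4] by (simp add: eqs(2-) ds)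
  have e15: "L * p * r4 = 0" using W[of 1 5] by (simp add: eqs(2-) ds)
  have e16: "L * q * r7 = 0" using W[of 1 6] by (simp add: eqs(2-) ds)
  have e17: "L * q * r6 = 0" using W[of 1 7] by (simp add: eqs(2-) ds)
  have v0: "v \<noteq> 0" using v2 by auto
  have nz: "L \<noteq> 0" "p \<noteq> 0" "q \<noteq> 0" using e11 v0 by auto
  have r: "r4 = 0" "r5 = 0" "r6 = 0" "r7 = 0" using e14 e15 e16 e17 nz by auto
  note r' = r[unfolded d]
  \<comment> \<open>Together with \<open>e47\<close> this makes the sum and the difference of
    \<open>b45 * q\<close> and \<open>b67 * p\<close> vanish; the same pattern settles
    \<open>c45\<close> and \<open>c67\<close>.\<close>
  have e12: "L * (b45 * q + b67 * p) = 0" using W[of 1 2] by (simp add: eqs(2-) ds r algebra_simps)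
  have e44: "b46 * c47 * p = v" using W[of 4 4] by (simp add: eqs(2-) ds r)
  have e47: "c47 * (b67 * p - b45 * q) = 0" using W[of 4 7] by (simp add: eqs(2-) ds r algebra_simps)
  have nz2: "b46 \<noteq> 0" "c47 \<noteq> 0" using e44 v0 by auto
  have b: "b45 = 0" "b67 = 0"
  proof -
    have "b67 * p = b45 * q" "b45 * q + b67 * p = 0" using e12 e47 nz nz2 by auto
    then show "b45 = 0" "b67 = 0" using nz by auto
  qed
  have e13: "L * (c45 * q + c67 * p) = 0" using W[of 1 3] by (simp add: eqs(2-) ds r b algebra_simps)
  have e46: "b46 * (c45 * q - c67 * p) = 0" using W[of 4 6] by (simp add: eqs(2-) ds r b algebra_simps)
  have c: "c45 = 0" "c67 = 0"
  proof -
    have "c45 * q = c67 * p" "c45 * q + c67 * p = 0" using e13 e46 nz nz2 by auto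
    then show "c45 = 0" "c67 = 0" using nz by auto
  qed
  have e22: "L * b46 * b57 = v" using W[of 2 2] by (simp add: eqs(2-) ds r b c)
  have e23: "L * (b56 * c47 - b46 * c57 - b57 * c46) = 0" using W[of 2 3] by (simp add: eqs(2-) ds r b c algebra_simps)
  have e45: "p * (b57 * c46 - b46 * c57 - b56 * c47) = 0" using W[of 4 5] by (simp add: eqs(2-) ds r b c algebra_simps)
  have e67: "q * (b57 * c46 - b46 * c57 + b56 * c47) = 0" using W[of 6 7] by (simp add: eqs(2-) ds r b c algebra_simps)
  have nz3: "b57 \<noteq> 0" using e22 v0 by auto
  have z: "b56 = 0" "c57 = 0" "c46 = 0"
  proof -
    have 1: "b56 * c47 - b46 * c57 - b57 * c46 = 0" "b57 * c46 - b46 * c57 - b56 * c47 = 0"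
      "b57 * c46 - b46 * c57 + b56 * c47 = 0" using e23 e45 e67 nz by auto
    then have "b56 * c47 = 0" by linarith
    then show "b56 = 0" using nz2 by simp
    with 1 have "b46 * c57 = 0" "b57 * c46 = 0" by auto
    then show "c57 = 0" "c46 = 0" using nz2 nz3 by auto
  qed
  have e33: "L * c47 * c56 = - v" using W[of 3 3] by (simp add: eqs(2-) ds r b c z)
  have e55: "b57 * c56 * p = - v" using W[of 5 5] by (simp add: eqs(2-) ds r b c z)
  have e66: "b46 * c56 * q = v" using W[of 6 6] by (simp add: eqs(2-) ds r b c z)
  have e77: "b57 * c47 * q = - v" using W[of 7 7] by (simp add: eqs(2-) ds r b c z)
  have pos: "L > 0" "p > 0" "b46 > 0" "c47 > 0" using sgn nz nz2 unfolding d by auto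
  have "v > 0" using e44 pos mult_pos_pos[OF mult_pos_pos[OF pos(3,4)] pos(2)] by simp
  with v2 show v: "v = 1" by (simp add: power2_eq_1_iff)
  have "(L * p) * q < 0" "(L * b46) * b57 > 0" "(L * c47) * c56 < 0" using e11 e22 e33 v by simp_all
  moreover have "L * p > 0" "L * b46 > 0" "L * c47 > 0" using pos by simp_all
  ultimately have neg: "q < 0" "b57 > 0" "c56 < 0"
    by (auto simp only: mult_less_0_iff[of "_ * _"] zero_less_mult_iff[of "_ * _"] dest: less_asym)
  \<comment> \<open>Both sides are \<open>- v^2\<close>; cancelling the common factors leaves
    \<open>p^2 = q^2\<close>.\<close>
  have "(b46 * c47 * p) * (b57 * c56 * p) = (b46 * c56 * q) * (b57 * c47 * q)"
    using e44 e55 e66 e77 by simp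
  then have "(b46 * c47 * b57 * c56) * (p\<^sup>2 - q\<^sup>2) = 0" by (simp add: power2_eq_square algebra_simps)
  then have "p\<^sup>2 = q\<^sup>2" using nz2 neg by auto
  then have q: "q = - p" using pos neg by (auto simp: power2_eq_iff)
  have b57: "b57 = b46"
  proof -
    have "b46 * c47 * p = b57 * c47 * p" using e44 e77 q by simp
    then show ?thesis using pos by simp
  qed
  have c56: "c56 = - c47"
  proof -
    have "b46 * p * (c56 + c47) = 0" using e44 e55 b57 by (simp add: algebra_simps)
    then show ?thesis using pos by auto
  qed
  have "L * p\<^sup>2 = 1" "L * b46\<^sup>2 = 1" "L * c47\<^sup>2 = 1"
    using e11 e22 e33 v q b57 c56 by (simp_all add: power2_eq_square)
  then have "L * (b46\<^sup>2 - p\<^sup>2) = 0" "L * (c47\<^sup>2 - p\<^sup>2) = 0" and Lp: "L * p\<^sup>2 = 1" by (simp_all add: algebra_simps)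
  then have "b46\<^sup>2 = p\<^sup>2" "c47\<^sup>2 = p\<^sup>2" using pos by auto
  then have bc: "b46 = p" "c47 = p" using pos by (auto simp: power2_eq_iff)
  then have "p ^ 3 = 1 ^ 3" using e44 v by (simp add: power3_eq_cube)
  then have p: "p = 1" using pos by (intro power_eq_imp_eq_base[of p 3 1]) auto
  with Lp have "L = 1" by simp
  then have "L = 1" "p = 1" "q = - 1" "b46 = 1" "b57 = 1" "c47 = 1" "c56 = - 1"
    using p bc c56 b57 q by simp_all
  then show "G2_standard a"
    using r b c z zero unfolding G2_standard_def d by (simp add: alt)
qed

section \<open>Orthonormal and adapted frames\<close>

lemma inner_pullback_matrix:
  fixes P :: "real^'n^'m"
  shows "X \<bullet> ((transpose P ** g ** P) *v Y) = (P *v X) \<bullet> (g *v (P *v Y))"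
  by (metis dot_lmul_matrix inner_commute matrix_vector_mul_assoc transpose_matrix_vector)

lemma matrix_component_inner: "(A :: real^'n^'m) $ i $ j = axis i 1 \<bullet> (A *v axis j 1)"
  by (simp add: inner_axis' matrix_vector_mult_basis column_def)

text \<open>Gram-Schmidt for the inner product \<open>g\<close>. The vectors are indexed by naturals
  so that the frame can be built by induction, and are relabelled by the index type at the
  end.\<close>

lemma pos_def_orthonormal_frame:
  fixes g :: "real^'n^'n"
  assumes sym: "transpose g = g" and pos: "\<And>X. X \<noteq> 0 \<Longrightarrow> X \<bullet> (g *v X) > 0"
  shows "\<exists>E :: real^'n^'n. transpose E ** g ** E = mat 1"
proof -
  have gs: "x \<bullet> (g *v y) = y \<bullet> (g *v x)" for x y
    by (metis dot_lmul_matrix inner_commute sym transpose_matrix_vector)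
  have "\<exists>f :: nat \<Rightarrow> real^'n. \<forall>i<n. \<forall>j<n. f i \<bullet> (g *v f j) = (if i = j then 1 else 0)"
    if "n \<le> CARD('n)" for n
    using that
  proof (induction n)
    case (Suc n)
    then obtain f :: "nat \<Rightarrow> real^'n" where f: "\<forall>i<n. \<forall>j<n. f i \<bullet> (g *v f j) = (if i = j then 1 else 0)"
      by auto
    have "dim (f ` {..<n}) \<le> card (f ` {..<n})" by (rule dim_le_card') simp
    also have "\<dots> \<le> n" using card_image_le[of "{..<n}" f] by simp
    also have "n < DIM(real^'n)" using Suc.prems by simp
    finally have "span (f ` {..<n}) \<noteq> UNIV" by (metis dim_UNIV dim_span less_irrefl)
    then obtain x where x: "x \<notin> span (f ` {..<n})" by blast
    define y where "y = x - (\<Sum>i<n. (f i \<bullet> (g *v x)) *\<^sub>R f i)"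
    have y0: "y \<noteq> 0"
    proof
      assume "y = 0"
      then have "x = (\<Sum>i<n. (f i \<bullet> (g *v x)) *\<^sub>R f i)" by (simp add: y_def)
      also have "\<dots> \<in> span (f ` {..<n})" by (intro span_sum span_scale span_base) auto
      finally show False using x by simp
    qed
    have fy: "f j \<bullet> (g *v y) = 0" if "j < n" for j
    proof -
      have "f j \<bullet> (g *v y) = f j \<bullet> (g *v x) - (\<Sum>i<n. (f i \<bullet> (g *v x)) * (f j \<bullet> (g *v f i)))"
        by (simp add: y_def matrix_vector_mult_diff_distrib inner_diff_right linear_sum[OF matrix_vector_mul_linear]
            linear_scale[OF matrix_vector_mul_linear] inner_sum_right)
      also have "(\<Sum>i<n. (f i \<bullet> (g *v x)) * (f j \<bullet> (g *v f i)))
          = (\<Sum>i<n. if i = j then f j \<bullet> (g *v x) else 0)"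
        by (rule sum.cong) (use f that in auto)
      finally show ?thesis using that by simp
    qed
    define s where "s = sqrt (y \<bullet> (g *v y))"
    have s: "s > 0" "s * s = y \<bullet> (g *v y)" using pos[OF y0] by (simp_all add: s_def)
    define f' where "f' = (\<lambda>i. if i < n then f i else y /\<^sub>R s)"
    have lin: "g *v (c *\<^sub>R z) = c *\<^sub>R (g *v z)" for c z
      by (rule linear_scale[OF matrix_vector_mul_linear])
    have "f' i \<bullet> (g *v f' j) = (if i = j then 1 else 0)" if "i < Suc n" "j < Suc n" for i j
    proof -
      have "y \<bullet> (g *v f i) = 0" if "i < n" for i using gs[of y "f i"] fy[OF that] by simp
      then show ?thesis using that f fy s by (auto simp: f'_def lin less_Suc_eq field_simps)
    qed
    then show ?case by blast
  qed simp
  then obtain f :: "nat \<Rightarrow> real^'n" where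
    f: "\<forall>i<CARD('n). \<forall>j<CARD('n). f i \<bullet> (g *v f j) = (if i = j then 1 else 0)" by blast
  obtain h where h: "bij_betw h (UNIV :: 'n set) {0..<CARD('n)}"
    using ex_bij_betw_finite_nat[of "UNIV :: 'n set"] by auto
  then have hb: "h i < CARD('n)" "h i = h j \<longleftrightarrow> i = j" for i j
    by (auto simp: bij_betw_def inj_on_def)
  define E :: "real^'n^'n" where "E = (\<chi> i j. f (h j) $ i)"
  have "E *v axis j 1 = f (h j)" for j
    by (simp add: matrix_vector_mult_basis column_def E_def vec_eq_iff)
  then have "(E *v axis i 1) \<bullet> (g *v (E *v axis j 1)) = (if i = j then 1 else 0)" for i j
    using f hb by simp
  then have "transpose E ** g ** E = mat 1"
    by (simp add: vec_eq_iff matrix_component_inner[of "transpose E ** g ** E"] inner_pullback_matrix)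
       (simp add: mat_def)
  then show ?thesis by blast
qed

lemma pullback3_eq_eval3: "pullback3 Q a $ i $ j $ k = eval3 a (column i Q) (column j Q) (column k Q)"
  by (simp add: pullback3_def eval3_def column_def)

lemma alternating3_pullback: "alternating3 a \<Longrightarrow> alternating3 (pullback3 Q a)"
  unfolding alternating3_def[of "pullback3 Q a"] pullback3_eq_eval3
  by (metis eval3_alternating(1,2) add.inverse_inverse)

lemma pullback3_linear: "linear (pullback3 P)"
  by (rule linearI; simp add: pullback3_def vec_eq_iff sum.distrib sum_distrib_left algebra_simps)

lemma sum_product3:
  fixes f :: "'a \<Rightarrow> 'd::semiring_0"
  shows "(\<Sum>l\<in>A. \<Sum>m\<in>B. \<Sum>n\<in>C. f l * (g m * h n)) = sum f A * (sum g B * sum h C)"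
  by (simp add: sum_distrib_left[symmetric] sum_distrib_right[symmetric])

lemma pullback3_compose: "pullback3 P (pullback3 Q a) = pullback3 (Q ** P) a"
proof -
  have t: "pullback3 P (tensor_prod3 x y z) = tensor_prod3 (x v* P) (y v* P) (z v* P)" for x y z
    by (simp add: vec_eq_iff pullback3_def tensor_prod3_def vector_matrix_mult_def mult.assoc sum_product3[symmetric])
       (simp add: mult_ac)
  have "(Q ** P) $ i = (Q $ i) v* P" for i
    by (simp add: vec_eq_iff matrix_matrix_mult_def vector_matrix_mult_def mult.commute)
  then show ?thesis
    unfolding pullback3_tensor_prod[of Q a] pullback3_tensor_prod[of "Q ** P" a]
    by (simp add: linear_sum[OF pullback3_linear] linear_scale[OF pullback3_linear] t)
qed

text \<open>The maximality conditions become the zeros: that of \<open>e1\<close>,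
  \<open>e2\<close>, \<open>e3\<close> gives the components 12k, 13k, 23k for k at least 4, and that
  of \<open>e4\<close>, \<open>e5\<close> for the 2-form \<open>a(e1, _, _)\<close> gives 14k and
  15k for k at least 6. Then \<open>e6\<close> points along the functional
  \<open>a(e2, e4, _)\<close>, which gives 247, and the last vector is determined up to a sign,
  chosen so that 347 is nonnegative.\<close>

lemma alternating3_adapted_frame:
  assumes alt: "alternating3 a" and "a \<noteq> 0"
  shows "\<exists>Q. transpose Q ** Q = mat 1 \<and>
    (\<forall>k\<in>{4, 5, 6, 7}. pullback3 Q a $ 1 $ 2 $ k = 0 \<and> pullback3 Q a $ 1 $ 3 $ k = 0 \<and> pullback3 Q a $ 2 $ 3 $ k = 0) \<and>
    (\<forall>k\<in>{6, 7}. pullback3 Q a $ 1 $ 4 $ k = 0 \<and> pullback3 Q a $ 1 $ 5 $ k = 0) \<and> pullback3 Q a $ 2 $ 4 $ 7 = 0 \<and>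
    pullback3 Q a $ 1 $ 2 $ 3 > 0 \<and> pullback3 Q a $ 1 $ 4 $ 5 \<ge> 0 \<and> pullback3 Q a $ 2 $ 4 $ 6 \<ge> 0 \<and> pullback3 Q a $ 3 $ 4 $ 7 \<ge> 0"
proof -
  note T = eval3_alternating[OF alt]
  obtain e1 e2 e3 L where L: "L > 0" and n: "norm e1 = 1" "norm e2 = 1" "norm e3 = 1"
    and o: "e1 \<bullet> e2 = 0" "e1 \<bullet> e3 = 0" "e2 \<bullet> e3 = 0"
    and T1: "\<And>k. eval3 a k e2 e3 = L * (e1 \<bullet> k)" and T2: "\<And>k. eval3 a e1 k e3 = L * (e2 \<bullet> k)"
    and T3: "\<And>k. eval3 a e1 e2 k = L * (e3 \<bullet> k)"
    using alternating3_max[OF assms] by blast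
  define V where "V = {k. \<forall>s\<in>{e1, e2, e3}. s \<bullet> k = 0}"
  have "\<exists>y\<in>V. \<exists>z\<in>V. \<exists>p\<ge>0. norm y = 1 \<and> norm z = 1 \<and> y \<bullet> z = 0 \<and>
    (\<forall>k\<in>V. eval3 a e1 k z = p * (y \<bullet> k)) \<and> (\<forall>k\<in>V. eval3 a e1 y k = p * (z \<bullet> k))"
  proof (rule alternating2_max[OF eval3_linear(3) eval3_linear(2) T(4) _ _ _ V_def])
    show "continuous_on UNIV (\<lambda>p. eval3 a e1 (fst p) (snd p))"
      by (intro continuous_on_eval3 continuous_intros)
    show "card {e1, e2, e3} < 6" by (rule le_less_trans[OF card_insert_le_m1[of 3]]) (auto simp: card_insert_if)
  qed simp
  then obtain e4 e5 p where e45: "e4 \<in> V" "e5 \<in> V" "p \<ge> 0" "norm e4 = 1" "norm e5 = 1" "e4 \<bullet> e5 = 0"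
    and T14: "\<And>k. k \<in> V \<Longrightarrow> eval3 a e1 k e5 = p * (e4 \<bullet> k)" and T15: "\<And>k. k \<in> V \<Longrightarrow> eval3 a e1 e4 k = p * (e5 \<bullet> k)"
    by blast
  define W where "W = {k. \<forall>s\<in>{e1, e2, e3, e4, e5}. s \<bullet> k = 0}"
  have c5: "card {e1, e2, e3, e4, e5} < 7" by (simp add: card_insert_if)
  obtain e6 b where e6: "e6 \<in> W" "b \<ge> 0" "norm e6 = 1" and T24: "\<And>k. k \<in> W \<Longrightarrow> eval3 a e2 e4 k = b * (e6 \<bullet> k)"
    using linear_functional_unit[OF eval3_linear(3)[of a e2 e4] _ c5 W_def] by auto
  define U where "U = {k. \<forall>s\<in>{e1, e2, e3, e4, e5, e6}. s \<bullet> k = 0}"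
  have c6: "card {e1, e2, e3, e4, e5, e6} < 7" by (simp add: card_insert_if)
  obtain e7 c where e7: "e7 \<in> U" "c \<ge> 0" "norm e7 = 1" and T34: "\<And>k. k \<in> U \<Longrightarrow> eval3 a e3 e4 k = c * (e7 \<bullet> k)"
    using linear_functional_unit[OF eval3_linear(3)[of a e3 e4] _ c6 U_def] by auto
  define e where "e i = (if i = (1::7) then e1 else if i = 2 then e2 else if i = 3 then e3 else if i = 4 then e4
      else if i = 5 then e5 else if i = 6 then e6 else e7)" for i
  define Q :: "real^7^7" where "Q = (\<chi> i j. e j $ i)"
  have col: "column j Q = e j" for j by (simp add: column_def Q_def vec_eq_iff)
  have orth: "e1 \<bullet> e4 = 0" "e2 \<bullet> e4 = 0" "e3 \<bullet> e4 = 0" "e1 \<bullet> e5 = 0" "e2 \<bullet> e5 = 0" "e3 \<bullet> e5 = 0"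
    "e1 \<bullet> e6 = 0" "e2 \<bullet> e6 = 0" "e3 \<bullet> e6 = 0" "e4 \<bullet> e6 = 0" "e5 \<bullet> e6 = 0"
    "e1 \<bullet> e7 = 0" "e2 \<bullet> e7 = 0" "e3 \<bullet> e7 = 0" "e4 \<bullet> e7 = 0" "e5 \<bullet> e7 = 0" "e6 \<bullet> e7 = 0"
    using e45 e6 e7 by (simp_all add: V_def W_def U_def)
  have ee: "e i \<bullet> e j = (if i = j then 1 else 0)" for i j
  proof -
    have "\<forall>i j. e i \<bullet> e j = (if i = j then 1 else 0)"
      unfolding forall_7 e_def using o n orth e45 e6 e7
      by (simp add: norm_eq_1 inner_commute)
    then show ?thesis by blast
  qed
  have in_V: "e4 \<in> V" "e5 \<in> V" "e6 \<in> V" "e7 \<in> V" and in_W: "e6 \<in> W" "e7 \<in> W"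
    using e45 e6 e7 by (auto simp: V_def W_def U_def)
  have "transpose Q ** Q = mat 1"
    by (simp add: vec_eq_iff matrix_matrix_mult_def transpose_def Q_def mat_def ee[unfolded inner_vec_def, simplified])
  moreover have "eval3 a e1 e3 k = - (L * (e2 \<bullet> k))" for k using T(1)[of e1 k e3] T2[of k] by simp
  moreover have "eval3 a e2 e3 k = L * (e1 \<bullet> k)" for k
    using T(1)[of e2 k e3] T(2)[of k e2 e3] T1[of k] by simp
  moreover have "eval3 a e1 e5 k = - (p * (e4 \<bullet> k))" if "k \<in> V" for k using T(1)[of e1 k e5] T14[OF that] by simp
  ultimately show ?thesis
    using L e45 e6 e7 orth n T3 T15 T24 T34 in_V in_W
    by (intro exI[of _ Q]) (simp add: pullback3_eq_eval3 col e_def norm_eq_1)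
qed

lemma matrix_inv_right_left:
  fixes P :: "real^'n^'n"
  assumes "det P \<noteq> 0"
  shows "P ** matrix_inv P = mat 1" "matrix_inv P ** P = mat 1"
proof -
  have "\<exists>Q. P ** Q = mat 1 \<and> Q ** P = mat 1"
    using assms invertible_det_nz[of P] by (simp add: invertible_def)
  then have "P ** matrix_inv P = mat 1 \<and> matrix_inv P ** P = mat 1"
    unfolding matrix_inv_def by (rule someI_ex)
  then show "P ** matrix_inv P = mat 1" "matrix_inv P ** P = mat 1" by blast+
qed

lemma matrix_inv_eqI:
  fixes P :: "real^'n^'n"
  assumes "P ** Q = mat 1"
  shows "matrix_inv P = Q"
proof -
  have "det P \<noteq> 0" using arg_cong[OF assms, of det] by (auto simp: det_mul)
  then have "matrix_inv P ** (P ** Q) = Q" by (simp add: matrix_mul_assoc matrix_inv_right_left)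
  then show ?thesis by (simp add: assms)
qed

text \<open>\<open>E\<close> turns \<open>g\<close> into the Euclidean inner product and
  \<open>Q\<close> rotates to the adapted frame, where the form is standard with volume coefficient
  1. The inverse of \<open>E ** Q\<close> undoes both, and its determinant is \<open>v\<close>
  because \<open>det (E ** Q) * v = 1\<close>.\<close>

theorem G2_normal_form:
  assumes alt: "alternating3 a" and g: "G2_metric_vol a g v"
  shows "\<exists>P a0. G2_standard a0 \<and> a = pullback3 P a0 \<and> g = transpose P ** P \<and> v = det P \<and> det P \<noteq> 0"
proof -
  have "\<exists>E :: real^7^7. transpose E ** g ** E = mat 1"
    by (rule pos_def_orthonormal_frame) (use g in \<open>auto simp: G2_metric_vol_def\<close>)
  then obtain E :: "real^7^7" where E: "transpose E ** g ** E = mat 1" by blast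
  have dE: "det E \<noteq> 0" using arg_cong[OF E, of det] by (auto simp: det_mul)
  define a1 where "a1 = pullback3 E a"
  have g1: "G2_metric_vol a1 (mat 1) (det E * v)"
    using G2_metric_vol_pullback[OF g dE] by (simp add: a1_def E)
  have alt1: "alternating3 a1" unfolding a1_def by (rule alternating3_pullback[OF alt])
  have "a1 \<noteq> 0"
  proof
    assume "a1 = 0"
    then have "wedge223 (contract3 X a1) (contract3 Y a1) a1 = 0" for X Y
      using linear_0[OF wedge223_linear(3)] by simp
    then have "axis 1 (1::real) \<bullet> (mat 1 *v axis (1::7) 1) * (det E * v) = 0"
      using g1 unfolding G2_metric_vol_def by (metis mult_eq_0_iff neg_equal_0_iff_equal zero_neq_numeral)
    then have 0: "det E * v = 0" by (simp add: inner_axis_axis)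
    have "(det E * v)\<^sup>2 = 1" using g1 by (simp add: G2_metric_vol_def)
    then show False unfolding 0 by simp
  qed
  from alternating3_adapted_frame[OF alt1 this] obtain Q where Q: "transpose Q ** Q = mat 1"
    and fr: "\<forall>k\<in>{4, 5, 6, 7}. pullback3 Q a1 $ 1 $ 2 $ k = 0 \<and> pullback3 Q a1 $ 1 $ 3 $ k = 0 \<and> pullback3 Q a1 $ 2 $ 3 $ k = 0"
      "\<forall>k\<in>{6, 7}. pullback3 Q a1 $ 1 $ 4 $ k = 0 \<and> pullback3 Q a1 $ 1 $ 5 $ k = 0" "pullback3 Q a1 $ 2 $ 4 $ 7 = 0"
      "pullback3 Q a1 $ 1 $ 2 $ 3 > 0" "pullback3 Q a1 $ 1 $ 4 $ 5 \<ge> 0" "pullback3 Q a1 $ 2 $ 4 $ 6 \<ge> 0" "pullback3 Q a1 $ 3 $ 4 $ 7 \<ge> 0"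
    by blast
  have dQ: "det Q \<noteq> 0" using arg_cong[OF Q, of det] by (auto simp: det_mul)
  define a0 where "a0 = pullback3 Q a1"
  have g0: "G2_metric_vol a0 (mat 1) (det Q * (det E * v))"
    using G2_metric_vol_pullback[OF g1 dQ] by (simp add: a0_def Q)
  have alt0: "alternating3 a0" unfolding a0_def by (rule alternating3_pullback[OF alt1])
  note std = G2_adapted_frame_standard[OF alt0 g0]
  have st: "G2_standard a0" and v0: "det Q * (det E * v) = 1"
    by (rule std; use fr in \<open>simp add: a0_def[symmetric]\<close>)+
  define B where "B = E ** Q"
  have dB: "det B \<noteq> 0" using dE dQ by (simp add: B_def det_mul)
  define P where "P = matrix_inv B"
  have BP: "B ** P = mat 1" "P ** B = mat 1" using matrix_inv_right_left[OF dB] by (simp_all add: P_def)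
  have "pullback3 P a0 = pullback3 (B ** P) a"
    unfolding a0_def a1_def B_def pullback3_compose by (simp add: matrix_mul_assoc)
  then have a: "a = pullback3 P a0" by (simp add: BP)
  have "transpose B ** g ** B = transpose Q ** (transpose E ** g ** E) ** Q"
    by (simp add: B_def matrix_transpose_mul matrix_mul_assoc)
  then have gB: "transpose B ** g ** B = mat 1" by (simp add: E Q)
  have "g = transpose (B ** P) ** g ** (B ** P)" by (simp add: BP)
  also have "\<dots> = transpose P ** (transpose B ** g ** B) ** P"
    by (simp add: matrix_transpose_mul matrix_mul_assoc)
  finally have g': "g = transpose P ** P" by (simp add: gB)
  have "det P * det B = 1" using arg_cong[OF BP(2), of det] by (simp add: det_mul)
  moreover have "det B * v = 1" using v0 by (simp add: B_def det_mul mult_ac)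
  ultimately have "v = det P" and "det P \<noteq> 0" by (metis mult.commute mult.left_commute mult.right_neutral, auto)
  then show ?thesis using st a g' by blast
qed

lemma G2_standard_alternating: "G2_standard a \<Longrightarrow> alternating3 a"
  by (simp add: G2_standard_def)

text \<open>The double cross product identity
  \<open>x \<times> (x \<times> y) = <x, y> x - |x|^2 y\<close> in matrix form: up to sign,
  \<open>contract3 x a\<close> is the matrix of the cross product with \<open>x\<close>.\<close>

lemma G2_standard_contract3_square:
  assumes "G2_standard a"
  shows "contract3 x a ** contract3 x a = tensor_prod x x - (x \<bullet> x) *\<^sub>R mat 1"
  using assms alternating3_sort[OF G2_standard_alternating[OF assms]] unfolding G2_standard_def
  by (simp add: vec_eq_iff forall_7 matrix_matrix_mult_def contract3_def sum_7 tensor_prod_def mat_def inner_vec_def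
      algebra_simps)

text \<open>The infinitesimal action of matrices on 3-forms, that is, the derivative at
  \<open>H = 0\<close> of the pullback along \<open>mat 1 + H\<close>.\<close>

definition act3 :: "real^7^7 \<Rightarrow> ten3 \<Rightarrow> ten3" where
  "act3 H a = (\<chi> i j k. \<Sum>l\<in>UNIV. H$l$i * a$l$j$k + H$l$j * a$i$l$k + H$l$k * a$i$j$l)"

lemma alternating3_act3:
  assumes "alternating3 a"
  shows "alternating3 (act3 H a)"
proof -
  note sw = alternating3_swap(1,2)[OF assms]
  have "act3 H a $ j $ i $ k = - act3 H a $ i $ j $ k" for i j k
    unfolding act3_def vec_lambda_beta sum_negf[symmetric]
    by (rule sum.cong[OF refl]) (simp add: sw(1)[of _ i k] sw(1)[of j _ k] sw(1)[of j i])
  moreover have "act3 H a $ i $ k $ j = - act3 H a $ i $ j $ k" for i j k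
    unfolding act3_def vec_lambda_beta sum_negf[symmetric]
    by (rule sum.cong[OF refl]) (simp add: sw(2)[of _ k j] sw(2)[of i _ j] sw(2)[of i k])
  ultimately show ?thesis unfolding alternating3_def by (metis add.inverse_inverse)
qed

lemma alternating3_eq_0I:
  assumes "alternating3 b"
    and "b$1$2$3 = 0" "b$1$2$4 = 0" "b$1$2$5 = 0" "b$1$2$6 = 0" "b$1$2$7 = 0"
    "b$1$3$4 = 0" "b$1$3$5 = 0" "b$1$3$6 = 0" "b$1$3$7 = 0" "b$1$4$5 = 0"
    "b$1$4$6 = 0" "b$1$4$7 = 0" "b$1$5$6 = 0" "b$1$5$7 = 0" "b$1$6$7 = 0"
    "b$2$3$4 = 0" "b$2$3$5 = 0" "b$2$3$6 = 0" "b$2$3$7 = 0" "b$2$4$5 = 0"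
    "b$2$4$6 = 0" "b$2$4$7 = 0" "b$2$5$6 = 0" "b$2$5$7 = 0" "b$2$6$7 = 0"
    "b$3$4$5 = 0" "b$3$4$6 = 0" "b$3$4$7 = 0" "b$3$5$6 = 0" "b$3$5$7 = 0"
    "b$3$6$7 = 0" "b$4$5$6 = 0" "b$4$5$7 = 0" "b$4$6$7 = 0" "b$5$6$7 = 0"
  shows "b = 0"
  using assms(2-) alternating3_sort[OF assms(1)] by (simp add: vec_eq_iff forall_7)

section \<open>The Hodge star of the standard form\<close>

lemma det7_swap_last:
  "det7 a b c d e h f = - det7 a b c d e f h" "det7 a b c d f e h = - det7 a b c d e f h"
proof -
  have sign: "sign (p \<circ> Transposition.transpose i j) = - sign p" if "p permutes (UNIV :: 7 set)" "i \<noteq> j" for p i j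
    using that by (subst sign_compose)
      (simp_all add: permutes_imp_permutation[OF finite] permutation_swap_id sign_swap_id)
  show "det7 a b c d e h f = - det7 a b c d e f h"
    unfolding det7_expand
    by (subst sum_permutations_compose_right[OF permutes_swap_id[of 6 UNIV 7]])
       (auto simp: sum_negf[symmetric] sign mult_ac intro!: sum.cong)
  show "det7 a b c d f e h = - det7 a b c d e f h"
    unfolding det7_expand
    by (subst sum_permutations_compose_right[OF permutes_swap_id[of 5 UNIV 6]])
       (auto simp: sum_negf[symmetric] sign mult_ac intro!: sum.cong)
qed

lemma alt_sum_0: "alt_sum n xs (\<lambda>l. 0) = 0"
  by (induction n arbitrary: xs) simp_all

text \<open>The 4-linear form \<open>\<star>a\<close> of the standard metric and volume form.\<close>
definition star4 :: "ten3 \<Rightarrow> real^7 \<Rightarrow> real^7 \<Rightarrow> real^7 \<Rightarrow> real^7 \<Rightarrow> real" where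
  "star4 a w x y z = (\<Sum>q\<in>UNIV. \<Sum>r\<in>UNIV. \<Sum>s\<in>UNIV. a$q$r$s *
     det7 (axis q 1) (axis r 1) (axis s 1) w x y z) / 6"

lemma hodge_star3_star4:
  "hodge_star3 (mat 1) 1 a $ m $ i $ j $ k = star4 a (axis m 1) (axis i 1) (axis j 1) (axis k 1)"
proof -
  have "matrix_inv (mat 1) = (mat 1 :: real^7^7)" by (rule matrix_inv_eqI) simp
  moreover have "column q (mat 1 :: real^7^7) = axis q 1" for q
    by (simp add: column_def mat_def axis_def vec_eq_iff)
  ultimately show ?thesis by (simp add: hodge_star3_det7 star4_def)
qed

text \<open>The list starts with 4, 5, 6, 7 so that the prescribed values are chosen first and wrong
  branches vanish at once. This reordering introduces no sign, since \<open>sign p\<close> does not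
  depend on how the set is listed.\<close>

lemma star4_axis_alt_sum:
  "star4 a (axis m 1) (axis i 1) (axis j 1) (axis k 1) = alt_sum 7 [4, 5, 6, 7, 1, 2, 3]
     (\<lambda>l. if l ! 0 = m \<and> l ! Suc 0 = i \<and> l ! 2 = j \<and> l ! 3 = k then a$(l ! 4)$(l ! 5)$(l ! 6) else 0) / 6"
proof -
  let ?P = "{p. p permutes (UNIV :: 7 set)}"
  let ?F = "\<lambda>l. if l ! 0 = m \<and> l ! Suc 0 = i \<and> l ! 2 = j \<and> l ! 3 = k then a$(l ! 4)$(l ! 5)$(l ! 6) else 0"
  have fin: "finite ?P" by (simp add: finite_permutations)
  have U: "UNIV = set [4, 5, 6, 7, 1, 2, 3 :: 7]" by (auto simp: UNIV_7)
  have inv: "matrix_inv (mat 1) = (mat 1 :: real^7^7)" by (rule matrix_inv_eqI) simp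
  have sum: "(\<Sum>q\<in>UNIV. \<Sum>r\<in>UNIV. \<Sum>s\<in>UNIV. mat 1 $ x $ q * mat 1 $ y $ r * mat 1 $ z $ s * a$q$r$s) = a$x$y$z" for x y z
  proof -
    have "mat 1 $ x $ q * mat 1 $ y $ r * mat 1 $ z $ s * a$q$r$s
        = (if s = z then if r = y then if q = x then a$x$y$z else 0 else 0 else 0)" for q r s
      by (simp add: mat_def)
    then show ?thesis by simp
  qed
  have "star4 a (axis m 1) (axis i 1) (axis j 1) (axis k 1)
      = (\<Sum>p\<in>{p\<in>?P. p 4 = m \<and> p 5 = i \<and> p 6 = j \<and> p 7 = k}. of_int (sign p) * a$(p 1)$(p 2)$(p 3)) / 6"
    unfolding hodge_star3_star4[symmetric] by (simp add: hodge_star3_def inv sum)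
  also have "\<dots> = (\<Sum>p\<in>?P. of_int (sign p) * ?F (map p [4, 5, 6, 7, 1, 2, 3])) / 6"
    unfolding sum.inter_filter[OF fin] by (intro arg_cong2[where f = "(/)"] sum.cong refl) simp
  also have "\<dots> = alt_sum 7 [4, 5, 6, 7, 1, 2, 3] ?F / 6"
    unfolding U by (subst sum_permutes_eq_alt_sum) simp_all
  finally show ?thesis .
qed

lemma star4_linear:
  "linear (\<lambda>w. star4 a w x y z)" "linear (\<lambda>x. star4 a w x y z)"
  "linear (\<lambda>y. star4 a w x y z)" "linear (star4 a w x y)"
  by (rule linearI; simp add: star4_def linear_add[OF det7_linear(4)] linear_scale[OF det7_linear(4)]
      linear_add[OF det7_linear(5)] linear_scale[OF det7_linear(5)] linear_add[OF det7_linear(6)]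
      linear_scale[OF det7_linear(6)] linear_add[OF det7_linear(7)] linear_scale[OF det7_linear(7)]
      algebra_simps sum.distrib sum_distrib_left add_divide_distrib)+

lemma star4_swap:
  "star4 a w x z y = - star4 a w x y z" "star4 a w y x z = - star4 a w x y z"
  by (simp_all add: star4_def sum_negf det7_swap_last(1)[of _ _ _ w x z y] det7_swap_last(2)[of _ _ _ w y x z])

lemma alt_sum_if:
  "alt_sum n xs (\<lambda>l. if c \<and> Q l then f l else 0) = (if c then alt_sum n xs (\<lambda>l. if Q l then f l else 0) else 0)"
  "alt_sum n xs (\<lambda>l. if c then f l else 0) = (if c then alt_sum n xs f else 0)"
  by (simp_all add: alt_sum_0)

text \<open>Choosing slot 0 first prunes the expansion: for concrete distinct entries at most one of
  the seven branches survives, and the next levels behave alike.\<close>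

lemma alt_sum_select_7:
  "alt_sum 7 [a, b, c, d, e, f, g] (\<lambda>l. if l ! 0 = m \<and> P l then F l else 0) =
     (if a = m then alt_sum 6 [b, c, d, e, f, g] (\<lambda>l. if P (a # l) then F (a # l) else 0) else 0)
     - (if b = m then alt_sum 6 [a, c, d, e, f, g] (\<lambda>l. if P (b # l) then F (b # l) else 0) else 0)
     + (if c = m then alt_sum 6 [a, b, d, e, f, g] (\<lambda>l. if P (c # l) then F (c # l) else 0) else 0)
     - (if d = m then alt_sum 6 [a, b, c, e, f, g] (\<lambda>l. if P (d # l) then F (d # l) else 0) else 0)
     + (if e = m then alt_sum 6 [a, b, c, d, f, g] (\<lambda>l. if P (e # l) then F (e # l) else 0) else 0)
     - (if f = m then alt_sum 6 [a, b, c, d, e, g] (\<lambda>l. if P (f # l) then F (f # l) else 0) else 0)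
     + (if g = m then alt_sum 6 [a, b, c, d, e, f] (\<lambda>l. if P (g # l) then F (g # l) else 0) else 0)"
  by (simp only: alt_sum_step_7 nth_Cons_0 alt_sum_if)

lemma alt_sum_select_6:
  "alt_sum 6 [a, b, c, d, e, f] (\<lambda>l. if l ! 0 = m \<and> P l then F l else 0) =
     (if a = m then alt_sum 5 [b, c, d, e, f] (\<lambda>l. if P (a # l) then F (a # l) else 0) else 0)
     - (if b = m then alt_sum 5 [a, c, d, e, f] (\<lambda>l. if P (b # l) then F (b # l) else 0) else 0)
     + (if c = m then alt_sum 5 [a, b, d, e, f] (\<lambda>l. if P (c # l) then F (c # l) else 0) else 0)
     - (if d = m then alt_sum 5 [a, b, c, e, f] (\<lambda>l. if P (d # l) then F (d # l) else 0) else 0)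
     + (if e = m then alt_sum 5 [a, b, c, d, f] (\<lambda>l. if P (e # l) then F (e # l) else 0) else 0)
     - (if f = m then alt_sum 5 [a, b, c, d, e] (\<lambda>l. if P (f # l) then F (f # l) else 0) else 0)"
  by (simp only: alt_sum_step_6 nth_Cons_0 alt_sum_if)

lemma alt_sum_select_5:
  "alt_sum 5 [a, b, c, d, e] (\<lambda>l. if l ! 0 = m \<and> P l then F l else 0) =
     (if a = m then alt_sum 4 [b, c, d, e] (\<lambda>l. if P (a # l) then F (a # l) else 0) else 0)
     - (if b = m then alt_sum 4 [a, c, d, e] (\<lambda>l. if P (b # l) then F (b # l) else 0) else 0)
     + (if c = m then alt_sum 4 [a, b, d, e] (\<lambda>l. if P (c # l) then F (c # l) else 0) else 0)
     - (if d = m then alt_sum 4 [a, b, c, e] (\<lambda>l. if P (d # l) then F (d # l) else 0) else 0)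
     + (if e = m then alt_sum 4 [a, b, c, d] (\<lambda>l. if P (e # l) then F (e # l) else 0) else 0)"
  by (simp only: alt_sum_step_5 nth_Cons_0 alt_sum_if)

lemma alt_sum_select_4:
  "alt_sum 4 [a, b, c, d] (\<lambda>l. if l ! 0 = m then F l else 0) =
     (if a = m then alt_sum 3 [b, c, d] (\<lambda>l. F (a # l)) else 0)
     - (if b = m then alt_sum 3 [a, c, d] (\<lambda>l. F (b # l)) else 0)
     + (if c = m then alt_sum 3 [a, b, d] (\<lambda>l. F (c # l)) else 0)
     - (if d = m then alt_sum 3 [a, b, c] (\<lambda>l. F (d # l)) else 0)"
  by (simp only: alt_sum_step_4 nth_Cons_0 alt_sum_if)

lemma alternating3_diff:
  assumes "alternating3 b" "alternating3 c"
  shows "alternating3 (b - c)"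
  unfolding alternating3_def
proof (intro allI)
  fix i j k
  have "b$i$j$k = - b$j$i$k" "b$i$j$k = - b$i$k$j" "c$i$j$k = - c$j$i$k" "c$i$j$k = - c$i$k$j"
    using assms unfolding alternating3_def by blast+
  then show "(b - c)$i$j$k = - (b - c)$j$i$k \<and> (b - c)$i$j$k = - (b - c)$i$k$j"
    unfolding vector_minus_component by linarith
qed

text \<open>Both sides are linear in \<open>w\<close> and alternating in the three slots, so the
  identity is checked on the seven basis vectors and the 35 increasing index triples. Its use is
  that \<open>contract3 w a\<close> is skew, which makes \<open>w \<lrcorner> \<psi>\<close> an
  infinitesimal rotation of \<open>a\<close>.\<close>

lemma G2_standard_star4:
  assumes std: "G2_standard a"
  shows "(\<chi> i j k. star4 a w (axis i 1) (axis j 1) (axis k 1)) = (1 / 3) *\<^sub>R act3 (contract3 w a) a"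
proof -
  note alt = G2_standard_alternating[OF std]
  define D where "D m = (\<chi> i j k. 3 * star4 a (axis m 1) (axis i 1) (axis j 1) (axis k 1)) - act3 (a $ m) a" for m
  have 1: "alternating3 (\<chi> i j k. 3 * star4 a (axis m 1) (axis i 1) (axis j 1) (axis k 1))" for m
    unfolding alternating3_def vec_lambda_beta
    by (intro allI conjI; (subst star4_swap(2), simp; fail)?) (subst star4_swap(1), simp)
  have 2: "alternating3 (D m)" for m
    unfolding D_def by (intro alternating3_diff 1 alternating3_act3 alt)
  have 3: "alt_sum 3 [x, y, z] (\<lambda>l. a$(l ! 0)$(l ! Suc 0)$(l ! 2)) = 6 * a$x$y$z" for x y z
    using alt_sum_3[OF alt, of x y z 1] by simp
  have "\<forall>m. D m$1$2$3 = 0 \<and> D m$1$2$4 = 0 \<and> D m$1$2$5 = 0 \<and> D m$1$2$6 = 0 \<and> D m$1$2$7 = 0 \<and>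
      D m$1$3$4 = 0 \<and> D m$1$3$5 = 0 \<and> D m$1$3$6 = 0 \<and> D m$1$3$7 = 0 \<and> D m$1$4$5 = 0 \<and>
      D m$1$4$6 = 0 \<and> D m$1$4$7 = 0 \<and> D m$1$5$6 = 0 \<and> D m$1$5$7 = 0 \<and> D m$1$6$7 = 0 \<and>
      D m$2$3$4 = 0 \<and> D m$2$3$5 = 0 \<and> D m$2$3$6 = 0 \<and> D m$2$3$7 = 0 \<and> D m$2$4$5 = 0 \<and>
      D m$2$4$6 = 0 \<and> D m$2$4$7 = 0 \<and> D m$2$5$6 = 0 \<and> D m$2$5$7 = 0 \<and> D m$2$6$7 = 0 \<and>
      D m$3$4$5 = 0 \<and> D m$3$4$6 = 0 \<and> D m$3$4$7 = 0 \<and> D m$3$5$6 = 0 \<and> D m$3$5$7 = 0 \<and>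
      D m$3$6$7 = 0 \<and> D m$4$5$6 = 0 \<and> D m$4$5$7 = 0 \<and> D m$4$6$7 = 0 \<and> D m$5$6$7 = 0"
    using std alternating3_sort[OF alt] unfolding forall_7 G2_standard_def
    by (simp add: D_def act3_def sum_7 star4_axis_alt_sum alt_sum_select_7 alt_sum_select_6 alt_sum_select_5
        alt_sum_select_4 3)
  then have "D m = 0" for m
    using alternating3_eq_0I[OF 2[of m]] by blast
  then have m: "3 * star4 a (axis m 1) (axis i 1) (axis j 1) (axis k 1) = act3 (a $ m) a $ i $ j $ k" for m i j k
    by (simp add: D_def vec_eq_iff)
  have w: "w = (\<Sum>m\<in>UNIV. w$m *\<^sub>R axis m 1)" using basis_expansion[of w] by (simp add: scalar_mult_eq_scaleR)
  have "3 * star4 a w (axis i 1) (axis j 1) (axis k 1) = act3 (contract3 w a) a $ i $ j $ k" for i j k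
  proof -
    have "3 * star4 a w (axis i 1) (axis j 1) (axis k 1)
        = (\<Sum>m\<in>UNIV. w$m * (3 * star4 a (axis m 1) (axis i 1) (axis j 1) (axis k 1)))"
      by (subst (1) w) (simp add: linear_sum[OF star4_linear(1)] linear_scale[OF star4_linear(1)] sum_distrib_left mult_ac)
    also have "\<dots> = (\<Sum>m\<in>UNIV. w$m * act3 (a $ m) a $ i $ j $ k)" by (simp add: m)
    also have "\<dots> = act3 (contract3 w a) a $ i $ j $ k"
      unfolding act3_def contract3_def vec_lambda_beta sum_distrib_left
      by (subst sum.swap) (simp add: sum_distrib_right sum_distrib_left sum.distrib algebra_simps)
    finally show ?thesis .
  qed
  then show ?thesis by (simp add: vec_eq_iff field_simps)
qed

section \<open>The infinitesimal action as a derivative, and naturality of the star\<close>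

lemma eval3_axes:
  "eval3 a x (axis j 1) (axis k 1) = (\<Sum>l\<in>UNIV. x$l * a$l$j$k)"
  "eval3 a (axis i 1) x (axis k 1) = (\<Sum>l\<in>UNIV. x$l * a$i$l$k)"
  "eval3 a (axis i 1) (axis j 1) x = (\<Sum>l\<in>UNIV. x$l * a$i$j$l)"
proof -
  have "x $ p * axis j 1 $ q * axis k 1 $ r * a$p$q$r
      = (if r = k then if q = j then x $ p * a$p$j$k else 0 else 0)" for p q r
    by (simp add: axis_def)
  then show "eval3 a x (axis j 1) (axis k 1) = (\<Sum>l\<in>UNIV. x$l * a$l$j$k)" by (simp add: eval3_def)
  have "axis i 1 $ p * x $ q * axis k 1 $ r * a$p$q$r
      = (if r = k then if p = i then x $ q * a$i$q$k else 0 else 0)" for p q r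
    by (simp add: axis_def)
  then show "eval3 a (axis i 1) x (axis k 1) = (\<Sum>l\<in>UNIV. x$l * a$i$l$k)"
    unfolding eval3_def by (subst sum.swap) simp
  have "(\<Sum>r\<in>UNIV. axis i 1 $ p * axis j 1 $ q * x $ r * a$p$q$r)
      = (if q = j then if p = i then \<Sum>r\<in>UNIV. x $ r * a$i$j$r else 0 else 0)" for p q
    by (simp add: axis_def)
  then show "eval3 a (axis i 1) (axis j 1) x = (\<Sum>l\<in>UNIV. x$l * a$i$j$l)" by (simp add: eval3_def)
qed

lemma pullback3_near_identity:
  "\<exists>b c. \<forall>s. pullback3 (mat 1 + s *\<^sub>R H) a = a + s *\<^sub>R act3 H a + s\<^sup>2 *\<^sub>R b + s ^ 3 *\<^sub>R c"
proof -
  let ?h = "\<lambda>i. column i H" and ?e = "\<lambda>i. axis i (1::real)"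
  define b :: ten3 where "b = (\<chi> i j k. eval3 a (?h i) (?h j) (?e k) + eval3 a (?h i) (?e j) (?h k) + eval3 a (?e i) (?h j) (?h k))"
  define c :: ten3 where "c = (\<chi> i j k. eval3 a (?h i) (?h j) (?h k))"
  note lin = linear_add[OF eval3_linear(1)] linear_scale[OF eval3_linear(1)] linear_add[OF eval3_linear(2)]
    linear_scale[OF eval3_linear(2)] linear_add[OF eval3_linear(3)] linear_scale[OF eval3_linear(3)]
  have col: "column i (mat 1 + s *\<^sub>R H) = ?e i + s *\<^sub>R ?h i" for i s
    by (simp add: column_def mat_def axis_def vec_eq_iff)
  have act: "act3 H a $ i $ j $ k = eval3 a (?h i) (?e j) (?e k) + eval3 a (?e i) (?h j) (?e k) + eval3 a (?e i) (?e j) (?h k)" for i j k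
    by (simp add: act3_def eval3_axes column_def sum.distrib)
  have "pullback3 (mat 1 + s *\<^sub>R H) a = a + s *\<^sub>R act3 H a + s\<^sup>2 *\<^sub>R b + s ^ 3 *\<^sub>R c" for s
    unfolding vec_eq_iff pullback3_eq_eval3 col vector_add_component vector_scaleR_component act b_def c_def vec_lambda_beta
    by (simp add: lin eval3_axis algebra_simps power2_eq_square power3_eq_cube)
  then show ?thesis by blast
qed

lemma has_vector_derivative_pullback3:
  "((\<lambda>s. pullback3 (mat 1 + s *\<^sub>R H) a) has_vector_derivative act3 H a) (at 0)"
proof -
  obtain b c where "\<forall>s. pullback3 (mat 1 + s *\<^sub>R H) a = a + s *\<^sub>R act3 H a + s\<^sup>2 *\<^sub>R b + s ^ 3 *\<^sub>R c"
    using pullback3_near_identity by blast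
  then have "(\<lambda>s. pullback3 (mat 1 + s *\<^sub>R H) a) = (\<lambda>s. a + s *\<^sub>R act3 H a + s\<^sup>2 *\<^sub>R b + s ^ 3 *\<^sub>R c)" by blast
  then show ?thesis by (auto intro!: derivative_eq_intros)
qed

lemma matrix_mult_scaleR:
  fixes A :: "real^'n^'m" and B :: "real^'p^'n"
  shows "A ** (c *\<^sub>R B) = c *\<^sub>R (A ** B)" "(c *\<^sub>R A) ** B = c *\<^sub>R (A ** B)"
  by (simp_all add: vec_eq_iff matrix_matrix_mult_def sum_distrib_left mult_ac)

lemma matrix_mult_add:
  fixes A A' :: "real^'n^'m" and B B' :: "real^'p^'n"
  shows "A ** (B + B') = A ** B + A ** B'" "(A + A') ** B = A ** B + A' ** B"
  by (simp_all add: vec_eq_iff matrix_matrix_mult_def sum.distrib algebra_simps)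

text \<open>Conjugating the path \<open>1 + s H\<close> by \<open>P\<close>.\<close>
lemma pullback3_act3:
  assumes "P ** R = mat 1"
  shows "pullback3 P (act3 H a) = act3 (R ** H ** P) (pullback3 P a)"
proof -
  have "P ** (mat 1 + s *\<^sub>R (R ** H ** P)) = (mat 1 + s *\<^sub>R H) ** P" for s
  proof -
    have "P ** (R ** H ** P) = (P ** R) ** H ** P" by (simp add: matrix_mul_assoc)
    then show ?thesis
      by (simp add: matrix_mult_add matrix_mult_scaleR assms)
  qed
  then have "pullback3 (mat 1 + s *\<^sub>R (R ** H ** P)) (pullback3 P a) = pullback3 P (pullback3 (mat 1 + s *\<^sub>R H) a)" for s
    by (simp add: pullback3_compose)
  then have "((\<lambda>s. pullback3 P (pullback3 (mat 1 + s *\<^sub>R H) a)) has_vector_derivative act3 (R ** H ** P) (pullback3 P a)) (at 0)"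
    using has_vector_derivative_pullback3[of "R ** H ** P" "pullback3 P a"] by simp
  moreover have "((\<lambda>s. pullback3 P (pullback3 (mat 1 + s *\<^sub>R H) a)) has_vector_derivative pullback3 P (act3 H a)) (at 0)"
    by (rule bounded_linear.has_vector_derivative[OF linear_conv_bounded_linear[THEN iffD1, OF pullback3_linear]
          has_vector_derivative_pullback3])
  ultimately show ?thesis using vector_derivative_unique_at by metis
qed

lemma sum_pullback3_det7:
  "(\<Sum>q\<in>UNIV. \<Sum>r\<in>UNIV. \<Sum>s\<in>UNIV. pullback3 P a$q$r$s * det7 (column q A) (column r A) (column s A) w x y z)
   = (\<Sum>q\<in>UNIV. \<Sum>r\<in>UNIV. \<Sum>s\<in>UNIV. a$q$r$s * det7 (A *v P$q) (A *v P$r) (A *v P$s) w x y z)"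
proof -
  define \<Phi> where "\<Phi> b = (\<Sum>q\<in>UNIV. \<Sum>r\<in>UNIV. \<Sum>s\<in>UNIV. b$q$r$s * det7 (column q A) (column r A) (column s A) w x y z)" for b :: ten3
  have lin: "linear \<Phi>"
    by (rule linearI) (simp_all add: \<Phi>_def sum.distrib sum_distrib_left algebra_simps)
  have mv: "A *v u = (\<Sum>q\<in>UNIV. u$q *\<^sub>R column q A)" for u
    by (simp add: matrix_mult_sum scalar_mult_eq_scaleR)
  have 1: "det7 (A *v t) u v w x y z = (\<Sum>q\<in>UNIV. t$q * det7 (column q A) u v w x y z)" for t u v
    by (simp add: mv[of t] linear_sum[OF det7_linear(1)] linear_scale[OF det7_linear(1)])
  have 2: "det7 t (A *v u) v w x y z = (\<Sum>r\<in>UNIV. u$r * det7 t (column r A) v w x y z)" for t u v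
    by (simp add: mv[of u] linear_sum[OF det7_linear(2)] linear_scale[OF det7_linear(2)])
  have 3: "det7 t u (A *v v) w x y z = (\<Sum>s\<in>UNIV. v$s * det7 t u (column s A) w x y z)" for t u v
    by (simp add: mv[of v] linear_sum[OF det7_linear(3)] linear_scale[OF det7_linear(3)])
  have "\<Phi> (tensor_prod3 t u v) = det7 (A *v t) (A *v u) (A *v v) w x y z" for t u v
    by (simp only: 1, simp only: 2, simp only: 3) (simp add: \<Phi>_def tensor_prod3_def sum_distrib_left mult_ac)
  then have "\<Phi> (pullback3 P a) = (\<Sum>q\<in>UNIV. \<Sum>r\<in>UNIV. \<Sum>s\<in>UNIV. a$q$r$s * det7 (A *v P$q) (A *v P$r) (A *v P$s) w x y z)"
    by (simp add: pullback3_tensor_prod linear_sum[OF lin] linear_scale[OF lin])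
  then show ?thesis by (simp add: \<Phi>_def)
qed

lemma ginv_transpose_mult:
  assumes "det P \<noteq> 0"
  shows "ginv (transpose P ** P) = matrix_inv P ** transpose (matrix_inv P)"
proof (rule matrix_inv_eqI)
  let ?R = "matrix_inv P"
  have "transpose P ** P ** (?R ** transpose ?R) = transpose P ** (P ** ?R) ** transpose ?R"
    by (simp add: matrix_mul_assoc)
  also have "\<dots> = transpose (?R ** P)" by (simp add: matrix_inv_right_left(1)[OF assms] matrix_transpose_mul)
  finally show "transpose P ** P ** (?R ** transpose ?R) = mat 1"
    by (simp add: matrix_inv_right_left(2)[OF assms])
qed

text \<open>With \<open>R\<close> the inverse of \<open>P\<close>, indices are raised by
  \<open>R ** transpose R\<close>, so all seven arguments of the determinant become images under the
  same \<open>R\<close>; the resulting \<open>det R\<close> cancels \<open>det P\<close>.\<close>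

lemma hodge_star3_pullback:
  assumes "det P \<noteq> 0"
  shows "hodge_star3 (transpose P ** P) (det P) (pullback3 P a) $ i $ j $ k $ l
     = star4 a (column i P) (column j P) (column k P) (column l P)"
proof -
  define R where "R = matrix_inv P"
  have PR: "P ** R = mat 1" "R ** P = mat 1" using matrix_inv_right_left[OF assms] by (simp_all add: R_def)
  define A where "A = ginv (transpose P ** P)"
  have A: "A = R ** transpose R" unfolding A_def R_def by (rule ginv_transpose_mult[OF assms])
  have AP: "A *v P$q = axis q 1 v* transpose R" for q
  proof -
    have "P$q = transpose P *v axis q 1" by (simp add: axis_vector_matrix_mult)
    then have "A *v P$q = (R ** transpose (P ** R)) *v axis q 1"
      by (simp add: A matrix_vector_mul_assoc matrix_transpose_mul matrix_mul_assoc del: transpose_matrix_vector)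
    then show ?thesis by (simp add: PR)
  qed
  have e: "axis i 1 = column i P v* transpose R" for i
  proof -
    have "column i P v* transpose R = R *v (P *v axis i 1)" by (simp add: matrix_vector_mult_basis)
    then show ?thesis by (simp add: matrix_vector_mul_assoc PR)
  qed
  have dR: "det P * det R = 1" using arg_cong[OF PR(1), of det] by (simp add: det_mul)
  have "hodge_star3 (transpose P ** P) (det P) (pullback3 P a) $ i $ j $ k $ l
     = det P / 6 * (\<Sum>q\<in>UNIV. \<Sum>r\<in>UNIV. \<Sum>s\<in>UNIV. a$q$r$s * det7 (A *v P$q) (A *v P$r) (A *v P$s)
        (axis i 1) (axis j 1) (axis k 1) (axis l 1))"
    by (simp only: hodge_star3_det7 A_def[symmetric] sum_pullback3_det7)
  also have "\<dots> = det P / 6 * (\<Sum>q\<in>UNIV. \<Sum>r\<in>UNIV. \<Sum>s\<in>UNIV. a$q$r$s * (det7 (axis q 1) (axis r 1) (axis s 1)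
        (column i P) (column j P) (column k P) (column l P) * det R))"
    unfolding AP e[of i] e[of j] e[of k] e[of l] det7_vector_matrix_mult by simp
  also have "\<dots> = (det P * det R) * star4 a (column i P) (column j P) (column k P) (column l P)"
    by (simp add: star4_def sum_distrib_left sum_distrib_right mult_ac)
  finally show ?thesis by (simp add: dR)
qed

lemma contract3_skew:
  assumes "alternating3 a"
  shows "transpose (contract3 x a) = - contract3 x a"
proof -
  have *: "contract3 x a $ k $ j = - contract3 x a $ j $ k" for j k
    unfolding contract3_def vec_lambda_beta sum_negf[symmetric]
    by (rule sum.cong[OF refl]) (subst alternating3_swap(2)[OF assms], simp)
  show ?thesis unfolding vec_eq_iff transpose_def by (simp add: *[symmetric])
qed

text \<open>The infinitesimal action of the skew endomorphism \<open>X \<lrcorner> \<phi>\<close> on \<open>\<phi>\<close> is \<open>3 X \<lrcorner> \<psi>\<close>.\<close>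
lemma contract4_hodge_star3_act3:
  assumes alt: "alternating3 a" and g: "G2_metric_vol a g v"
  shows "\<exists>H. contract4 g X (hodge_star3 g v a) = act3 H a \<and> transpose H ** g + g ** H = 0"
proof -
  obtain P a0 where std: "G2_standard a0" and a: "a = pullback3 P a0" and gP: "g = transpose P ** P"
    and v: "v = det P" and d: "det P \<noteq> 0"
    using G2_normal_form[OF assms] by blast
  define R where "R = matrix_inv P"
  have PR: "P ** R = mat 1" "R ** P = mat 1" using matrix_inv_right_left[OF d] by (simp_all add: R_def)
  \<comment> \<open>The vector dual to \<open>X\<close> with respect to \<open>g\<close>, carried by
    \<open>P\<close> to the coordinates of the standard form.\<close>
  define w where "w = (\<Sum>m\<in>UNIV. \<Sum>n\<in>UNIV. (ginv g $ m $ n * X$m) *\<^sub>R column n P)"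
  define J where "J = (1 / 3) *\<^sub>R contract3 w a0"
  define H where "H = R ** J ** P"
  have "contract4 g X (hodge_star3 g v a) $ i $ j $ k = pullback3 P (\<chi> i j k. star4 a0 w (axis i 1) (axis j 1) (axis k 1)) $ i $ j $ k" for i j k
  proof -
    have ax: "y = (\<Sum>l\<in>UNIV. y$l *\<^sub>R axis l 1)" for y :: "real^7"
      using basis_expansion[of y] by (simp add: scalar_mult_eq_scaleR)
    have "contract4 g X (hodge_star3 g v a) $ i $ j $ k = star4 a0 w (column i P) (column j P) (column k P)"
      unfolding w_def linear_sum[OF star4_linear(1)] linear_scale[OF star4_linear(1)]
      by (simp add: contract4_def a gP v hodge_star3_pullback[OF d])
    also have "\<dots> = (\<Sum>l\<in>UNIV. P$l$i * (\<Sum>m\<in>UNIV. P$m$j * (\<Sum>n\<in>UNIV. P$n$k * star4 a0 w (axis l 1) (axis m 1) (axis n 1))))"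
    proof -
      have 1: "star4 a0 w y y' y'' = (\<Sum>l\<in>UNIV. y$l * star4 a0 w (axis l 1) y' y'')" for y y' y''
        by (subst (1) ax) (simp add: linear_sum[OF star4_linear(2)] linear_scale[OF star4_linear(2)])
      have 2: "star4 a0 w y' y y'' = (\<Sum>l\<in>UNIV. y$l * star4 a0 w y' (axis l 1) y'')" for y y' y''
        by (subst (1) ax[of y]) (simp add: linear_sum[OF star4_linear(3)] linear_scale[OF star4_linear(3)])
      have 3: "star4 a0 w y' y'' y = (\<Sum>l\<in>UNIV. y$l * star4 a0 w y' y'' (axis l 1))" for y y' y''
        by (subst (1) ax[of y]) (simp add: linear_sum[OF star4_linear(4)] linear_scale[OF star4_linear(4)])
      show ?thesis
        by (subst 1, subst 2, subst 3) (simp add: column_def)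
    qed
    finally show ?thesis by (simp add: pullback3_def sum_distrib_left mult_ac)
  qed
  then have "contract4 g X (hodge_star3 g v a) = pullback3 P ((1 / 3) *\<^sub>R act3 (contract3 w a0) a0)"
    by (simp add: vec_eq_iff G2_standard_star4[OF std, symmetric])
  also have "(1 / 3) *\<^sub>R act3 (contract3 w a0) a0 = act3 J a0"
    by (simp add: J_def act3_def vec_eq_iff sum_distrib_left algebra_simps)
  also have "pullback3 P (act3 J a0) = act3 H a" unfolding H_def a by (rule pullback3_act3[OF PR(1)])
  finally have 1: "contract4 g X (hodge_star3 g v a) = act3 H a" .
  have skew: "transpose J = - J"
    using contract3_skew[OF G2_standard_alternating[OF std], of w] unfolding J_def transpose_scalar by simp
  \<comment> \<open>\<open>g ** H\<close> is congruent to the skew matrix \<open>J\<close>, hence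
    skew itself.\<close>
  have "g ** H = transpose P ** ((P ** R) ** J ** P)" by (simp add: gP H_def matrix_mul_assoc)
  then have gH: "g ** H = transpose P ** J ** P" by (simp add: PR matrix_mul_assoc)
  have "transpose (g ** H) = transpose P ** transpose J ** P" unfolding gH by (simp add: matrix_transpose_mul matrix_mul_assoc)
  moreover have "transpose (g ** H) = transpose H ** g" by (simp add: gP matrix_transpose_mul matrix_mul_assoc)
  ultimately have "transpose H ** g = transpose P ** (- J) ** P" by (simp add: skew)
  also have "\<dots> = (- 1) *\<^sub>R (g ** H)"
    unfolding gH using matrix_mult_scaleR(1)[of "transpose P" "- 1" J] matrix_mult_scaleR(2)[of "- 1" "transpose P ** J" P] by simp
  finally show ?thesis using 1 by auto
qed

section \<open>The metric as a function of the 3-form\<close>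

lemma det_scaleR: "det (c *\<^sub>R A :: real^'n^'n) = c ^ CARD('n) * det A"
proof -
  have "c *\<^sub>R A = mat c ** A"
    by (simp add: vec_eq_iff matrix_matrix_mult_def mat_def if_distrib[of "\<lambda>x. x * _"] cong: if_cong)
  then show ?thesis using det_matrix_scaleR[of c, where 'n = 'n] by (simp add: det_mul matrix_scaleR)
qed

text \<open>The matrix of \<open>(X \<lrcorner> a) \<and> (Y \<lrcorner> a) \<and> a\<close>. As its determinant is \<open>(-6)^7 v^9\<close>, it determines \<open>v\<close> and
  then the metric.\<close>
definition G2_bilinear :: "ten3 \<Rightarrow> ten2" where
  "G2_bilinear a = (\<chi> i j. wedge223 (a $ i) (a $ j) a)"

definition G2_vol_formula :: "ten3 \<Rightarrow> real" where
  "G2_vol_formula a = root 9 (det (G2_bilinear a) / (- 6) ^ 7)"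

definition G2_metric_formula :: "ten3 \<Rightarrow> ten2" where
  "G2_metric_formula a = (1 / (- 6 * G2_vol_formula a)) *\<^sub>R G2_bilinear a"

lemma wedge223_contract3:
  "wedge223 (contract3 X a) (contract3 Y a) a = X \<bullet> (G2_bilinear a *v Y)"
proof -
  have c: "contract3 X a = (\<Sum>i\<in>UNIV. X$i *\<^sub>R a $ i)" for X
    by (simp add: contract3_def vec_eq_iff sum_component)
  show ?thesis
    unfolding c linear_sum[OF wedge223_linear(1)] linear_scale[OF wedge223_linear(1)]
      linear_sum[OF wedge223_linear(2)] linear_scale[OF wedge223_linear(2)]
    by (simp add: G2_bilinear_def inner_vec_def matrix_vector_mult_def sum_distrib_left mult_ac) (rule sum.swap)
qed

text \<open>Exchanging the index pairs of the two 2-forms is the even permutation (1 3)(2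
  4).\<close>

lemma wedge223_commute: "wedge223 \<beta> \<alpha> \<gamma> = wedge223 \<alpha> \<beta> \<gamma>"
proof -
  let ?q = "Transposition.transpose 1 3 \<circ> Transposition.transpose 2 (4::7)"
  have q: "?q permutes UNIV" by (intro permutes_compose permutes_swap_id) auto
  have s: "sign (p \<circ> ?q) = sign p" if "p permutes (UNIV :: 7 set)" for p
    using that by (simp add: sign_compose permutes_imp_permutation[OF finite] permutation_swap_id
      permutation_compose sign_swap_id)
  show ?thesis unfolding wedge223_def
    by (subst sum_permutations_compose_right[OF q], rule arg_cong[where f = "\<lambda>x. x / 24"], rule sum.cong[OF refl])
       (simp only: mem_Collect_eq s, simp add: Transposition.transpose_def mult_ac)
qed

lemma transpose_G2_bilinear: "transpose (G2_bilinear a) = G2_bilinear a"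
  by (simp add: vec_eq_iff transpose_def G2_bilinear_def wedge223_commute[of "a $ j" "a $ i" for i j])

lemma G2_metric_vol_imp_formula:
  assumes "G2_metric_vol a g v"
  shows "v = G2_vol_formula a" "g = G2_metric_formula a" "det (G2_bilinear a) \<noteq> 0"
proof -
  have v2: "v\<^sup>2 = det g" using assms by (simp add: G2_metric_vol_def)
  moreover have "det g \<noteq> 0"
    by (rule pos_def_invertible(2)) (use assms in \<open>simp add: G2_metric_vol_def\<close>)
  ultimately have v0: "v \<noteq> 0" by auto
  have "axis i 1 \<bullet> (G2_bilinear a *v axis j 1) = - 6 * v * (axis i 1 \<bullet> (g *v axis j 1))" for i j
    using assms by (simp add: G2_metric_vol_def wedge223_contract3)
  then have B: "G2_bilinear a = (- 6 * v) *\<^sub>R g"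
    by (simp add: vec_eq_iff matrix_component_inner[of "G2_bilinear a"] matrix_component_inner[of g])
  have d: "det (G2_bilinear a) = (- 6) ^ 7 * v ^ 9"
    unfolding B det_scaleR v2[symmetric] by (simp add: power_mult_distrib power_add[symmetric] mult.assoc)
  then show "det (G2_bilinear a) \<noteq> 0" using v0 by simp
  show v: "v = G2_vol_formula a"
    unfolding G2_vol_formula_def d by (simp add: odd_real_root_power_cancel)
  show "g = G2_metric_formula a"
    unfolding G2_metric_formula_def v[symmetric] B using v0 by simp
qed

text \<open>The converse of \<open>G2_metric_vol_imp_formula\<close>: once \<open>det B\<close> is
  nonzero the formulas solve \<open>B = - 6 v g\<close> and \<open>v^2 = det g\<close> identically,
  so only positivity has to be asked for. Both conditions are open, hence nondegeneracy survives
  small variations.\<close>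

lemma G2_metric_vol_formula:
  assumes d: "det (G2_bilinear a) \<noteq> 0" and pos: "\<And>X. X \<noteq> 0 \<Longrightarrow> X \<bullet> (G2_metric_formula a *v X) > 0"
  shows "G2_metric_vol a (G2_metric_formula a) (G2_vol_formula a)"
proof -
  define v where "v = G2_vol_formula a"
  have v9: "v ^ 9 = det (G2_bilinear a) / (- 6) ^ 7"
    unfolding v_def G2_vol_formula_def by (rule odd_real_root_pow) simp
  then have v0: "v \<noteq> 0" using d by auto
  have g: "G2_metric_formula a = (1 / (- 6 * v)) *\<^sub>R G2_bilinear a" by (simp add: G2_metric_formula_def v_def)
  have "det (G2_metric_formula a) = (1 / (- 6 * v)) ^ 7 * ((- 6) ^ 7 * v ^ 9)"
    unfolding g det_scaleR v9 by simp
  also have "\<dots> = v\<^sup>2" using v0 by (simp add: field_simps power_mult_distrib eval_nat_numeral)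
  finally have "v\<^sup>2 = det (G2_metric_formula a)" by simp
  moreover have "transpose (G2_metric_formula a) = G2_metric_formula a"
    unfolding g transpose_scalar transpose_G2_bilinear ..
  moreover have "G2_bilinear a = (- 6 * v) *\<^sub>R G2_metric_formula a" using v0 by (simp add: g)
  then have "wedge223 (contract3 X a) (contract3 Y a) a = - 6 * (X \<bullet> (G2_metric_formula a *v Y)) * v" for X Y
    unfolding wedge223_contract3 by (simp only: scaleR_matrix_vector_assoc[symmetric] inner_scaleR_right mult_ac)
  ultimately show ?thesis using pos unfolding G2_metric_vol_def v_def by auto
qed

lemma G2_metric_eq: "G2_metric_vol a g v \<Longrightarrow> G2_metric a = g"
  unfolding G2_metric_def by (rule the_equality) (auto dest: G2_metric_vol_imp_formula(2))

lemma G2_vol_eq: "G2_metric_vol a g v \<Longrightarrow> G2_vol a = v"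
  unfolding G2_vol_def by (rule the_equality) (auto dest: G2_metric_vol_imp_formula(1))

section \<open>Smooth dependence of metric and volume on the 3-form\<close>

lemma C_k_on_wedge223:
  assumes "open S" "C_k_on k S \<alpha>" "C_k_on k S \<beta>" "C_k_on k S \<gamma>"
  shows "C_k_on k S (\<lambda>z. wedge223 (\<alpha> z) (\<beta> z) (\<gamma> z))"
  unfolding wedge223_def divide_inverse
  by (intro C_k_on_sum C_k_on_mult C_k_on_const C_k_on_vec_nth assms)

lemma C_k_on_det:
  fixes A :: "'a::real_normed_vector \<Rightarrow> real^'n^'n"
  assumes "open S" "C_k_on k S A"
  shows "C_k_on k S (\<lambda>z. det (A z))"
  unfolding det_def by (intro C_k_on_sum C_k_on_prod C_k_on_mult C_k_on_const C_k_on_vec_nth assms)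

lemma C_k_on_G2_bilinear:
  assumes "open S" "C_k_on k S \<Psi>"
  shows "C_k_on k S (\<lambda>z. G2_bilinear (\<Psi> z))"
  unfolding G2_bilinear_def by (intro C_k_on_vec_lambda C_k_on_wedge223 C_k_on_vec_nth assms)

lemma C_k_on_G2_vol_formula:
  assumes "open S" "C_k_on k S \<Psi>" "\<And>z. z \<in> S \<Longrightarrow> det (G2_bilinear (\<Psi> z)) \<noteq> 0"
  shows "C_k_on k S (\<lambda>z. G2_vol_formula (\<Psi> z))"
  unfolding G2_vol_formula_def
  by (intro C_k_on_odd_root C_k_on_divide C_k_on_det C_k_on_G2_bilinear C_k_on_const assms) (auto simp: assms(3))

lemma C_k_on_G2_metric_formula:
  assumes "open S" "C_k_on k S \<Psi>" "\<And>z. z \<in> S \<Longrightarrow> det (G2_bilinear (\<Psi> z)) \<noteq> 0"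
  shows "C_k_on k S (\<lambda>z. G2_metric_formula (\<Psi> z))"
  unfolding G2_metric_formula_def
  by (intro C_k_on_scaleR C_k_on_divide C_k_on_mult C_k_on_G2_vol_formula C_k_on_G2_bilinear C_k_on_const assms)
     (auto simp: assms(3) G2_vol_formula_def)

lemma transpose_add: "transpose (A + B) = transpose A + transpose (B :: real^'n^'m)"
  by (simp add: vec_eq_iff transpose_def)

text \<open>Differentiating the equivariance of the metric along the curve
  \<open>mat 1 + s H\<close> gives the derivative of the formula on orbit directions without
  touching the ninth root.\<close>

lemma G2_metric_formula_derivative_act3:
  assumes g: "G2_metric_vol a g v" and D: "(G2_metric_formula has_derivative D) (at a)"
  shows "D (act3 H a) = transpose H ** g + g ** H"
proof -
  define c where "c s = pullback3 (mat 1 + s *\<^sub>R H) a" for s :: real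
  have c0: "c 0 = a" by (simp add: c_def)
  have "(c has_derivative (\<lambda>s. s *\<^sub>R act3 H a)) (at 0)"
    using has_vector_derivative_pullback3[of H a] unfolding c_def has_vector_derivative_def .
  then have "((\<lambda>s. G2_metric_formula (c s)) has_derivative (\<lambda>s. D (s *\<^sub>R act3 H a))) (at 0)"
    by (rule has_derivative_compose) (simp add: c0 D)
  then have 1: "((\<lambda>s. G2_metric_formula (c s)) has_vector_derivative D (act3 H a)) (at 0)"
    unfolding has_vector_derivative_def using linear_scale[OF has_derivative_linear[OF D]] by simp
  have cont: "continuous_on UNIV (\<lambda>s::real. det (mat 1 + s *\<^sub>R H))"
    unfolding det_def by (intro continuous_intros)
  \<comment> \<open>The parameters for which \<open>mat 1 + s H\<close> is invertible, where
    equivariance gives the metric exactly.\<close>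
  define S where "S = {s::real. det (mat 1 + s *\<^sub>R H) \<noteq> 0}"
  have "S = (\<lambda>s. det (mat 1 + s *\<^sub>R H)) -` (- {0})" by (auto simp: S_def)
  then have S: "open S" using continuous_open_preimage[OF cont open_UNIV, of "- {0}"] by (simp add: open_Compl)
  have S0: "0 \<in> S" by (simp add: S_def)
  have path: "G2_metric_formula (c s) = g + s *\<^sub>R (transpose H ** g + g ** H) + s\<^sup>2 *\<^sub>R (transpose H ** g ** H)"
    if "s \<in> S" for s
  proof -
    have "G2_metric_formula (c s) = transpose (mat 1 + s *\<^sub>R H) ** g ** (mat 1 + s *\<^sub>R H)"
      using G2_metric_vol_imp_formula(2)[OF G2_metric_vol_pullback[OF g]] that
      by (simp add: S_def c_def)
    also have "\<dots> = g + s *\<^sub>R (transpose H ** g + g ** H) + s\<^sup>2 *\<^sub>R (transpose H ** g ** H)"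
      by (simp add: transpose_add transpose_scalar matrix_mult_add matrix_mult_scaleR algebra_simps power2_eq_square)
    finally show ?thesis .
  qed
  have "((\<lambda>s. g + s *\<^sub>R (transpose H ** g + g ** H) + s\<^sup>2 *\<^sub>R (transpose H ** g ** H))
      has_vector_derivative (transpose H ** g + g ** H)) (at 0)"
    by (auto intro!: derivative_eq_intros)
  then have "((\<lambda>s. G2_metric_formula (c s)) has_vector_derivative (transpose H ** g + g ** H)) (at 0)"
    by (rule has_vector_derivative_transform_within_open[OF _ S S0]) (simp add: path)
  with 1 show ?thesis by (rule vector_derivative_unique_at)
qed

lemma transpose_ginv:
  fixes g :: ten2
  assumes "transpose g = g" "det g \<noteq> 0"
  shows "transpose (ginv g) = ginv g"
proof -
  have "transpose (ginv g) ** g = transpose (g ** ginv g)" by (simp add: matrix_transpose_mul assms(1))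
  also have "\<dots> = mat 1" by (simp add: matrix_inv_right_left[OF assms(2)])
  finally have "transpose (ginv g) ** g ** ginv g = ginv g" by simp
  then show ?thesis by (simp add: matrix_mul_assoc[symmetric] matrix_inv_right_left[OF assms(2)])
qed

lemma G2_metric_vol_det: "G2_metric_vol a g v \<Longrightarrow> det g \<noteq> 0"
  by (rule pos_def_invertible(2)) (simp add: G2_metric_vol_def)

lemma diamond_eq_act3:
  assumes "transpose (ginv g) = ginv g" "transpose h = h"
  shows "diamond g h a = act3 (ginv g ** h) a"
proof -
  have g: "ginv g $ p $ q = ginv g $ q $ p" and h: "h $ p $ q = h $ q $ p" for p q
    using arg_cong[OF assms(1), of "\<lambda>M. M $ q $ p"] arg_cong[OF assms(2), of "\<lambda>M. M $ q $ p"]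
    by (simp_all add: transpose_def)
  have s: "ginv g $ p $ l * (h$i$p * A + h$j$p * B + h$k$p * C)
      = ginv g $ l $ p * h$p$i * A + ginv g $ l $ p * h$p$j * B + ginv g $ l $ p * h$p$k * C" for p l i j k A B C
    by (simp add: g[of p l] h[of i p] h[of j p] h[of k p] algebra_simps)
  have "diamond g h a $ i $ j $ k = act3 (ginv g ** h) a $ i $ j $ k" for i j k
    unfolding diamond_def act3_def vec_lambda_beta s
    by (subst sum.swap) (simp add: matrix_matrix_mult_def sum_distrib_right sum.distrib)
  then show ?thesis by (simp add: vec_eq_iff)
qed

text \<open>The metric varies by \<open>2 h\<close> along \<open>h \<diamond> \<phi> + X \<lrcorner> \<psi>\<close>: the first summand is the infinitesimal action of \<open>g\<^sup>-\<^sup>1 h\<close>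
  and the second one the infinitesimal action of a \<open>g\<close>-skew endomorphism.\<close>
lemma G2_metric_formula_derivative_pair:
  assumes alt: "alternating3 a" and g: "G2_metric_vol a g v" and D: "(G2_metric_formula has_derivative D) (at a)"
    and h: "transpose h = h"
  shows "D (pair_to_3_form a (h, X)) = 2 *\<^sub>R h"
proof -
  have sym: "transpose g = g" using g by (simp add: G2_metric_vol_def)
  note d = G2_metric_vol_det[OF g]
  note I = transpose_ginv[OF sym d]
  have eq: "G2_metric a = g" "G2_psi a = hodge_star3 g v a"
    using G2_metric_eq[OF g] G2_vol_eq[OF g] by (simp_all add: G2_psi_def)
  obtain H where H: "contract4 g X (hodge_star3 g v a) = act3 H a" "transpose H ** g + g ** H = 0"
    using contract4_hodge_star3_act3[OF alt g] by blast
  have "pair_to_3_form a (h, X) = act3 (ginv g ** h) a + act3 H a"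
    by (simp add: pair_to_3_form_def eq H(1) diamond_eq_act3[OF I h])
  then have "D (pair_to_3_form a (h, X)) = D (act3 (ginv g ** h) a) + D (act3 H a)"
    by (simp add: linear_add[OF has_derivative_linear[OF D]])
  also have "\<dots> = transpose (ginv g ** h) ** g + g ** (ginv g ** h)"
    by (simp add: G2_metric_formula_derivative_act3[OF g D] H(2))
  also have "transpose (ginv g ** h) ** g = h ** (ginv g ** g)"
    by (simp add: matrix_transpose_mul I h matrix_mul_assoc)
  also have "g ** (ginv g ** h) = (g ** ginv g) ** h" by (simp add: matrix_mul_assoc)
  finally show ?thesis by (simp add: matrix_inv_right_left[OF d] scaleR_2)
qed

section \<open>Curvature\<close>

lemma C_k_on_differentiable: "C_k_on (Suc k) S f \<Longrightarrow> x \<in> S \<Longrightarrow> f differentiable (at x)"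
  by simp

lemma C_k_on_derivative: "C_k_on (Suc k) S f \<Longrightarrow> C_k_on k S (\<lambda>x. frechet_derivative f (at x) v)"
  by simp

section \<open>Families depending on a parameter\<close>

lemma pd_slice:
  assumes "K differentiable (at (s, z))"
  shows "pd i (\<lambda>z. K (s, z)) z = frechet_derivative K (at (s, z)) (0, axis i 1)"
proof -
  have "((\<lambda>z. (s, z)) has_derivative (\<lambda>v. (0, v))) (at z)"
    by (auto intro!: derivative_eq_intros)
  from has_derivative_compose[OF this assms[unfolded frechet_derivative_works]]
  have "((\<lambda>z. K (s, z)) has_derivative (\<lambda>v. frechet_derivative K (at (s, z)) (0, v))) (at z)" .
  from frechet_derivative_at[OF this] show ?thesis unfolding pd_def by metis
qed

lemma has_vector_derivative_slice:
  assumes "K differentiable (at (s, z))"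
  shows "((\<lambda>s. K (s, z)) has_vector_derivative frechet_derivative K (at (s, z)) (1, 0)) (at s)"
proof -
  let ?D = "frechet_derivative K (at (s, z))"
  have D: "(K has_derivative ?D) (at (s, z))" using assms unfolding frechet_derivative_works .
  have "((\<lambda>s. (s, z)) has_derivative (\<lambda>r. (r, 0))) (at s)"
    by (auto intro!: derivative_eq_intros)
  from has_derivative_compose[OF this D]
  have "((\<lambda>s. K (s, z)) has_derivative (\<lambda>r. ?D (r, 0))) (at s)" .
  moreover have "(\<lambda>r. ?D (r, 0)) = (\<lambda>r. r *\<^sub>R ?D (1, 0))"
  proof
    fix r :: real
    have "?D (r *\<^sub>R (1, 0)) = r *\<^sub>R ?D (1, 0)" by (rule linear_scale[OF has_derivative_linear[OF D]])
    then show "?D (r, 0) = r *\<^sub>R ?D (1, 0)"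
      by (simp only: scaleR_Pair scaleR_zero_right real_scaleR_def mult_1_right)
  qed
  ultimately show ?thesis unfolding has_vector_derivative_def by metis
qed

lemma pd_cong_open:
  assumes "open S" "y \<in> S" "\<And>z. z \<in> S \<Longrightarrow> f z = g z"
  shows "pd i f y = pd i g y"
  unfolding pd_def by (simp only: frechet_derivative_cong_open[OF assms])

lemma open_slice: "open W \<Longrightarrow> open {z. (s, z) \<in> W}"
  using open_vimage[of W "\<lambda>z. (s, z)"] by (simp add: vimage_def continuous_on_Pair)

lemma open_slice': "open W \<Longrightarrow> open {s. (s, z) \<in> W}"
  using open_vimage[of W "\<lambda>s. (s, z)"] by (simp add: vimage_def continuous_on_Pair)

lemma pd_pd_slice:
  assumes W: "open W" "(s, y) \<in> W" and K: "C_k_on 2 W K"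
  shows "pd i (pd j (\<lambda>z. K (s, z))) y =
    frechet_derivative (\<lambda>p. frechet_derivative K (at p) (0, axis j 1)) (at (s, y)) (0, axis i 1)"
proof -
  let ?Kj = "\<lambda>p. frechet_derivative K (at p) (0, axis j 1)"
  have K1: "K differentiable (at p)" and K2: "?Kj differentiable (at p)" if "p \<in> W" for p
    using C_k_on_differentiable[OF K[unfolded numeral_2_eq_2] that]
      C_k_on_differentiable[OF C_k_on_derivative[OF K[unfolded numeral_2_eq_2]] that] .
  have "pd i (pd j (\<lambda>z. K (s, z))) y = pd i (\<lambda>z. ?Kj (s, z)) y"
    by (rule pd_cong_open[OF open_slice[OF W(1)]]) (use W(2) pd_slice[OF K1] in auto)
  also have "\<dots> = frechet_derivative ?Kj (at (s, y)) (0, axis i 1)"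
    by (rule pd_slice[OF K2[OF W(2)]])
  finally show ?thesis .
qed

text \<open>The family is one function on the product, with d/ds and the coordinate derivatives as
  its derivatives in the directions \<open>(1, 0)\<close> and \<open>(0, axis i 1)\<close>; symmetry
  of second derivatives moves d/ds inside. The last claim takes three derivatives, hence class
  3.\<close>

lemma has_vector_derivative_jet:
  fixes K :: "real \<times> (real^7) \<Rightarrow> 'b::euclidean_space"
  assumes W: "open W" "(0, y) \<in> W" and K: "C_k_on 3 W K"
    and k: "\<And>z. (0, z) \<in> W \<Longrightarrow> frechet_derivative K (at (0, z)) (1, 0) = k z"
  shows "((\<lambda>s. K (s, y)) has_vector_derivative k y) (at 0)"
    "((\<lambda>s. pd i (\<lambda>z. K (s, z)) y) has_vector_derivative pd i k y) (at 0)"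
    "((\<lambda>s. pd i (pd j (\<lambda>z. K (s, z))) y) has_vector_derivative pd i (pd j k) y) (at 0)"
proof -
  define d where "d v p = frechet_derivative K (at p) v" for v p
  define dd where "dd v w p = frechet_derivative (d v) (at p) w" for v w p
  let ?e = "\<lambda>i. (0 :: real, axis i (1::real) :: real^7)" and ?t = "(1 :: real, 0 :: real^7)"
  have K3: "C_k_on (Suc (Suc (Suc 0))) W K" using K unfolding numeral_3_eq_3 .
  have d2: "C_k_on (Suc (Suc 0)) W (d v)" for v unfolding d_def by (rule C_k_on_derivative[OF K3])
  have dd1: "C_k_on (Suc 0) W (dd v w)" for v w unfolding dd_def by (rule C_k_on_derivative[OF d2])
  have C2: "C_k_on 2 W (d v)" for v using d2 unfolding numeral_2_eq_2 .
  have CK2: "C_k_on 2 W K" by (rule C_k_on_le[OF K]) simp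
  have dif: "K differentiable (at p)" "d v differentiable (at p)" "dd v w differentiable (at p)" if "p \<in> W" for v w p
    using C_k_on_differentiable[OF K3 that] C_k_on_differentiable[OF d2 that] C_k_on_differentiable[OF dd1 that] .
  have sym: "dd v w p = dd w v p" if "p \<in> W" for v w p
    using second_derivative_symmetric[OF W(1) CK2 that, of v w] unfolding dd_def d_def .
  have opS: "open {s. (s, y) \<in> W}" "0 \<in> {s. (s, y) \<in> W}" using open_slice'[OF W(1)] W(2) by auto
  have opZ: "open {z. (0, z) \<in> W}" "y \<in> {z. (0, z) \<in> W}" using open_slice[OF W(1)] W(2) by auto
  show "((\<lambda>s. K (s, y)) has_vector_derivative k y) (at 0)"
    using has_vector_derivative_slice[OF dif(1)[OF W(2)]] k[OF W(2)] by simp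
  have eq1: "dd (?e i) ?t (0, y) = pd i k y"
  proof -
    have "pd i k y = pd i (\<lambda>z. d ?t (0, z)) y"
      by (rule pd_cong_open[OF opZ]) (simp add: d_def k)
    also have "\<dots> = dd ?t (?e i) (0, y)" unfolding dd_def by (rule pd_slice[OF dif(2)[OF W(2)]])
    finally show ?thesis using sym[OF W(2)] by simp
  qed
  have "((\<lambda>s. d (?e i) (s, y)) has_vector_derivative pd i k y) (at 0)"
    unfolding eq1[symmetric] dd_def by (rule has_vector_derivative_slice[OF dif(2)[OF W(2)]])
  then show "((\<lambda>s. pd i (\<lambda>z. K (s, z)) y) has_vector_derivative pd i k y) (at 0)"
    by (rule has_vector_derivative_transform_within_open[OF _ opS]) (simp add: d_def pd_slice dif(1))
  \<comment> \<open>The parameter direction is exchanged first with the outer coordinate direction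
    and then with the inner one.\<close>
  have eq2: "frechet_derivative (dd (?e j) (?e i)) (at (0, y)) ?t = pd i (pd j k) y"
  proof -
    have "frechet_derivative (dd (?e j) (?e i)) (at (0, y)) ?t
        = frechet_derivative (dd (?e j) ?t) (at (0, y)) (?e i)"
      using second_derivative_symmetric[OF W(1) C2 W(2), of "?e j" "?e i" ?t] unfolding dd_def .
    also have "frechet_derivative (dd (?e j) ?t) (at (0, y)) = frechet_derivative (dd ?t (?e j)) (at (0, y))"
      by (rule frechet_derivative_cong_open[OF W]) (rule sym)
    also have "frechet_derivative (dd ?t (?e j)) (at (0, y)) (?e i) = pd i (pd j (\<lambda>z. d ?t (0, z))) y"
      using pd_pd_slice[OF W C2, of i j ?t] unfolding dd_def by simp
    also have "\<dots> = pd i (pd j k) y"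
    proof (rule pd_cong_open[OF opZ])
      fix z assume z: "z \<in> {z. (0, z) \<in> W}"
      show "pd j (\<lambda>z. d ?t (0, z)) z = pd j k z"
        by (rule pd_cong_open[OF opZ(1) z]) (simp add: d_def k)
    qed
    finally show ?thesis .
  qed
  have "((\<lambda>s. dd (?e j) (?e i) (s, y)) has_vector_derivative pd i (pd j k) y) (at 0)"
    unfolding eq2[symmetric] by (rule has_vector_derivative_slice[OF dif(3)[OF W(2)]])
  then show "((\<lambda>s. pd i (pd j (\<lambda>z. K (s, z))) y) has_vector_derivative pd i (pd j k) y) (at 0)"
    by (rule has_vector_derivative_transform_within_open[OF _ opS])
       (use pd_pd_slice[OF W(1) _ CK2] in \<open>simp add: dd_def d_def[abs_def]\<close>)
qed

text \<open>The Christoffel symbols, their derivatives and the curvature as functions of the 2-jet of the metric: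
  \<open>D $ i\<close> stands for \<open>\<partial>\<^sub>i g\<close> and \<open>DD $ i $ j\<close> for \<open>\<partial>\<^sub>i \<partial>\<^sub>j g\<close>.\<close>
definition christoffel1 :: "ten2^7 \<Rightarrow> 7 \<Rightarrow> 7 \<Rightarrow> 7 \<Rightarrow> real" where
  "christoffel1 D l j k = D$j$k$l + D$k$j$l - D$l$j$k"

definition christoffel_jet :: "ten2 \<Rightarrow> ten2^7 \<Rightarrow> 7 \<Rightarrow> 7 \<Rightarrow> 7 \<Rightarrow> real" where
  "christoffel_jet g D m j k = (\<Sum>l\<in>UNIV. ginv g $ m $ l * christoffel1 D l j k) / 2"

text \<open>The derivative of the inverse metric, by
  \<open>d(g^-1) = - g^-1 (dg) g^-1\<close>.\<close>

definition dginv_jet :: "ten2 \<Rightarrow> ten2^7 \<Rightarrow> 7 \<Rightarrow> 7 \<Rightarrow> 7 \<Rightarrow> real" where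
  "dginv_jet g D i m l = - (\<Sum>p\<in>UNIV. (\<Sum>q\<in>UNIV. ginv g $ m $ q * D$i$q$p) * ginv g $ p $ l)"

definition dchristoffel_jet :: "ten2 \<Rightarrow> ten2^7 \<Rightarrow> ten2^7^7 \<Rightarrow> 7 \<Rightarrow> 7 \<Rightarrow> 7 \<Rightarrow> 7 \<Rightarrow> real" where
  "dchristoffel_jet g D DD i m j k = (\<Sum>l\<in>UNIV. dginv_jet g D i m l * christoffel1 D l j k
     + ginv g $ m $ l * christoffel1 (DD$i) l j k) / 2"

definition riemann_jet :: "ten2 \<Rightarrow> ten2^7 \<Rightarrow> ten2^7^7 \<Rightarrow> ten4" where
  "riemann_jet g D DD = (\<chi> i j k l. \<Sum>m\<in>UNIV.
     (dchristoffel_jet g D DD i m j k + (\<Sum>n\<in>UNIV. christoffel_jet g D m i n * christoffel_jet g D n j k)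
      - (dchristoffel_jet g D DD j m i k + (\<Sum>n\<in>UNIV. christoffel_jet g D m j n * christoffel_jet g D n i k))) * g$m$l)"

text \<open>Cramer's rule: \<open>matrix_inv\<close> is defined by choice, and this exhibits it as a
  rational function of the entries, hence smooth where the determinant is nonzero.\<close>

lemma ginv_component:
  fixes g :: ten2
  assumes "det g \<noteq> 0"
  shows "ginv g $ i $ j = det (\<chi> r c. if c = i then axis j 1 $ r else g $ r $ c) / det g"
proof -
  have "g *v (ginv g *v axis j 1) = axis j 1"
    by (simp add: matrix_vector_mul_assoc matrix_inv_right_left[OF assms])
  then have "ginv g *v axis j 1 = (\<chi> k. det (\<chi> r c. if c = k then axis j 1 $ r else g $ r $ c) / det g)"
    using cramer[OF assms] by blast
  then have "(ginv g *v axis j 1) $ i = det (\<chi> r c. if c = i then axis j 1 $ r else g $ r $ c) / det g" by simp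
  then show ?thesis by (simp add: matrix_vector_mult_basis column_def)
qed

lemma C_k_on_ginv:
  fixes G :: "'a::real_normed_vector \<Rightarrow> ten2"
  assumes "open S" "C_k_on k S G" "\<And>z. z \<in> S \<Longrightarrow> det (G z) \<noteq> 0"
  shows "C_k_on k S (\<lambda>z. ginv (G z))"
proof -
  have "C_k_on k S (\<lambda>z. if c = i then axis j (1::real) $ r else G z $ r $ c)" for i j r c
    by (cases "c = i") (simp_all add: C_k_on_vec_nth assms(1,2))
  then have "C_k_on k S (\<lambda>z. \<chi> i j. det (\<chi> r c. if c = i then axis j 1 $ r else G z $ r $ c) / det (G z))"
    by (intro C_k_on_vec_lambda C_k_on_divide C_k_on_det assms)
  moreover have eq: "ginv (G z) = (\<chi> i j. det (\<chi> r c. if c = i then axis j 1 $ r else G z $ r $ c) / det (G z))" if "z \<in> S" for z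
    by (simp add: vec_eq_iff ginv_component[OF assms(3)[OF that]])
  ultimately show ?thesis by (subst C_k_on_cong[OF assms(1) eq])
qed

section \<open>Rules for coordinate derivatives, and the curvature in terms of the 2-jet\<close>

lemma pd_component:
  fixes f :: "real^7 \<Rightarrow> 'b::real_normed_vector^'n"
  assumes "f differentiable (at y)"
  shows "pd i f y $ m = pd i (\<lambda>z. f z $ m) y"
  unfolding pd_def using frechet_derivative_linear_comp[OF bounded_linear_vec_nth assms] by metis

lemma pd_eqI: "(f has_derivative D) (at y) \<Longrightarrow> pd i f y = D (axis i 1)"
  unfolding pd_def by (metis frechet_derivative_at)

lemma pd_has_derivative: "f differentiable (at y) \<Longrightarrow> (f has_derivative frechet_derivative f (at y)) (at y)"
  by (simp add: frechet_derivative_works)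

lemma pd_add: "f differentiable (at y) \<Longrightarrow> g differentiable (at y) \<Longrightarrow> pd i (\<lambda>z. f z + g z) y = pd i f y + pd i g y"
  using pd_eqI[OF has_derivative_add[OF pd_has_derivative pd_has_derivative]] by (simp add: pd_def)

lemma pd_diff: "f differentiable (at y) \<Longrightarrow> g differentiable (at y) \<Longrightarrow> pd i (\<lambda>z. f z - g z) y = pd i f y - pd i g y"
  using pd_eqI[OF has_derivative_diff[OF pd_has_derivative pd_has_derivative]] by (simp add: pd_def)

lemma pd_sum:
  assumes "\<And>a. a \<in> A \<Longrightarrow> f a differentiable (at y)"
  shows "pd i (\<lambda>z. \<Sum>a\<in>A. f a z) y = (\<Sum>a\<in>A. pd i (f a) y)"
proof -
  have "((\<lambda>z. \<Sum>a\<in>A. f a z) has_derivative (\<lambda>v. \<Sum>a\<in>A. frechet_derivative (f a) (at y) v)) (at y)"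
    by (rule has_derivative_sum) (rule pd_has_derivative[OF assms])
  from pd_eqI[OF this] show ?thesis by (simp add: pd_def)
qed

lemma pd_mult:
  fixes f g :: "real^7 \<Rightarrow> real"
  shows "f differentiable (at y) \<Longrightarrow> g differentiable (at y) \<Longrightarrow> pd i (\<lambda>z. f z * g z) y = pd i f y * g y + f y * pd i g y"
  using pd_eqI[OF has_derivative_mult[OF pd_has_derivative pd_has_derivative]] by (simp add: pd_def add.commute)

lemma pd_divide_const:
  fixes f :: "real^7 \<Rightarrow> real"
  shows "f differentiable (at y) \<Longrightarrow> pd i (\<lambda>z. f z / c) y = pd i f y / c"
  using pd_eqI[OF has_derivative_mult_left[OF pd_has_derivative, of f y "1 / c"]] by (simp add: pd_def)

lemma pd_const [simp]: "pd i (\<lambda>_. c) y = 0"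
  by (simp add: pd_def frechet_derivative_const)

lemma riemann_eq_riemann_jet:
  assumes S: "open S" "y \<in> S" and G: "C_k_on 2 S G" and d: "\<And>z. z \<in> S \<Longrightarrow> det (G z) \<noteq> 0"
  shows "riemann G y = riemann_jet (G y) (\<chi> i. pd i G y) (\<chi> i j. pd i (pd j G) y)"
proof -
  define I where "I z = ginv (G z)" for z
  have CI: "C_k_on 2 S I" unfolding I_def by (rule C_k_on_ginv[OF S(1) G d])
  have G': "C_k_on (Suc (Suc 0)) S G" using G unfolding numeral_2_eq_2 .
  have CG1: "C_k_on (Suc 0) S (pd i G)" for i unfolding pd_def by (rule C_k_on_derivative[OF G'])
  have CI': "C_k_on (Suc 0) S I" by (rule C_k_on_le[OF CI]) simp
  have CG': "C_k_on (Suc 0) S G" by (rule C_k_on_le[OF G]) simp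
  have dG: "(\<lambda>z. G z $ p $ q) differentiable (at z)" "G differentiable (at z)" "(\<lambda>z. G z $ p) differentiable (at z)" if "z \<in> S" for p q z
    using C_k_on_differentiable[OF _ that] C_k_on_vec_nth[OF S(1) C_k_on_vec_nth[OF S(1) CG']] CG' C_k_on_vec_nth[OF S(1) CG'] by blast+
  have dI: "(\<lambda>z. I z $ p $ q) differentiable (at z)" if "z \<in> S" for p q z
    using C_k_on_differentiable[OF _ that] C_k_on_vec_nth[OF S(1) C_k_on_vec_nth[OF S(1) CI']] by blast
  have dpG: "(\<lambda>z. pd i G z $ p $ q) differentiable (at z)" "pd i G differentiable (at z)" "(\<lambda>z. pd i G z $ p) differentiable (at z)" if "z \<in> S" for i p q z
    using C_k_on_differentiable[OF _ that] C_k_on_vec_nth[OF S(1) C_k_on_vec_nth[OF S(1) CG1]] CG1 C_k_on_vec_nth[OF S(1) CG1] by blast+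
  define \<Gamma> where "\<Gamma> m j k z = (\<Sum>l\<in>UNIV. I z $ m $ l * (pd j G z $ k $ l + pd k G z $ j $ l - pd l G z $ j $ k)) / 2" for m j k z
  have chr: "christoffel G z $ m $ j $ k = \<Gamma> m j k z" for z m j k
    by (simp add: christoffel_def \<Gamma>_def I_def)
  have C\<Gamma>: "C_k_on (Suc 0) S (\<Gamma> m j k)" for m j k
    unfolding \<Gamma>_def by (intro C_k_on_divide C_k_on_sum C_k_on_mult C_k_on_add C_k_on_diff C_k_on_vec_nth C_k_on_const CI' CG1 S(1)) simp_all
  have cov1: "cov_deriv G j (coord_field k) = (\<lambda>z. \<chi> m. \<Gamma> m j k z)" for j k
  proof
    fix z
    have "christoffel G z $ m $ j $ n * axis k 1 $ n = (if n = k then \<Gamma> m j k z else 0)" for m n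
      by (simp add: chr axis_def)
    then show "cov_deriv G j (coord_field k) z = (\<chi> m. \<Gamma> m j k z)"
      by (simp add: cov_deriv_def)
  qed
  \<comment> \<open>Differentiate \<open>g^-1 g = 1\<close> and multiply by \<open>g^-1\<close> from
    the right.\<close>
  have pI: "pd i (\<lambda>z. I z $ m $ l) y = dginv_jet (G y) (\<chi> i. pd i G y) i m l" for i m l
  proof -
    have IG: "(\<Sum>q\<in>UNIV. I z $ m $ q * G z $ q $ p) = mat 1 $ m $ p" if "z \<in> S" for z p
      using matrix_inv_right_left(2)[OF d[OF that]] by (simp add: I_def matrix_matrix_mult_def vec_eq_iff)
    have "0 = pd i (\<lambda>z. \<Sum>q\<in>UNIV. I z $ m $ q * G z $ q $ p) y" for p
      using pd_cong_open[OF S, of "\<lambda>z. \<Sum>q\<in>UNIV. I z $ m $ q * G z $ q $ p" "\<lambda>_. mat 1 $ m $ p" i] IG by simp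
    then have "(\<Sum>q\<in>UNIV. pd i (\<lambda>z. I z $ m $ q) y * G y $ q $ p) = - (\<Sum>q\<in>UNIV. I y $ m $ q * pd i G y $ q $ p)" for p
      by (simp add: pd_sum pd_mult dI dG S(2) sum.distrib pd_component[OF dG(2)[OF S(2)]] pd_component[OF dG(3)[OF S(2)]] eq_neg_iff_add_eq_0)
    then have "dginv_jet (G y) (\<chi> i. pd i G y) i m l = (\<Sum>p\<in>UNIV. (\<Sum>q\<in>UNIV. pd i (\<lambda>z. I z $ m $ q) y * G y $ q $ p) * I y $ p $ l)"
      by (simp add: dginv_jet_def I_def sum_negf)
    also have "\<dots> = (\<Sum>q\<in>UNIV. pd i (\<lambda>z. I z $ m $ q) y * (\<Sum>p\<in>UNIV. G y $ q $ p * I y $ p $ l))"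
      unfolding sum_distrib_left sum_distrib_right by (subst sum.swap) (simp add: mult.assoc)
    finally have eq: "dginv_jet (G y) (\<chi> i. pd i G y) i m l
        = (\<Sum>q\<in>UNIV. pd i (\<lambda>z. I z $ m $ q) y * (\<Sum>p\<in>UNIV. G y $ q $ p * I y $ p $ l))" .
    have "pd i (\<lambda>z. I z $ m $ q) y * (\<Sum>p\<in>UNIV. G y $ q $ p * I y $ p $ l)
        = (if q = l then pd i (\<lambda>z. I z $ m $ l) y else 0)" for q
      using arg_cong[OF matrix_inv_right_left(1)[OF d[OF S(2)]], of "\<lambda>M. M $ q $ l"]
      by (simp add: I_def matrix_matrix_mult_def mat_def)
    then show ?thesis unfolding eq by simp
  qed
  have p\<Gamma>: "pd i (\<Gamma> m j k) y = dchristoffel_jet (G y) (\<chi> i. pd i G y) (\<chi> i j. pd i (pd j G) y) i m j k" for i m j k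
  proof -
    define t where "t l z = I z $ m $ l * (pd j G z $ k $ l + pd k G z $ j $ l - pd l G z $ j $ k)" for l z
    have dt: "t l differentiable (at y)" for l
      unfolding t_def[abs_def]
      by (intro C_k_on_differentiable[OF _ S(2), of 0] C_k_on_mult C_k_on_add C_k_on_diff C_k_on_vec_nth CI' CG1 S(1))
    have "pd i (\<Gamma> m j k) y = (\<Sum>l\<in>UNIV. pd i (t l) y) / 2"
      unfolding \<Gamma>_def[abs_def] t_def[symmetric] by (simp add: pd_divide_const pd_sum dt)
    moreover have "pd i (t l) y = pd i (\<lambda>z. I z $ m $ l) y * (pd j G y $ k $ l + pd k G y $ j $ l - pd l G y $ j $ k)
        + I y $ m $ l * (pd i (pd j G) y $ k $ l + pd i (pd k G) y $ j $ l - pd i (pd l G) y $ j $ k)" for l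
      unfolding t_def[abs_def]
      by (simp add: pd_mult pd_add pd_diff dI dpG S(2) pd_component[OF dpG(2)[OF S(2)]] pd_component[OF dpG(3)[OF S(2)]])
    ultimately show ?thesis by (simp add: dchristoffel_jet_def christoffel1_def pI I_def[symmetric])
  qed
  have \<Gamma>y: "\<Gamma> m j k y = christoffel_jet (G y) (\<chi> i. pd i G y) m j k" for m j k
    by (simp add: \<Gamma>_def christoffel_jet_def christoffel1_def I_def)
  have cov2: "cov_deriv G i (cov_deriv G j (coord_field k)) y $ m
      = pd i (\<Gamma> m j k) y + (\<Sum>n\<in>UNIV. \<Gamma> m i n y * \<Gamma> n j k y)" for i j k m
  proof -
    have "(\<lambda>z. \<chi> m. \<Gamma> m j k z) differentiable (at y)"
      by (rule C_k_on_differentiable[OF C_k_on_vec_lambda[OF S(1) C\<Gamma>] S(2)])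
    from pd_component[OF this, of i m] show ?thesis
      unfolding cov1 by (simp add: cov_deriv_def chr)
  qed
  show ?thesis
    by (simp add: vec_eq_iff riemann_def riemann_jet_def inner_vec_def cov2 p\<Gamma> \<Gamma>y matrix_vector_mult_basis column_def)
qed

text \<open>F as a function of finitely many numbers: the metric, its first and second derivatives,
  and \<open>\<phi>\<close>. Linearizing F then means differentiating this function on a
  finite-dimensional space.\<close>

definition F_jet :: "ten2 \<times> (ten2^7) \<times> (ten2^7^7) \<times> ten3 \<Rightarrow> ten2" where
  "F_jet J = (\<chi> p q. \<Sum>i\<in>UNIV. \<Sum>j\<in>UNIV. \<Sum>k\<in>UNIV. \<Sum>l\<in>UNIV.
     riemann_jet (fst J) (fst (snd J)) (fst (snd (snd J))) $ i $ j $ k $ l *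
     raise12 (fst J) (snd (snd (snd J))) $ i $ j $ p * raise12 (fst J) (snd (snd (snd J))) $ k $ l $ q)"

lemma open_F_jet_domain: "open {J :: ten2 \<times> (ten2^7) \<times> (ten2^7^7) \<times> ten3. det (fst J) \<noteq> 0}"
proof -
  have "continuous_on UNIV (\<lambda>J :: ten2 \<times> (ten2^7) \<times> (ten2^7^7) \<times> ten3. det (fst J))"
    unfolding det_def by (intro continuous_intros)
  from continuous_open_preimage[OF this open_UNIV, of "- {0}"] show ?thesis
    by (simp add: open_Compl vimage_def)
qed

lemma differentiable_F_jet:
  assumes "det (fst J) \<noteq> 0"
  shows "F_jet differentiable (at J)"
proof -
  let ?S = "{J :: ten2 \<times> (ten2^7) \<times> (ten2^7^7) \<times> ten3. det (fst J) \<noteq> 0}"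
  note S = open_F_jet_domain
  have I: "C_k_on (Suc 0) ?S (\<lambda>J. ginv (fst J))"
    by (rule C_k_on_ginv[OF S C_k_on_fst[OF S C_k_on_ident]]) simp
  note intros = C_k_on_sum[OF S] C_k_on_mult[OF S] C_k_on_add[OF S] C_k_on_diff[OF S] C_k_on_minus[OF S] C_k_on_vec_nth[OF S]
    C_k_on_fst[OF S] C_k_on_snd[OF S] C_k_on_ident I
  have c1: "C_k_on (Suc 0) ?S (\<lambda>J. christoffel1 (fst (snd J)) l j k)" for l j k
    unfolding christoffel1_def by (intro intros)
  have c2: "C_k_on (Suc 0) ?S (\<lambda>J. christoffel1 (fst (snd (snd J)) $ i) l j k)" for i l j k
    unfolding christoffel1_def by (intro intros)
  have c3: "C_k_on (Suc 0) ?S (\<lambda>J. christoffel_jet (fst J) (fst (snd J)) l j k)" for l j k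
    unfolding christoffel_jet_def by (intro C_k_on_divide[OF S] C_k_on_const intros c1) simp
  have c4: "C_k_on (Suc 0) ?S (\<lambda>J. dginv_jet (fst J) (fst (snd J)) i m l)" for i m l
    unfolding dginv_jet_def by (intro intros)
  have c5: "C_k_on (Suc 0) ?S (\<lambda>J. dchristoffel_jet (fst J) (fst (snd J)) (fst (snd (snd J))) i l j k)" for i l j k
    unfolding dchristoffel_jet_def by (intro C_k_on_divide[OF S] C_k_on_const intros c1 c2 c4) simp
  have c6: "C_k_on (Suc 0) ?S (\<lambda>J. riemann_jet (fst J) (fst (snd J)) (fst (snd (snd J))) $ i $ j $ k $ l)" for i j k l
    unfolding riemann_jet_def vec_lambda_beta by (intro intros c3 c5)
  have c7: "C_k_on (Suc 0) ?S (\<lambda>J. raise12 (fst J) (snd (snd (snd J))) $ i $ j $ k)" for i j k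
    unfolding raise12_def vec_lambda_beta by (intro intros)
  have "C_k_on (Suc 0) ?S F_jet"
    unfolding F_jet_def[abs_def] by (intro C_k_on_vec_lambda[OF S] intros c6 c7)
  then show ?thesis by (rule C_k_on_differentiable) (use assms in simp)
qed

lemma F_tensor_eq_F_jet:
  assumes S: "open S" "y \<in> S" and G: "C_k_on 2 S (\<lambda>z. G2_metric (\<Phi> z))" and d: "\<And>z. z \<in> S \<Longrightarrow> det (G2_metric (\<Phi> z)) \<noteq> 0"
  shows "F_tensor \<Phi> y = F_jet (G2_metric (\<Phi> y), \<chi> i. pd i (\<lambda>z. G2_metric (\<Phi> z)) y,
     \<chi> i j. pd i (pd j (\<lambda>z. G2_metric (\<Phi> z))) y, \<Phi> y)"
  by (simp add: F_tensor_def F_jet_def Let_def riemann_eq_riemann_jet[OF S G d])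

definition riemann_symbol :: "ten2^7^7 \<Rightarrow> ten4" where
  "riemann_symbol DD = (\<chi> i j k l. (christoffel1 (DD$i) l j k - christoffel1 (DD$j) l i k) / 2)"

text \<open>Second derivatives enter the curvature affinely, so the expansion in \<open>s\<close> is
  exact. The inverse metric in the Christoffel symbols is cancelled by lowering the last index with
  \<open>g\<close>, which leaves \<open>riemann_symbol\<close> free of \<open>g\<close>.\<close>

lemma riemann_jet_affine:
  assumes "det g \<noteq> 0" "transpose g = g"
  shows "riemann_jet g D (DD + s *\<^sub>R DD') = riemann_jet g D DD + s *\<^sub>R riemann_symbol DD'"
proof -
  have c: "christoffel1 ((DD + s *\<^sub>R DD') $ i) l j k = christoffel1 (DD $ i) l j k + s * christoffel1 (DD' $ i) l j k" for i l j k
    by (simp add: christoffel1_def algebra_simps)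
  define t where "t i m j k = (\<Sum>l\<in>UNIV. ginv g $ m $ l * christoffel1 (DD' $ i) l j k) / 2" for i m j k
  have dc: "dchristoffel_jet g D (DD + s *\<^sub>R DD') i m j k = dchristoffel_jet g D DD i m j k
      + s * t i m j k" for i m j k
    unfolding dchristoffel_jet_def t_def c by (simp add: sum.distrib sum_distrib_left algebra_simps add_divide_distrib)
  have gI: "(\<Sum>m\<in>UNIV. (\<Sum>p\<in>UNIV. ginv g $ m $ p * X p) * g $ m $ l) = X l" for X l
  proof -
    have "(\<Sum>m\<in>UNIV. (\<Sum>p\<in>UNIV. ginv g $ m $ p * X p) * g $ m $ l)
        = (\<Sum>p\<in>UNIV. X p * (\<Sum>m\<in>UNIV. g $ l $ m * ginv g $ m $ p))"
      unfolding sum_distrib_left sum_distrib_right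
      using arg_cong[OF assms(2), of "\<lambda>M. M $ l $ m" for m]
      by (subst sum.swap) (simp add: transpose_def mult_ac)
    also have "\<dots> = (\<Sum>p\<in>UNIV. if p = l then X p else 0)"
      using arg_cong[OF matrix_inv_right_left(1)[OF assms(1)], of "\<lambda>M. M $ l $ p" for p]
      by (intro sum.cong refl) (simp add: matrix_matrix_mult_def mat_def)
    finally show ?thesis by simp
  qed
  have eq: "riemann_symbol DD' $ i $ j $ k $ l = (\<Sum>m\<in>UNIV. (t i m j k - t j m i k) * g $ m $ l)" for i j k l
    using gI[of "\<lambda>p. christoffel1 (DD' $ i) p j k" l] gI[of "\<lambda>p. christoffel1 (DD' $ j) p i k" l]
    by (simp add: riemann_symbol_def t_def left_diff_distrib sum_subtractf diff_divide_distrib sum_divide_distrib[symmetric])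
  have "s *\<^sub>R riemann_symbol DD' $ i $ j $ k $ l = (\<Sum>m\<in>UNIV. s * ((t i m j k - t j m i k) * g $ m $ l))" for i j k l
    unfolding eq by (simp add: sum_distrib_left)
  then show ?thesis
    unfolding vec_eq_iff vector_add_component vector_scaleR_component
    by (simp only: riemann_jet_def vec_lambda_beta dc sum.distrib[symmetric])
       (intro allI sum.cong refl, simp add: algebra_simps)
qed

section \<open>The linearization and its symbol\<close>

text \<open>On the unit sphere the quadratic form has a minimum \<open>m > 0\<close>, and a
  perturbation of norm below \<open>m / CARD('n)\<close> changes it there by less than
  \<open>m\<close>.\<close>

lemma open_pos_def: "open {A :: real^'n^'n. \<forall>X. X \<noteq> 0 \<longrightarrow> X \<bullet> (A *v X) > 0}"
  unfolding open_dist
proof (intro ballI)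
  fix A :: "real^'n^'n" assume "A \<in> {A. \<forall>X. X \<noteq> 0 \<longrightarrow> X \<bullet> (A *v X) > 0}"
  then have A: "X \<bullet> (A *v X) > 0" if "X \<noteq> 0" for X using that by blast
  have cont: "continuous_on (sphere 0 1) (\<lambda>X. X \<bullet> (A *v X))"
    by (intro continuous_intros linear_continuous_on matrix_vector_mul_bounded_linear)
  have "sphere (0 :: real^'n) 1 \<noteq> {}" by simp
  then obtain x where x: "x \<in> sphere 0 1" "\<And>y. y \<in> sphere 0 1 \<Longrightarrow> x \<bullet> (A *v x) \<le> y \<bullet> (A *v y)"
    using continuous_attains_inf[OF compact_sphere _ cont] by blast
  define m where "m = x \<bullet> (A *v x)"
  have "x \<noteq> 0" using x(1) by force
  then have m: "m > 0" unfolding m_def by (rule A)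
  have bound: "norm (M *v Y) \<le> CARD('n) * norm M" if "norm Y = 1" for M :: "real^'n^'n" and Y
  proof -
    have "\<bar>(M *v Y) $ i\<bar> \<le> norm M" for i
    proof -
      have "(M *v Y) $ i = M $ i \<bullet> Y" by (simp add: matrix_vector_mult_def inner_vec_def)
      also have "\<bar>\<dots>\<bar> \<le> norm (M $ i) * norm Y" by (rule Cauchy_Schwarz_ineq2)
      also have "\<dots> \<le> norm M" using Finite_Cartesian_Product.norm_nth_le[of M i] that by simp
      finally show ?thesis .
    qed
    then have "(\<Sum>i\<in>UNIV. \<bar>(M *v Y) $ i\<bar>) \<le> (\<Sum>i\<in>(UNIV :: 'n set). norm M)" by (intro sum_mono)
    then show ?thesis using norm_le_l1_cart[of "M *v Y"] by simp
  qed
  define e where "e = m / CARD('n)"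
  have "e > 0" using m by (simp add: e_def)
  moreover have "X \<bullet> (A' *v X) > 0" if "dist A' A < e" "X \<noteq> 0" for A' X
  proof -
    define Y where "Y = X /\<^sub>R norm X"
    have Y: "norm Y = 1" using that(2) by (simp add: Y_def)
    have "\<bar>Y \<bullet> ((A' - A) *v Y)\<bar> \<le> norm Y * norm ((A' - A) *v Y)" by (rule Cauchy_Schwarz_ineq2)
    also have "\<dots> \<le> CARD('n) * norm (A' - A)" using bound[OF Y] Y by simp
    also have "\<dots> < CARD('n) * e" using that(1) by (simp add: dist_norm)
    finally have "\<bar>Y \<bullet> ((A' - A) *v Y)\<bar> < m" by (simp add: e_def)
    moreover have "m \<le> Y \<bullet> (A *v Y)" unfolding m_def by (rule x(2)) (simp add: Y)
    ultimately have "Y \<bullet> (A' *v Y) > 0" by (simp add: matrix_vector_mult_diff_rdistrib inner_diff_right)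
    moreover have "Y \<bullet> (A' *v Y) = (inverse (norm X))\<^sup>2 * (X \<bullet> (A' *v X))"
      unfolding Y_def by (simp add: linear_scale[OF matrix_vector_mul_linear] power2_eq_square)
    ultimately show ?thesis by (simp add: zero_less_mult_iff)
  qed
  ultimately show "\<exists>e>0. \<forall>B. dist B A < e \<longrightarrow> B \<in> {A. \<forall>X. X \<noteq> 0 \<longrightarrow> X \<bullet> (A *v X) > 0}" by blast
qed

lemma has_vector_derivative_vec_lambda:
  fixes f :: "'n::finite \<Rightarrow> real \<Rightarrow> 'b::real_normed_vector"
  assumes "\<And>i. (f i has_vector_derivative f' i) (at s)"
  shows "((\<lambda>s. \<chi> i. f i s) has_vector_derivative (\<chi> i. f' i)) (at s)"
proof -
  have eq: "(\<chi> i. g i) = (\<Sum>i\<in>UNIV. axis i (g i))" for g :: "'n \<Rightarrow> 'b"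
    by (simp add: vec_eq_iff axis_def sum_component)
  show ?thesis unfolding eq
    by (intro has_vector_derivative_sum bounded_linear.has_vector_derivative[OF bounded_linear_axis] assms)
qed

lemma C_k_on_diamond:
  assumes "open S" "C_k_on k S G" "\<And>z. z \<in> S \<Longrightarrow> det (G z) \<noteq> 0" "C_k_on k S h" "C_k_on k S \<Phi>"
  shows "C_k_on k S (\<lambda>z. diamond (G z) (h z) (\<Phi> z))"
  unfolding diamond_def
  by (intro C_k_on_vec_lambda C_k_on_sum C_k_on_mult C_k_on_add C_k_on_vec_nth C_k_on_ginv assms)

lemma C_k_on_hodge_star3:
  assumes "open S" "C_k_on k S G" "\<And>z. z \<in> S \<Longrightarrow> det (G z) \<noteq> 0" "C_k_on k S v" "C_k_on k S \<Phi>"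
  shows "C_k_on k S (\<lambda>z. hodge_star3 (G z) (v z) (\<Phi> z))"
  unfolding hodge_star3_def divide_inverse
  by (intro C_k_on_vec_lambda C_k_on_sum C_k_on_mult C_k_on_add C_k_on_vec_nth C_k_on_ginv C_k_on_const assms)

lemma C_k_on_contract4:
  assumes "open S" "C_k_on k S G" "\<And>z. z \<in> S \<Longrightarrow> det (G z) \<noteq> 0" "C_k_on k S X" "C_k_on k S \<psi>"
  shows "C_k_on k S (\<lambda>z. contract4 (G z) (X z) (\<psi> z))"
  unfolding contract4_def
  by (intro C_k_on_vec_lambda C_k_on_sum C_k_on_mult C_k_on_add C_k_on_vec_nth C_k_on_ginv assms)

lemma pair_to_3_form_linear: "linear (pair_to_3_form a)"
  by (rule linearI; simp add: pair_to_3_form_def diamond_def contract4_def vec_eq_iff sum.distrib sum_distrib_left algebra_simps)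

lemma pd_linear_comp:
  assumes "bounded_linear L" "f differentiable (at y)"
  shows "pd i (\<lambda>z. L (f z)) y = L (pd i f y)"
  unfolding pd_def by (rule frechet_derivative_linear_comp[OF assms])

lemma pd_pd_linear_comp:
  assumes "bounded_linear L" "open S" "C_k_on 2 S f" "y \<in> S"
  shows "pd i (pd j (\<lambda>z. L (f z))) y = L (pd i (pd j f) y)"
proof -
  have f: "C_k_on (Suc (Suc 0)) S f" using assms(3) unfolding numeral_2_eq_2 .
  have "pd i (pd j (\<lambda>z. L (f z))) y = pd i (\<lambda>z. L (pd j f z)) y"
    by (rule pd_cong_open[OF assms(2,4)]) (rule pd_linear_comp[OF assms(1) C_k_on_differentiable[OF f]])
  also have "\<dots> = L (pd i (pd j f) y)"
    unfolding pd_def[of j f]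
    by (rule pd_linear_comp[OF assms(1) C_k_on_differentiable[OF C_k_on_derivative[OF f] assms(4)]])
  finally show ?thesis .
qed

text \<open>The coordinate picture of a G2-structure in a single chart. Metric and symbol at a point
  involve only the components near it, so the manifold enters the theorem through one chart
  image.\<close>

locale G2_form_on =
  fixes \<Omega> :: "(real^7) set" and \<Phi> :: "real^7 \<Rightarrow> ten3"
  assumes open_\<Omega>: "open \<Omega>" and smooth_\<Phi>: "smooth_on \<Omega> \<Phi>"
    and alternating_\<Phi>: "\<And>z. z \<in> \<Omega> \<Longrightarrow> alternating3 (\<Phi> z)"
    and nondegenerate_\<Phi>: "\<And>z. z \<in> \<Omega> \<Longrightarrow> nondegenerate3 (\<Phi> z)"
begin

lemma metric_vol:
  assumes "z \<in> \<Omega>"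
  shows "G2_metric_vol (\<Phi> z) (G2_metric (\<Phi> z)) (G2_vol (\<Phi> z))"
proof -
  obtain g v where "G2_metric_vol (\<Phi> z) g v"
    using nondegenerate_\<Phi>[OF assms] unfolding nondegenerate3_def by blast
  then show ?thesis using G2_metric_eq G2_vol_eq by metis
qed

lemmas metric_formula = G2_metric_vol_imp_formula[OF metric_vol]

lemma C_k_\<Phi>: "C_k_on k \<Omega> \<Phi>"
  using smooth_\<Phi> by (simp add: smooth_on_def)

lemma C_k_metric: "C_k_on k \<Omega> (\<lambda>z. G2_metric (\<Phi> z))"
proof (subst C_k_on_cong[OF open_\<Omega>])
  show "C_k_on k \<Omega> (\<lambda>z. G2_metric_formula (\<Phi> z))"
    by (rule C_k_on_G2_metric_formula[OF open_\<Omega> C_k_\<Phi> metric_formula(3)])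
qed (rule metric_formula(2))

lemma C_k_vol: "C_k_on k \<Omega> (\<lambda>z. G2_vol (\<Phi> z))"
proof (subst C_k_on_cong[OF open_\<Omega>])
  show "C_k_on k \<Omega> (\<lambda>z. G2_vol_formula (\<Phi> z))"
    by (rule C_k_on_G2_vol_formula[OF open_\<Omega> C_k_\<Phi> metric_formula(3)])
qed (rule metric_formula(1))

lemma C_k_pair_to_3_form:
  assumes "smooth_on \<Omega> u"
  shows "C_k_on k \<Omega> (\<lambda>z. pair_to_3_form (\<Phi> z) (u z))"
proof -
  have u: "C_k_on k \<Omega> u" using assms by (simp add: smooth_on_def)
  have d: "det (G2_metric (\<Phi> z)) \<noteq> 0" if "z \<in> \<Omega>" for z by (rule G2_metric_vol_det[OF metric_vol[OF that]])
  show ?thesis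
    unfolding pair_to_3_form_def G2_psi_def
    by (intro C_k_on_add C_k_on_diamond C_k_on_contract4 C_k_on_hodge_star3 C_k_on_fst C_k_on_snd C_k_metric C_k_vol C_k_\<Phi> u open_\<Omega> d)
qed

definition jet :: "real^7 \<Rightarrow> ten2 \<times> (ten2^7) \<times> (ten2^7^7) \<times> ten3" where
  "jet y = (G2_metric (\<Phi> y), \<chi> i. pd i (\<lambda>z. G2_metric (\<Phi> z)) y,
     \<chi> i j. pd i (pd j (\<lambda>z. G2_metric (\<Phi> z))) y, \<Phi> y)"

end

lemma differentiable_G2_metric_formula:
  assumes "det (G2_bilinear a) \<noteq> 0"
  shows "G2_metric_formula differentiable (at a)"
proof -
  have "continuous_on UNIV (\<lambda>a. det (G2_bilinear a))"
    by (rule C_k_on_continuous[of 0]) (intro C_k_on_det C_k_on_G2_bilinear C_k_on_ident open_UNIV)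
  from continuous_open_preimage[OF this open_UNIV, of "- {0}"]
  have S: "open {a. det (G2_bilinear a) \<noteq> 0}" by (simp add: open_Compl vimage_def)
  have "C_k_on (Suc 0) {a. det (G2_bilinear a) \<noteq> 0} (\<lambda>a. G2_metric_formula a)"
    by (rule C_k_on_G2_metric_formula[OF S C_k_on_ident]) simp
  then show ?thesis by (rule C_k_on_differentiable) (use assms in simp)
qed

context G2_form_on
begin

text \<open>The linearization only sees the 2-jet of \<open>h\<close> and the value of the variation of \<open>\<phi>\<close>, since the
  metric varies by \<open>2 h\<close>.\<close>
lemma DF_eq:
  assumes y: "y \<in> \<Omega>" and u: "smooth_on \<Omega> u" "\<And>z. z \<in> \<Omega> \<Longrightarrow> u z \<in> sym2_covec"
  shows "DF \<Phi> u y = frechet_derivative F_jet (at (jet y))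
    (2 *\<^sub>R fst (u y), \<chi> i. 2 *\<^sub>R fst (pd i u y), \<chi> i j. 2 *\<^sub>R fst (pd i (pd j u) y), pair_to_3_form (\<Phi> y) (u y))"
proof -
  define w where "w z = pair_to_3_form (\<Phi> z) (u z)" for z
  \<comment> \<open>The whole variation as one map on the product, so that smoothness holds jointly
    in \<open>s\<close> and \<open>z\<close>.\<close>
  define \<Psi> where "\<Psi> p = \<Phi> (snd p) + fst p *\<^sub>R w (snd p)" for p :: "real \<times> (real^7)"
  define K where "K p = G2_metric_formula (\<Psi> p)" for p
  let ?U = "UNIV \<times> \<Omega> :: (real \<times> (real^7)) set"
  have U: "open ?U" by (simp add: open_Times open_\<Omega>)
  have Cw: "C_k_on k \<Omega> w" for k unfolding w_def by (rule C_k_pair_to_3_form[OF u(1)])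
  have snd: "C_k_on k ?U (\<lambda>p. f (snd p))" if "C_k_on k \<Omega> f" for k and f :: "real^7 \<Rightarrow> ten3"
    using C_k_on_affine_comp[OF U bounded_linear_snd _ that, of 0] by auto
  have C\<Psi>: "C_k_on k ?U \<Psi>" for k
    unfolding \<Psi>_def by (intro C_k_on_add C_k_on_scaleR C_k_on_fst C_k_on_ident snd C_k_\<Phi> Cw U)
  \<comment> \<open>The formula is smooth on \<open>W1\<close>; on the smaller open set
    \<open>W\<close> it is also positive definite and therefore is the metric of the varied
    form.\<close>
  define W1 where "W1 = {p \<in> ?U. det (G2_bilinear (\<Psi> p)) \<noteq> 0}"
  have "continuous_on ?U (\<lambda>p. det (G2_bilinear (\<Psi> p)))"
    by (rule C_k_on_continuous[of 0]) (intro C_k_on_det C_k_on_G2_bilinear C\<Psi> U)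
  from continuous_open_preimage[OF this U, of "- {0}"] have W1: "open W1"
    by (simp add: open_Compl W1_def vimage_def Int_def)
  have CK1: "C_k_on k W1 K" for k
    unfolding K_def by (rule C_k_on_G2_metric_formula[OF W1 C_k_on_subset[OF C\<Psi>]]) (auto simp: W1_def)
  define W where "W = {p \<in> W1. \<forall>X. X \<noteq> 0 \<longrightarrow> X \<bullet> (K p *v X) > 0}"
  from continuous_open_preimage[OF C_k_on_continuous[OF CK1[of 0]] W1 open_pos_def] have W: "open W"
    by (simp add: W_def vimage_def Int_def)
  have CK: "C_k_on k W K" for k by (rule C_k_on_subset[OF CK1]) (auto simp: W_def)
  have K_metric: "G2_metric_vol (\<Psi> p) (K p) (G2_vol_formula (\<Psi> p))" if "p \<in> W" for p
    unfolding K_def by (rule G2_metric_vol_formula) (use that in \<open>auto simp: W_def W1_def K_def\<close>)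
  have K0: "K (0, z) = G2_metric (\<Phi> z)" if "z \<in> \<Omega>" for z
    using metric_formula(2)[OF that] by (simp add: K_def \<Psi>_def)
  have W0: "(0, z) \<in> W" if "z \<in> \<Omega>" for z
    using metric_formula(3)[OF that] metric_vol[OF that] that K0[OF that]
    unfolding W_def W1_def by (simp add: \<Psi>_def G2_metric_vol_def)
  have k: "frechet_derivative K (at (0, z)) (1, 0) = 2 *\<^sub>R fst (u z)" if "(0, z) \<in> W" for z
  proof -
    have z: "z \<in> \<Omega>" using that by (simp add: W_def W1_def)
    define D where "D = frechet_derivative G2_metric_formula (at (\<Phi> z))"
    have D: "(G2_metric_formula has_derivative D) (at (\<Phi> z))"
      unfolding D_def by (rule differentiable_G2_metric_formula[OF metric_formula(3)[OF z], unfolded frechet_derivative_works])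
    have "((\<lambda>s. \<Phi> z + s *\<^sub>R w z) has_derivative (\<lambda>s. s *\<^sub>R w z)) (at (0 :: real))"
      by (auto intro!: derivative_eq_intros)
    then have "((\<lambda>s. G2_metric_formula (\<Phi> z + s *\<^sub>R w z)) has_derivative (\<lambda>s. D (s *\<^sub>R w z))) (at (0 :: real))"
      by (rule has_derivative_compose) (simp add: D)
    then have "((\<lambda>s. K (s, z)) has_vector_derivative D (w z)) (at 0)"
      unfolding has_vector_derivative_def K_def \<Psi>_def
      using linear_scale[OF has_derivative_linear[OF D]] by simp
    moreover have "((\<lambda>s. K (s, z)) has_vector_derivative frechet_derivative K (at (0, z)) (1, 0)) (at 0)"
      by (rule has_vector_derivative_slice[OF C_k_on_differentiable[OF CK that]])
    ultimately have "frechet_derivative K (at (0, z)) (1, 0) = D (w z)"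
      by (rule vector_derivative_unique_at[symmetric])
    moreover have "transpose (fst (u z)) = fst (u z)" using u(2)[OF z] by (auto simp: sym2_covec_def)
    ultimately show ?thesis
      using G2_metric_formula_derivative_pair[OF alternating_\<Phi>[OF z] metric_vol[OF z] D, of "fst (u z)" "snd (u z)"]
      by (simp add: w_def)
  qed
  note jets = has_vector_derivative_jet[OF W W0[OF y] CK k]
  define J where "J s = (K (s, y), \<chi> i. pd i (\<lambda>z. K (s, z)) y, \<chi> i j. pd i (pd j (\<lambda>z. K (s, z))) y, \<Phi> y + s *\<^sub>R w y)" for s
  let ?h = "\<lambda>z. 2 *\<^sub>R fst (u z)"
  have dJ: "(J has_vector_derivative (?h y, \<chi> i. pd i ?h y, \<chi> i j. pd i (pd j ?h) y, w y)) (at 0)"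
    unfolding J_def
    by (intro has_vector_derivative_Pair has_vector_derivative_vec_lambda jets) (auto intro!: derivative_eq_intros)
  have J0: "J 0 = jet y"
  proof -
    have 1: "pd i (\<lambda>z. K (0, z)) z = pd i (\<lambda>z. G2_metric (\<Phi> z)) z" if "z \<in> \<Omega>" for i z
      by (rule pd_cong_open[OF open_\<Omega> that K0])
    have "pd i (pd j (\<lambda>z. K (0, z))) y = pd i (pd j (\<lambda>z. G2_metric (\<Phi> z))) y" for i j
      by (rule pd_cong_open[OF open_\<Omega> y 1])
    then show ?thesis by (simp add: J_def jet_def K0[OF y] 1[OF y])
  qed
  have "det (fst (jet y)) \<noteq> 0" using G2_metric_vol_det[OF metric_vol[OF y]] by (simp add: jet_def)
  note dF = differentiable_F_jet[OF this, unfolded frechet_derivative_works]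
  define L where "L = frechet_derivative F_jet (at (jet y))"
  have "((\<lambda>s. F_jet (J s)) has_derivative (\<lambda>s. L (s *\<^sub>R (?h y, \<chi> i. pd i ?h y, \<chi> i j. pd i (pd j ?h) y, w y)))) (at 0)"
    by (rule has_derivative_compose[OF dJ[unfolded has_vector_derivative_def]]) (simp add: L_def J0 dF)
  then have "((\<lambda>s. F_jet (J s)) has_vector_derivative L (?h y, \<chi> i. pd i ?h y, \<chi> i j. pd i (pd j ?h) y, w y)) (at 0)"
    unfolding has_vector_derivative_def L_def linear_scale[OF has_derivative_linear[OF dF]] .
  then have "((\<lambda>s. F_tensor (\<lambda>z. \<Phi> z + s *\<^sub>R w z) y) has_vector_derivative
      L (?h y, \<chi> i. pd i ?h y, \<chi> i j. pd i (pd j ?h) y, w y)) (at 0)"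
  proof (rule has_vector_derivative_transform_within_open[OF _ open_slice'[OF W, of y]])
    show "0 \<in> {s. (s, y) \<in> W}" using W0[OF y] by simp
    \<comment> \<open>For such \<open>s\<close> the varied form is nondegenerate on a whole
      neighbourhood \<open>S\<close> of \<open>y\<close>, as required for the derivatives of its
      metric in \<open>F_tensor\<close>.\<close>
    fix s assume s: "s \<in> {s. (s, y) \<in> W}"
    define S where "S = {z. (s, z) \<in> W}"
    have S: "open S" "y \<in> S" using open_slice[OF W] s by (auto simp: S_def)
    have eq: "G2_metric (\<Phi> z + s *\<^sub>R w z) = K (s, z)" if "z \<in> S" for z
      using G2_metric_eq[OF K_metric[of "(s, z)"]] that by (simp add: S_def \<Psi>_def)
    have "C_k_on 2 S (\<lambda>z. K ((s, 0) + (0, z)))"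
      by (rule C_k_on_affine_comp[OF S(1) _ _ CK])
         (auto simp: S_def intro!: bounded_linear_Pair bounded_linear_zero bounded_linear_ident)
    then have C2: "C_k_on 2 S (\<lambda>z. G2_metric (\<Phi> z + s *\<^sub>R w z))"
      by (subst C_k_on_cong[OF S(1) eq]) simp_all
    have d: "det (G2_metric (\<Phi> z + s *\<^sub>R w z)) \<noteq> 0" if "z \<in> S" for z
      using G2_metric_vol_det[OF K_metric[of "(s, z)"]] that by (simp add: eq S_def)
    have 1: "pd i (\<lambda>z. G2_metric (\<Phi> z + s *\<^sub>R w z)) z = pd i (\<lambda>z. K (s, z)) z" if "z \<in> S" for i z
      by (rule pd_cong_open[OF S(1) that eq])
    have "pd i (pd j (\<lambda>z. G2_metric (\<Phi> z + s *\<^sub>R w z))) y = pd i (pd j (\<lambda>z. K (s, z))) y" for i j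
      by (rule pd_cong_open[OF S 1])
    then show "F_jet (J s) = F_tensor (\<lambda>z. \<Phi> z + s *\<^sub>R w z) y"
      by (simp add: F_tensor_eq_F_jet[OF S C2 d] J_def eq[OF S(2)] 1[OF S(2)])
  qed
  then have "DF \<Phi> u y = L (?h y, \<chi> i. pd i ?h y, \<chi> i j. pd i (pd j ?h) y, w y)"
    unfolding DF_def w_def by (rule vector_derivative_at)
  moreover have "bounded_linear (\<lambda>v :: ten2 \<times> covec. 2 *\<^sub>R fst v)"
    by (intro bounded_linear_scaleR_right[THEN bounded_linear_compose] bounded_linear_fst)
  note bl = this
  have Cu: "C_k_on k \<Omega> u" for k using u(1) by (simp add: smooth_on_def)
  have "pd i ?h y = 2 *\<^sub>R fst (pd i u y)" for i
    by (rule pd_linear_comp[OF bl C_k_on_differentiable[OF Cu y]])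
  moreover have "pd i (pd j ?h) y = 2 *\<^sub>R fst (pd i (pd j u) y)" for i j
    by (rule pd_pd_linear_comp[OF bl open_\<Omega> Cu y])
  ultimately show ?thesis by (simp add: L_def w_def)
qed

definition F_symbol :: "real^7 \<Rightarrow> ten2^7^7 \<Rightarrow> ten2" where
  "F_symbol y DD = (\<chi> p q. \<Sum>i\<in>UNIV. \<Sum>j\<in>UNIV. \<Sum>k\<in>UNIV. \<Sum>l\<in>UNIV. riemann_symbol DD $ i $ j $ k $ l *
     raise12 (G2_metric (\<Phi> y)) (\<Phi> y) $ i $ j $ p * raise12 (G2_metric (\<Phi> y)) (\<Phi> y) $ k $ l $ q)"

text \<open>Along \<open>(0, 0, DD, 0)\<close> the function \<open>F_jet\<close> is affine, so its
  derivative is the slope.\<close>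

lemma F_jet_derivative_second_order:
  assumes y: "y \<in> \<Omega>"
  shows "frechet_derivative F_jet (at (jet y)) (0, 0, DD, 0) = F_symbol y DD"
proof -
  have d: "det (G2_metric (\<Phi> y)) \<noteq> 0" and sym: "transpose (G2_metric (\<Phi> y)) = G2_metric (\<Phi> y)"
    using G2_metric_vol_det[OF metric_vol[OF y]] metric_vol[OF y] by (simp_all add: G2_metric_vol_def)
  have "det (fst (jet y)) \<noteq> 0" using d by (simp add: jet_def)
  note dF = differentiable_F_jet[OF this, unfolded frechet_derivative_works]
  define L where "L = frechet_derivative F_jet (at (jet y))"
  let ?v = "(0, 0, DD, 0) :: ten2 \<times> (ten2^7) \<times> (ten2^7^7) \<times> ten3"
  have "((\<lambda>s. jet y + s *\<^sub>R ?v) has_derivative (\<lambda>s. s *\<^sub>R ?v)) (at (0 :: real))"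
    by (auto intro!: derivative_eq_intros simp del: scaleR_Pair)
  then have "((\<lambda>s. F_jet (jet y + s *\<^sub>R ?v)) has_derivative (\<lambda>s. L (s *\<^sub>R ?v))) (at (0 :: real))"
    by (rule has_derivative_compose) (simp add: L_def dF zero_prod_def[symmetric])
  then have 1: "((\<lambda>s. F_jet (jet y + s *\<^sub>R ?v)) has_vector_derivative L ?v) (at 0)"
    unfolding has_vector_derivative_def L_def linear_scale[OF has_derivative_linear[OF dF]] .
  have "F_jet (jet y + s *\<^sub>R ?v) = F_jet (jet y) + s *\<^sub>R F_symbol y DD" for s
    by (simp add: F_jet_def jet_def riemann_jet_affine[OF d sym] F_symbol_def vec_eq_iff)
       (simp add: sum.distrib sum_distrib_left algebra_simps)
  then have "((\<lambda>s. F_jet (jet y + s *\<^sub>R ?v)) has_vector_derivative F_symbol y DD) (at 0)"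
    by (auto intro!: derivative_eq_intros)
  with 1 show ?thesis unfolding L_def by (rule vector_derivative_unique_at)
qed

end

lemma smooth_on_quadratic: "smooth_on S (\<lambda>z. ((\<xi> \<bullet> (z - y))\<^sup>2 / 2) *\<^sub>R e)"
proof -
  have "C_k_on k UNIV (\<lambda>z. ((\<xi> \<bullet> (z - y))\<^sup>2 / 2) *\<^sub>R e)" for k
    unfolding inner_diff_right
    by (intro C_k_on_scaleR C_k_on_divide C_k_on_power C_k_on_diff C_k_on_const open_UNIV
        C_k_on_bounded_linear bounded_linear_inner_right) simp
  then show ?thesis unfolding smooth_on_def by (blast intro: C_k_on_subset)
qed

lemma pd_quadratic:
  fixes \<xi> y :: "real^7"
  shows "pd j (\<lambda>z. ((\<xi> \<bullet> (z - y))\<^sup>2 / 2) *\<^sub>R e) z = (\<xi> \<bullet> (z - y) * \<xi>$j) *\<^sub>R e"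
    "pd i (pd j (\<lambda>z. ((\<xi> \<bullet> (z - y))\<^sup>2 / 2) *\<^sub>R e)) z = (\<xi>$i * \<xi>$j) *\<^sub>R e"
proof -
  have 1: "pd j (\<lambda>z. ((\<xi> \<bullet> (z - y))\<^sup>2 / 2) *\<^sub>R e) = (\<lambda>z. (\<xi> \<bullet> (z - y) * \<xi>$j) *\<^sub>R e)" for j
  proof
    fix z
    have "((\<lambda>z. ((\<xi> \<bullet> (z - y))\<^sup>2 / 2) *\<^sub>R e) has_derivative (\<lambda>v. (\<xi> \<bullet> (z - y) * (\<xi> \<bullet> v)) *\<^sub>R e)) (at z)"
      by (auto intro!: derivative_eq_intros simp: power2_eq_square)
    from pd_eqI[OF this, of j] show "pd j (\<lambda>z. ((\<xi> \<bullet> (z - y))\<^sup>2 / 2) *\<^sub>R e) z = (\<xi> \<bullet> (z - y) * \<xi>$j) *\<^sub>R e"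
      by (simp add: inner_axis)
  qed
  then show "pd j (\<lambda>z. ((\<xi> \<bullet> (z - y))\<^sup>2 / 2) *\<^sub>R e) z = (\<xi> \<bullet> (z - y) * \<xi>$j) *\<^sub>R e" by simp
  have "((\<lambda>z. (\<xi> \<bullet> (z - y) * \<xi>$j) *\<^sub>R e) has_derivative (\<lambda>v. ((\<xi> \<bullet> v) * \<xi>$j) *\<^sub>R e)) (at z)"
    by (auto intro!: derivative_eq_intros)
  from pd_eqI[OF this, of i] show "pd i (pd j (\<lambda>z. ((\<xi> \<bullet> (z - y))\<^sup>2 / 2) *\<^sub>R e)) z = (\<xi>$i * \<xi>$j) *\<^sub>R e"
    unfolding 1 by (simp add: inner_axis)
qed

text \<open>The symbol is determined by the test sections \<open>\<langle>\<xi>, z - y\<rangle>\<^sup>2 e / 2\<close>.\<close>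
lemma principal_symbol_eqI:
  assumes lin: "\<And>i j. linear (a i j)" "\<And>i. linear (b i)" "linear c"
    and P: "\<And>u. smooth_on \<Omega> u \<Longrightarrow> (\<And>z. z \<in> \<Omega> \<Longrightarrow> u z \<in> E) \<Longrightarrow>
      P u y = (\<Sum>i\<in>UNIV. \<Sum>j\<in>UNIV. a i j (pd i (pd j u) y)) + (\<Sum>i\<in>UNIV. b i (pd i u y)) + c (u y)"
    and E: "subspace E" "e \<in> E"
  shows "principal_symbol \<Omega> E P y \<xi> e = (\<Sum>i\<in>UNIV. \<Sum>j\<in>UNIV. (\<xi>$i * \<xi>$j) *\<^sub>R a i j e)"
proof -
  define u where "u = (\<lambda>z. ((\<xi> \<bullet> (z - y))\<^sup>2 / 2) *\<^sub>R e)"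
  have u: "smooth_on \<Omega> u" "\<And>z. u z \<in> E"
    unfolding u_def by (rule smooth_on_quadratic, rule subspace_scale[OF E])
  \<comment> \<open>At \<open>y\<close> the test section and its first derivatives vanish and its
    second derivatives are \<open>\<xi>$i * \<xi>$j\<close> times \<open>e\<close>, so every
    admissible choice of coefficients yields the same value \<open>P u y\<close>.\<close>
  have pu: "pd i (pd j u) y = (\<xi>$i * \<xi>$j) *\<^sub>R e" "pd i u y = 0" "u y = 0" for i j
    by (simp_all add: u_def pd_quadratic)
  show ?thesis
    unfolding principal_symbol_def
  proof (rule the_equality)
    show "\<exists>a' b' c'. (\<forall>i j. linear (a' i j)) \<and> (\<forall>i. linear (b' i)) \<and> linear c' \<and>
      (\<forall>u. smooth_on \<Omega> u \<and> (\<forall>z\<in>\<Omega>. u z \<in> E) \<longrightarrow>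
        P u y = (\<Sum>i\<in>UNIV. \<Sum>j\<in>UNIV. a' i j (pd i (pd j u) y)) + (\<Sum>i\<in>UNIV. b' i (pd i u y)) + c' (u y)) \<and>
      (\<Sum>i\<in>UNIV. \<Sum>j\<in>UNIV. (\<xi>$i * \<xi>$j) *\<^sub>R a i j e) = (\<Sum>i\<in>UNIV. \<Sum>j\<in>UNIV. (\<xi>$i * \<xi>$j) *\<^sub>R a' i j e)"
      using lin P by (intro exI[of _ a] exI[of _ b] exI[of _ c]) blast
    fix t
    assume "\<exists>a b c. (\<forall>i j. linear (a i j)) \<and> (\<forall>i. linear (b i)) \<and> linear c \<and>
      (\<forall>u. smooth_on \<Omega> u \<and> (\<forall>z\<in>\<Omega>. u z \<in> E) \<longrightarrow>
        P u y = (\<Sum>i\<in>UNIV. \<Sum>j\<in>UNIV. a i j (pd i (pd j u) y)) + (\<Sum>i\<in>UNIV. b i (pd i u y)) + c (u y)) \<and>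
      t = (\<Sum>i\<in>UNIV. \<Sum>j\<in>UNIV. (\<xi>$i * \<xi>$j) *\<^sub>R a i j e)"
    then obtain a' b' c' where lin': "\<forall>i j. linear (a' i j)" "\<forall>i. linear (b' i)" "linear c'"
      and P': "\<forall>u. smooth_on \<Omega> u \<and> (\<forall>z\<in>\<Omega>. u z \<in> E) \<longrightarrow>
        P u y = (\<Sum>i\<in>UNIV. \<Sum>j\<in>UNIV. a' i j (pd i (pd j u) y)) + (\<Sum>i\<in>UNIV. b' i (pd i u y)) + c' (u y)"
      and t: "t = (\<Sum>i\<in>UNIV. \<Sum>j\<in>UNIV. (\<xi>$i * \<xi>$j) *\<^sub>R a' i j e)" by blast
    have "t = P u y" using P' u lin' by (simp add: t pu linear_0 linear_scale)
    also have "\<dots> = (\<Sum>i\<in>UNIV. \<Sum>j\<in>UNIV. (\<xi>$i * \<xi>$j) *\<^sub>R a i j e)"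
      using P[OF u] lin by (simp add: pu linear_0 linear_scale)
    finally show "t = (\<Sum>i\<in>UNIV. \<Sum>j\<in>UNIV. (\<xi>$i * \<xi>$j) *\<^sub>R a i j e)" .
  qed
qed

lemma subspace_sym2_covec: "subspace sym2_covec"
  by (auto simp: subspace_def sym2_covec_def transpose_def vec_eq_iff zero_prod_def)

lemma sum_axis: "(\<Sum>i\<in>UNIV. axis i (f i)) = (\<chi> i. f i)"
  by (simp add: vec_eq_iff axis_def sum_component)

lemma axis_linear: "axis i (x + y) = axis i x + axis i y" "axis i (r *\<^sub>R x) = r *\<^sub>R axis i x"
  for x y :: "'a::real_vector"
  by (simp_all add: axis_def vec_eq_iff)

context G2_form_on
begin

lemma symbol_DF_eq:
  assumes y: "y \<in> \<Omega>" and e: "e \<in> sym2_covec"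
  shows "symbol_DF \<Omega> \<Phi> y \<xi> e = F_symbol y (\<chi> i j. (\<xi>$i * \<xi>$j) *\<^sub>R 2 *\<^sub>R fst e)"
proof -
  have "det (fst (jet y)) \<noteq> 0" using G2_metric_vol_det[OF metric_vol[OF y]] by (simp add: jet_def)
  define L where "L = frechet_derivative F_jet (at (jet y))"
  have L: "linear L"
    unfolding L_def
    by (rule has_derivative_linear[OF differentiable_F_jet[OF \<open>det (fst (jet y)) \<noteq> 0\<close>, unfolded frechet_derivative_works]])
  \<comment> \<open>The coefficients are read off from the linear map of \<open>DF_eq\<close> by
    placing each derivative in its slot of the jet; the variation of \<open>\<phi>\<close> itself is
    of order zero and belongs to \<open>c\<close>.\<close>
  define a b c where "a i j e = L (0, 0, axis i (axis j (2 *\<^sub>R fst e)), 0)" and "b i e = L (0, axis i (2 *\<^sub>R fst e), 0, 0)"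
    and "c e = L (2 *\<^sub>R fst e, 0, 0, pair_to_3_form (\<Phi> y) e)" for i j and e :: "ten2 \<times> covec"
  have Ladd: "L p + L q = L (p + q)" and Lscale: "r *\<^sub>R L p = L (r *\<^sub>R p)" for p q r
    by (simp_all add: linear_add[OF L] linear_scale[OF L])
  have Lsum: "(\<Sum>i\<in>UNIV. L (f i)) = L (\<Sum>i\<in>UNIV. f i)" for f :: "7 \<Rightarrow> _"
    by (simp add: linear_sum[OF L])
  have lin: "linear (a i j)" "linear (b i)" "linear c" for i j
    by (rule linearI; simp add: a_def b_def c_def Ladd Lscale axis_linear[symmetric] linear_add[OF pair_to_3_form_linear]
      linear_scale[OF pair_to_3_form_linear] scaleR_add_right mult.commute)+
  have sum1: "(\<Sum>i\<in>UNIV. \<Sum>j\<in>UNIV. L (0, 0, axis i (axis j (f i j)), 0)) = L (0, 0, \<chi> i j. f i j, 0)" for f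
  proof -
    have "(\<Sum>i\<in>UNIV. \<Sum>j\<in>UNIV. (0 :: ten2, 0 :: ten2^7, axis i (axis j (f i j)), 0 :: ten3))
        = (0, 0, \<Sum>i\<in>UNIV. \<Sum>j\<in>UNIV. axis i (axis j (f i j)), 0)"
      by (simp add: prod_eq_iff fst_sum snd_sum)
    also have "(\<Sum>i\<in>UNIV. \<Sum>j\<in>UNIV. axis i (axis j (f i j))) = (\<chi> i j. f i j)"
      by (simp add: sum_axis linear_sum[OF bounded_linear.linear[OF bounded_linear_axis], symmetric])
    finally show ?thesis by (simp add: Lsum)
  qed
  have sum2: "(\<Sum>i\<in>UNIV. L (0, axis i (f i), 0, 0)) = L (0, \<chi> i. f i, 0, 0)" for f
  proof -
    have "(\<Sum>i\<in>UNIV. (0 :: ten2, axis i (f i) :: ten2^7, 0 :: ten2^7^7, 0 :: ten3)) = (0, \<Sum>i\<in>UNIV. axis i (f i), 0, 0)"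
      by (simp add: prod_eq_iff fst_sum snd_sum)
    then show ?thesis by (simp add: Lsum sum_axis)
  qed
  have DFu: "DF \<Phi> u y = (\<Sum>i\<in>UNIV. \<Sum>j\<in>UNIV. a i j (pd i (pd j u) y)) + (\<Sum>i\<in>UNIV. b i (pd i u y)) + c (u y)"
    if "smooth_on \<Omega> u" "\<And>z. z \<in> \<Omega> \<Longrightarrow> u z \<in> sym2_covec" for u
    unfolding a_def b_def c_def sum1 sum2 Ladd using DF_eq[OF y that] by (simp add: L_def)
  have "symbol_DF \<Omega> \<Phi> y \<xi> e = (\<Sum>i\<in>UNIV. \<Sum>j\<in>UNIV. (\<xi>$i * \<xi>$j) *\<^sub>R a i j e)"
    unfolding symbol_DF_def by (rule principal_symbol_eqI[where a = a and b = b and c = c, OF lin _ subspace_sym2_covec e]) (rule DFu)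
  also have "\<dots> = (\<Sum>i\<in>UNIV. \<Sum>j\<in>UNIV. L (0, 0, axis i (axis j ((\<xi>$i * \<xi>$j) *\<^sub>R 2 *\<^sub>R fst e)), 0))"
    by (simp add: a_def Lscale axis_linear(2)[symmetric])
  also have "\<dots> = F_symbol y (\<chi> i j. (\<xi>$i * \<xi>$j) *\<^sub>R 2 *\<^sub>R fst e)"
    unfolding sum1 unfolding L_def by (rule F_jet_derivative_second_order[OF y])
  finally show ?thesis .
qed

end

section \<open>Self-adjoint operators with three eigenvalues\<close>

text \<open>\<open>T^3 = c^2 T\<close> says that \<open>T\<close> is annihilated by
  \<open>t (t - c) (t + c)\<close>, which has three distinct roots, and self-adjointness makes the
  eigenspaces orthogonal. Everything is relative to \<open>W\<close>, since the symbol is meaningful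
  on symmetric pairs only.\<close>

locale cubic_self_adjoint =
  fixes W :: "'a::real_vector set" and T :: "'a \<Rightarrow> 'a" and ip :: "'a \<Rightarrow> 'a \<Rightarrow> real" and c :: real
  assumes W: "subspace W"
    and T_in: "\<And>u. u \<in> W \<Longrightarrow> T u \<in> W"
    and T_add: "\<And>u w. u \<in> W \<Longrightarrow> w \<in> W \<Longrightarrow> T (u + w) = T u + T w"
    and T_scale: "\<And>r u. u \<in> W \<Longrightarrow> T (r *\<^sub>R u) = r *\<^sub>R T u"
    and cubic: "\<And>u. u \<in> W \<Longrightarrow> T (T (T u)) = c\<^sup>2 *\<^sub>R T u"
    and c: "c > 0"
    and ip_add: "\<And>u v w. ip (u + v) w = ip u w + ip v w"
    and ip_scale: "\<And>r u w. ip (r *\<^sub>R u) w = r * ip u w"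
    and ip_sym: "\<And>u w. u \<in> W \<Longrightarrow> w \<in> W \<Longrightarrow> ip u w = ip w u"
    and ip_nonneg: "\<And>u. u \<in> W \<Longrightarrow> ip u u \<ge> 0"
    and self_adj: "\<And>u w. u \<in> W \<Longrightarrow> w \<in> W \<Longrightarrow> ip (T u) w = ip u (T w)"
begin

definition eigenspace :: "real \<Rightarrow> 'a set" where
  "eigenspace r = {u \<in> W. T u = r *\<^sub>R u}"

lemma eigenspaceD: "u \<in> eigenspace r \<Longrightarrow> u \<in> W" "u \<in> eigenspace r \<Longrightarrow> T u = r *\<^sub>R u"
  by (simp_all add: eigenspace_def)

lemma subspace_eigenspace: "subspace (eigenspace r)"
proof (rule subspaceI)
  show "0 \<in> eigenspace r"
    using T_scale[of 0 0] subspace_0[OF W] by (simp add: eigenspace_def)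
  show "x + y \<in> eigenspace r" if "x \<in> eigenspace r" "y \<in> eigenspace r" for x y
    using that subspace_add[OF W] by (simp add: eigenspace_def T_add scaleR_add_right)
  show "k *\<^sub>R x \<in> eigenspace r" if "x \<in> eigenspace r" for k x
    using that subspace_scale[OF W] by (simp add: eigenspace_def T_scale)
qed

lemma eigenspace_orthogonal:
  assumes "u \<in> eigenspace r" "w \<in> eigenspace s" "r \<noteq> s"
  shows "ip u w = 0"
proof -
  have "r * ip u w = ip (T u) w" using assms by (simp add: eigenspaceD ip_scale)
  also have "\<dots> = ip (T w) u" using assms by (metis self_adj ip_sym eigenspaceD(1) T_in)
  also have "\<dots> = s * ip w u" using assms by (simp add: eigenspaceD ip_scale)
  also have "ip w u = ip u w" using assms by (metis ip_sym eigenspaceD(1))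
  finally show ?thesis using assms(3) by simp
qed

lemma decomposition_exists:
  assumes "w \<in> W"
  shows "\<exists>x\<in>eigenspace 0. \<exists>y\<in>eigenspace c. \<exists>z\<in>eigenspace (- c). w = x + y + z"
proof -
  \<comment> \<open>\<open>p\<close> is the part of \<open>w\<close> in the two nonzero eigenspaces,
    and \<open>T\<close> exchanges \<open>p\<close> and \<open>q\<close> up to the factor
    \<open>c\<close>; hence \<open>p + q\<close> and \<open>p - q\<close> are eigenvectors for
    \<open>c\<close> and \<open>- c\<close>.\<close>
  define p where "p = (1 / c\<^sup>2) *\<^sub>R T (T w)"
  define q where "q = (1 / c) *\<^sub>R T w"
  have TW: "T w \<in> W" "T (T w) \<in> W" using assms T_in by auto
  have pq: "p \<in> W" "q \<in> W" using TW subspace_scale[OF W] by (auto simp: p_def q_def)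
  have Tp: "T p = c *\<^sub>R q" "T p = T w" using c by (simp_all add: p_def q_def T_scale TW cubic assms power2_eq_square)
  have Tq: "T q = c *\<^sub>R p" using c by (simp add: p_def q_def T_scale TW power2_eq_square)
  have Tdiff: "T (u - v) = T u - T v" if "u \<in> W" "v \<in> W" for u v
    using T_add[OF that(1), of "(-1) *\<^sub>R v"] T_scale[OF that(2), of "-1"] subspace_scale[OF W that(2), of "-1"] by simp
  have "w - p \<in> eigenspace 0"
    using assms pq subspace_diff[OF W] by (simp add: eigenspace_def Tdiff Tp(2))
  moreover have "(1 / 2) *\<^sub>R (p + q) \<in> eigenspace c"
    using pq subspace_scale[OF W] subspace_add[OF W]
    by (simp add: eigenspace_def T_scale T_add Tp(1) Tq algebra_simps)
  moreover have "(1 / 2) *\<^sub>R (p - q) \<in> eigenspace (- c)"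
    using pq subspace_scale[OF W] subspace_diff[OF W]
    by (simp add: eigenspace_def T_scale Tdiff Tp(1) Tq algebra_simps)
  moreover have "w = (w - p) + (1 / 2) *\<^sub>R (p + q) + (1 / 2) *\<^sub>R (p - q)"
  proof -
    have "(1 / 2) *\<^sub>R (p + q) + (1 / 2) *\<^sub>R (p - q) = (1 / 2 + 1 / 2) *\<^sub>R p"
      by (simp only: scaleR_add_left scaleR_add_right scaleR_diff_right) simp
    then show ?thesis by (simp add: add.assoc)
  qed
  ultimately show ?thesis by blast
qed

text \<open>Applying \<open>T\<close> to the relation leaves \<open>y = z\<close>, an eigenvector
  for both \<open>c\<close> and \<open>- c\<close>. The argument is algebraic, as \<open>ip\<close>
  is only assumed semidefinite.\<close>

lemma decomposition_unique:
  assumes "x \<in> eigenspace 0" "y \<in> eigenspace c" "z \<in> eigenspace (- c)" "x + y + z = 0"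
  shows "x = 0" "y = 0" "z = 0"
proof -
  note W3 = eigenspaceD(1)[OF assms(1)] eigenspaceD(1)[OF assms(2)] eigenspaceD(1)[OF assms(3)]
  note sc = subspace_scale[OF W] and ad = subspace_add[OF W]
  have "T (x + y + z) = 0" using T_scale[OF subspace_0[OF W], of 0] by (simp add: assms(4))
  then have "c *\<^sub>R y - c *\<^sub>R z = 0"
    using W3 by (simp add: T_add ad eigenspaceD(2)[OF assms(1)] eigenspaceD(2)[OF assms(2)] eigenspaceD(2)[OF assms(3)])
  then have yz: "y = z" using c by simp
  have "c *\<^sub>R y = T y" using eigenspaceD(2)[OF assms(2)] by simp
  also have "T y = - (c *\<^sub>R y)" using eigenspaceD(2)[OF assms(3)] by (simp add: yz)
  finally have "(2 * c) *\<^sub>R y = 0" by (simp add: scaleR_2[symmetric] eq_neg_iff_add_eq_0 flip: scaleR_scaleR)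
  then show "y = 0" using c by simp
  then show "z = 0" using yz by simp
  then show "x = 0" using assms(4) \<open>y = 0\<close> by simp
qed

lemma orthogonal_decomposition3_eigenspaces:
  "orthogonal_decomposition3 ip W (eigenspace 0) (eigenspace c) (eigenspace (- c))"
proof -
  have "\<exists>!(x, y, z). x \<in> eigenspace 0 \<and> y \<in> eigenspace c \<and> z \<in> eigenspace (- c) \<and> w = x + y + z" if w: "w \<in> W" for w
  proof -
    obtain x y z where xyz: "x \<in> eigenspace 0" "y \<in> eigenspace c" "z \<in> eigenspace (- c)" "w = x + y + z"
      using decomposition_exists[OF w] by blast
    show ?thesis
    proof (rule ex1I[of _ "(x, y, z)"])
      show "case (x, y, z) of (x, y, z) \<Rightarrow> x \<in> eigenspace 0 \<and> y \<in> eigenspace c \<and> z \<in> eigenspace (- c) \<and> w = x + y + z"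
        using xyz by simp
      fix t assume t: "case t of (x, y, z) \<Rightarrow> x \<in> eigenspace 0 \<and> y \<in> eigenspace c \<and> z \<in> eigenspace (- c) \<and> w = x + y + z"
      obtain x' y' z' where [simp]: "t = (x', y', z')" by (cases t)
      have "x - x' \<in> eigenspace 0" "y - y' \<in> eigenspace c" "z - z' \<in> eigenspace (- c)"
        using t xyz subspace_diff[OF subspace_eigenspace] by auto
      moreover have "(x - x') + (y - y') + (z - z') = 0" using t xyz by (simp add: algebra_simps)
      ultimately have "x - x' = 0" "y - y' = 0" "z - z' = 0" using decomposition_unique by blast+
      then show "t = (x, y, z)" by simp
    qed
  qed
  then show ?thesis
    unfolding orthogonal_decomposition3_def
    using subspace_eigenspace eigenspace_orthogonal[of _ 0 _ c] eigenspace_orthogonal[of _ 0 _ "- c"]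
      eigenspace_orthogonal[of _ c _ "- c"] c by (auto dest: eigenspaceD(1))
qed

text \<open>In the decomposition \<open>w = x + y + z\<close> the pairing of \<open>T w\<close> with
  \<open>w\<close> is \<open>c\<close> times the difference of \<open>ip y y\<close> and
  \<open>ip z z\<close>.\<close>

lemma ip_bound:
  assumes "w \<in> W"
  shows "\<bar>ip (T w) w\<bar> \<le> c * ip w w"
proof -
  obtain x y z where xyz: "x \<in> eigenspace 0" "y \<in> eigenspace c" "z \<in> eigenspace (- c)" and w: "w = x + y + z"
    using decomposition_exists[OF assms] by blast
  note W3 = eigenspaceD(1)[OF xyz(1)] eigenspaceD(1)[OF xyz(2)] eigenspaceD(1)[OF xyz(3)]
  note ad = subspace_add[OF W]
  have o: "ip x y = 0" "ip x z = 0" "ip y z = 0" "ip y x = 0" "ip z x = 0" "ip z y = 0"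
    using xyz c by (auto intro: eigenspace_orthogonal)
  have right: "ip u (x + y + z) = ip u x + ip u y + ip u z" if "u \<in> W" for u
    using that W3 by (simp add: ip_sym[OF that] ad ip_add)
  have ips: "ip x w = ip x x" "ip y w = ip y y" "ip z w = ip z z"
    unfolding w by (simp_all add: right[OF W3(1)] right[OF W3(2)] right[OF W3(3)] o)
  have "T w = c *\<^sub>R y + (- c) *\<^sub>R z"
    using W3 by (simp add: w T_add ad eigenspaceD(2)[OF xyz(1)] eigenspaceD(2)[OF xyz(2)] eigenspaceD(2)[OF xyz(3)])
  then have "ip (T w) w = c * ip y w + (- c) * ip z w" by (simp only: ip_add ip_scale)
  then have "ip (T w) w = c * (ip y y - ip z z)" by (simp add: ips algebra_simps)
  moreover have "ip w w = ip x w + ip y w + ip z w" by (subst (1) w) (simp only: ip_add)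
  then have "ip w w = ip x x + ip y y + ip z z" by (simp only: ips)
  moreover have "\<bar>ip y y - ip z z\<bar> \<le> ip x x + ip y y + ip z z"
    using ip_nonneg[OF W3(1)] ip_nonneg[OF W3(2)] ip_nonneg[OF W3(3)] by linarith
  ultimately show ?thesis using c by (simp add: abs_mult mult_left_mono)
qed

end

section \<open>The eigenspaces of the symbol\<close>

lemma eval3_contract3: "(contract3 x a *v z) $ j = eval3 a x (axis j 1) z"
proof -
  have "(\<Sum>r\<in>UNIV. x $ p * axis j 1 $ q * z $ r * a$p$q$r) = (if q = j then \<Sum>r\<in>UNIV. x $ p * z $ r * a$p$j$r else 0)" for p q
    by (simp add: axis_def)
  then have "eval3 a x (axis j 1) z = (\<Sum>p\<in>UNIV. \<Sum>r\<in>UNIV. x $ p * z $ r * a$p$j$r)"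
    by (simp add: eval3_def)
  then show ?thesis
    by (simp add: matrix_vector_mult_def contract3_def sum_distrib_right sum_distrib_left mult_ac) (rule sum.swap)
qed

lemma contract3_self: "alternating3 a \<Longrightarrow> contract3 x a *v x = 0"
  using eval3_alternating(1)[of a x x] eval3_alternating(3)[of a x]
  by (simp add: vec_eq_iff eval3_contract3)

lemma pullback2_eq_matrix: "pullback2 P b = transpose P ** b ** P"
proof -
  have "(\<Sum>l\<in>UNIV. \<Sum>m\<in>UNIV. P$l$i * P$m$j * b$l$m) = (\<Sum>m\<in>UNIV. (\<Sum>l\<in>UNIV. P$l$i * b$l$m) * P$m$j)" for i j
    by (subst sum.swap) (simp add: sum_distrib_right sum_distrib_left mult_ac)
  then show ?thesis by (simp add: vec_eq_iff pullback2_def matrix_matrix_mult_def transpose_def)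
qed

lemma tensor_prod_mult:
  "A ** tensor_prod x y = tensor_prod (A *v x) y" "tensor_prod x y ** A = tensor_prod x (y v* A)"
  by (simp_all add: vec_eq_iff matrix_matrix_mult_def tensor_prod_def matrix_vector_mult_def vector_matrix_mult_def
      sum_distrib_left sum_distrib_right mult_ac)

text \<open>The endomorphism \<open>M = \<xi>\<^sup>\<sharp> \<lrcorner> \<phi>\<close> is, up to the factor \<open>|\<xi>|\<close>, a complex structure on the orthogonal complement of \<open>\<xi>\<close>.\<close>
lemma G2_endomorphism:
  fixes \<xi> :: covec
  assumes alt: "alternating3 a" and g: "G2_metric_vol a g v"
  defines "I \<equiv> ginv g"
  defines "M \<equiv> I ** contract3 (I *v \<xi>) a"
  shows "M ** M = tensor_prod (I *v \<xi>) \<xi> - (\<xi> \<bullet> (I *v \<xi>)) *\<^sub>R mat 1"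
    "M *v (I *v \<xi>) = 0" "\<xi> v* M = 0" "transpose (M ** I) = - (M ** I)" "\<exists>R. I = R ** transpose R \<and> det R \<noteq> 0"
proof -
  obtain P a0 where std: "G2_standard a0" and a: "a = pullback3 P a0" and gP: "g = transpose P ** P" and d: "det P \<noteq> 0"
    using G2_normal_form[OF alt g] by blast
  define R where "R = matrix_inv P"
  have PR: "P ** R = mat 1" "R ** P = mat 1" using matrix_inv_right_left[OF d] by (simp_all add: R_def)
  have I: "I = R ** transpose R" unfolding I_def R_def gP by (rule ginv_transpose_mult[OF d])
  have dR: "det R \<noteq> 0" using arg_cong[OF PR(1), of det] by (auto simp: det_mul)
  \<comment> \<open>\<open>\<xi>\<close> in the coordinates where the metric is Euclidean; there
    \<open>M\<close> becomes \<open>J\<close>, the contraction of the standard form with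
    \<open>x\<close>.\<close>
  define x where "x = \<xi> v* R"
  have Ix: "I *v \<xi> = R *v x" by (simp add: I x_def matrix_vector_mul_assoc[symmetric])
  have xP: "x v* P = \<xi>" by (simp add: x_def vector_matrix_mul_assoc PR)
  have Px: "P *v (I *v \<xi>) = x" by (simp add: Ix matrix_vector_mul_assoc PR)
  define J where "J = contract3 x a0"
  have tRP: "transpose R ** transpose P = mat 1" by (simp add: matrix_transpose_mul[symmetric] PR)
  have "M = R ** (transpose R ** transpose P) ** J ** P"
    unfolding M_def a contract3_pullback3 Px pullback2_eq_matrix by (simp add: I J_def matrix_mul_assoc)
  then have M: "M = R ** J ** P" by (simp add: tRP)
  note alt0 = G2_standard_alternating[OF std]
  have "M ** M = R ** J ** (P ** R) ** J ** P" by (simp add: M matrix_mul_assoc)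
  also have "\<dots> = R ** (J ** J) ** P" by (simp add: PR matrix_mul_assoc)
  also have "J ** J = tensor_prod x x + (- (x \<bullet> x)) *\<^sub>R mat 1"
    unfolding J_def using G2_standard_contract3_square[OF std, of x] by simp
  also have "R ** (tensor_prod x x + (- (x \<bullet> x)) *\<^sub>R mat 1) ** P = tensor_prod (R *v x) (x v* P) + (- (x \<bullet> x)) *\<^sub>R mat 1"
    unfolding matrix_mult_add matrix_mult_scaleR tensor_prod_mult by (simp add: PR)
  also have "x \<bullet> x = \<xi> \<bullet> (I *v \<xi>)" unfolding Ix by (simp add: dot_lmul_matrix[symmetric] x_def)
  finally show "M ** M = tensor_prod (I *v \<xi>) \<xi> - (\<xi> \<bullet> (I *v \<xi>)) *\<^sub>R mat 1"
    by (simp add: Ix xP)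
  have "M *v (I *v \<xi>) = R *v (J *v (P *v (I *v \<xi>)))" by (simp add: M matrix_vector_mul_assoc matrix_mul_assoc)
  then show "M *v (I *v \<xi>) = 0" by (simp add: Px J_def contract3_self[OF alt0])
  have skew: "transpose J = - J" unfolding J_def by (rule contract3_skew[OF alt0])
  have "x v* J = transpose J *v x" by simp
  also have "\<dots> = - (J *v x)" unfolding skew by (simp add: matrix_vector_mult_def vec_eq_iff sum_negf)
  finally have "x v* J = 0" by (simp add: J_def contract3_self[OF alt0])
  moreover have "\<xi> v* M = (x v* J) v* P" by (simp add: M x_def vector_matrix_mul_assoc matrix_mul_assoc)
  ultimately show "\<xi> v* M = 0" by simp
  have "M ** I = R ** J ** (P ** R) ** transpose R" by (simp add: M I matrix_mul_assoc)
  then have MI: "M ** I = R ** J ** transpose R" by (simp add: PR)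
  then have "transpose (M ** I) = R ** transpose J ** transpose R" by (simp add: matrix_transpose_mul matrix_mul_assoc)
  then have "transpose (M ** I) = R ** ((-1) *\<^sub>R J) ** transpose R" by (simp add: skew)
  then show "transpose (M ** I) = - (M ** I)" unfolding matrix_mult_scaleR MI by simp
  show "\<exists>R. I = R ** transpose R \<and> det R \<noteq> 0" using I dR by blast
qed

section \<open>Matrix form of the inner products and contractions\<close>

lemma inner_matrix: "(h :: real^'n^'m) \<bullet> k = (\<Sum>i\<in>UNIV. \<Sum>j\<in>UNIV. h$i$j * k$i$j)"
  by (simp add: inner_vec_def)

lemma inner_transpose: "transpose (h :: real^'n^'m) \<bullet> transpose k = h \<bullet> k"
  unfolding inner_matrix transpose_def by (simp, rule sum.swap)

lemma inner_matrix_mult_left: "((A :: real^'m^'p) ** (h :: real^'n^'m)) \<bullet> k = h \<bullet> (transpose A ** k)"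
proof -
  have "(A ** h) \<bullet> k = (\<Sum>i\<in>UNIV. \<Sum>j\<in>UNIV. \<Sum>l\<in>UNIV. A$i$l * h$l$j * k$i$j)"
    by (simp add: inner_matrix matrix_matrix_mult_def sum_distrib_right)
  also have "\<dots> = (\<Sum>i\<in>UNIV. \<Sum>l\<in>UNIV. \<Sum>j\<in>UNIV. A$i$l * h$l$j * k$i$j)"
    by (rule sum.cong[OF refl], rule sum.swap)
  also have "\<dots> = (\<Sum>l\<in>UNIV. \<Sum>i\<in>UNIV. \<Sum>j\<in>UNIV. A$i$l * h$l$j * k$i$j)" by (rule sum.swap)
  also have "\<dots> = (\<Sum>l\<in>UNIV. \<Sum>j\<in>UNIV. \<Sum>i\<in>UNIV. A$i$l * h$l$j * k$i$j)"
    by (rule sum.cong[OF refl], rule sum.swap)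
  also have "\<dots> = h \<bullet> (transpose A ** k)"
    by (simp add: inner_matrix matrix_matrix_mult_def transpose_def sum_distrib_left mult_ac)
  finally show ?thesis .
qed

lemma inner_matrix_mult_right: "((h :: real^'m^'n) ** (B :: real^'p^'m)) \<bullet> k = h \<bullet> (k ** transpose B)"
proof -
  have "(h ** B) \<bullet> k = (transpose B ** transpose h) \<bullet> transpose k"
    by (simp add: inner_transpose[symmetric, of "h ** B"] matrix_transpose_mul)
  also have "\<dots> = transpose h \<bullet> transpose (k ** transpose B)"
    by (simp add: inner_matrix_mult_left matrix_transpose_mul)
  finally show ?thesis by (simp add: inner_transpose)
qed

lemma ten2_inner_eq: "ten2_inner g h k = h \<bullet> (ginv g ** k ** transpose (ginv g))"
proof -
  have "(\<Sum>p\<in>UNIV. \<Sum>q\<in>UNIV. ginv g $ i $ p * ginv g $ j $ q * h$i$j * k$p$q)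
      = h$i$j * (\<Sum>q\<in>UNIV. (\<Sum>p\<in>UNIV. ginv g $ i $ p * k$p$q) * ginv g $ j $ q)" for i j
    unfolding sum_distrib_left sum_distrib_right by (subst sum.swap) (simp add: mult_ac)
  then show ?thesis
    by (simp add: ten2_inner_def inner_matrix matrix_matrix_mult_def transpose_def)
qed

lemma covec_inner_eq: "covec_inner g X Y = X \<bullet> (ginv g *v Y)"
  by (simp add: covec_inner_def inner_vec_def matrix_vector_mult_def sum_distrib_left mult_ac)

lemma ten2_apply_eq: "ten2_apply g h \<xi> = h *v (ginv g *v \<xi>)"
  by (simp add: ten2_apply_def vec_eq_iff matrix_vector_mult_def sum_distrib_left mult_ac)

lemma sum_reverse3:
  "(\<Sum>i\<in>A. \<Sum>j\<in>B. \<Sum>k\<in>C. f i j k) = (\<Sum>k\<in>C. \<Sum>j\<in>B. \<Sum>i\<in>A. f i j k)"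
proof -
  have "(\<Sum>i\<in>A. \<Sum>j\<in>B. \<Sum>k\<in>C. f i j k) = (\<Sum>i\<in>A. \<Sum>k\<in>C. \<Sum>j\<in>B. f i j k)"
    by (intro sum.cong refl) (rule sum.swap)
  also have "\<dots> = (\<Sum>k\<in>C. \<Sum>i\<in>A. \<Sum>j\<in>B. f i j k)" by (rule sum.swap)
  also have "\<dots> = (\<Sum>k\<in>C. \<Sum>j\<in>B. \<Sum>i\<in>A. f i j k)"
    by (intro sum.cong refl) (rule sum.swap)
  finally show ?thesis .
qed

text \<open>The four terms are copies of one expression with indices exchanged within the pairs;
  skewness of \<open>A\<close> and \<open>B\<close> absorbs the signs, and renaming the summation
  indices makes the copies equal.\<close>

lemma symbol_contraction:
  fixes A B :: "real^7^7" and x :: "real^7" and h :: "real^7^7"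
  assumes A: "\<And>i j. A$i$j = - A$j$i" and B: "\<And>k l. B$k$l = - B$l$k"
  shows "(\<Sum>i\<in>UNIV. \<Sum>j\<in>UNIV. \<Sum>k\<in>UNIV. \<Sum>l\<in>UNIV.
      (x$i * x$k * h$j$l - x$i * x$l * h$j$k - x$j * x$k * h$i$l + x$j * x$l * h$i$k) * A$i$j * B$k$l)
    = 4 * (\<Sum>j\<in>UNIV. \<Sum>l\<in>UNIV. (\<Sum>i\<in>UNIV. x$i * A$i$j) * h$j$l * (\<Sum>k\<in>UNIV. x$k * B$k$l))"
proof -
  define T where "T i j k l = x$i * x$k * h$j$l * A$i$j * B$k$l" for i j k l
  define S where "S = (\<Sum>i\<in>UNIV. \<Sum>j\<in>UNIV. \<Sum>k\<in>UNIV. \<Sum>l\<in>UNIV. T i j k l)"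
  have "(x$i * x$k * h$j$l - x$i * x$l * h$j$k - x$j * x$k * h$i$l + x$j * x$l * h$i$k) * A$i$j * B$k$l
      = T i j k l + T i j l k + T j i k l + T j i l k" for i j k l
    unfolding T_def using A[of j i] B[of l k] by (simp add: algebra_simps)
  moreover have "(\<Sum>i\<in>UNIV. \<Sum>j\<in>UNIV. \<Sum>k\<in>UNIV. \<Sum>l\<in>UNIV. T i j l k) = S"
    unfolding S_def by (rule sum.cong[OF refl], rule sum.cong[OF refl], rule sum.swap)
  moreover have "(\<Sum>i\<in>UNIV. \<Sum>j\<in>UNIV. \<Sum>k\<in>UNIV. \<Sum>l\<in>UNIV. T j i k l) = S"
    unfolding S_def by (rule sum.swap)
  moreover have "(\<Sum>i\<in>UNIV. \<Sum>j\<in>UNIV. \<Sum>k\<in>UNIV. \<Sum>l\<in>UNIV. T j i l k) = S"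
  proof -
    have "(\<Sum>i\<in>UNIV. \<Sum>j\<in>UNIV. \<Sum>k\<in>UNIV. \<Sum>l\<in>UNIV. T j i l k) = (\<Sum>i\<in>UNIV. \<Sum>j\<in>UNIV. \<Sum>k\<in>UNIV. \<Sum>l\<in>UNIV. T i j l k)"
      by (rule sum.swap)
    also have "\<dots> = S" unfolding S_def by (rule sum.cong[OF refl], rule sum.cong[OF refl], rule sum.swap)
    finally show ?thesis .
  qed
  ultimately have "(\<Sum>i\<in>UNIV. \<Sum>j\<in>UNIV. \<Sum>k\<in>UNIV. \<Sum>l\<in>UNIV.
      (x$i * x$k * h$j$l - x$i * x$l * h$j$k - x$j * x$k * h$i$l + x$j * x$l * h$i$k) * A$i$j * B$k$l) = 4 * S"
    by (simp add: sum.distrib S_def[symmetric])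
  also have "S = (\<Sum>j\<in>UNIV. \<Sum>l\<in>UNIV. \<Sum>i\<in>UNIV. \<Sum>k\<in>UNIV. T i j k l)"
  proof -
    have "S = (\<Sum>j\<in>UNIV. \<Sum>i\<in>UNIV. \<Sum>k\<in>UNIV. \<Sum>l\<in>UNIV. T i j k l)"
      unfolding S_def by (rule sum.swap)
    also have "\<dots> = (\<Sum>j\<in>UNIV. \<Sum>l\<in>UNIV. \<Sum>k\<in>UNIV. \<Sum>i\<in>UNIV. T i j k l)"
      by (rule sum.cong[OF refl], rule sum_reverse3)
    also have "\<dots> = (\<Sum>j\<in>UNIV. \<Sum>l\<in>UNIV. \<Sum>i\<in>UNIV. \<Sum>k\<in>UNIV. T i j k l)"
      by (rule sum.cong[OF refl], rule sum.cong[OF refl], rule sum.swap)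
    finally show ?thesis .
  qed
  also have "\<dots> = (\<Sum>j\<in>UNIV. \<Sum>l\<in>UNIV. (\<Sum>i\<in>UNIV. x$i * A$i$j) * h$j$l * (\<Sum>k\<in>UNIV. x$k * B$k$l))"
    unfolding T_def by (simp add: sum_distrib_left sum_distrib_right mult_ac)
  finally show ?thesis .
qed

lemma raise12_skew:
  assumes "alternating3 a"
  shows "raise12 g a $ i $ j $ p = - raise12 g a $ j $ i $ p"
proof -
  have "raise12 g a $ i $ j $ p = (\<Sum>l\<in>UNIV. \<Sum>k\<in>UNIV. ginv g $ i $ k * ginv g $ j $ l * a$k$l$p)"
    unfolding raise12_def vec_lambda_beta by (rule sum.swap)
  also have "\<dots> = - raise12 g a $ j $ i $ p"
    unfolding raise12_def vec_lambda_beta sum_negf[symmetric]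
    by (intro sum.cong refl) (subst alternating3_swap(1)[OF assms], simp add: mult_ac)
  finally show ?thesis .
qed

lemma raise12_contract:
  assumes "transpose (ginv g) = ginv g"
  shows "(\<Sum>i\<in>UNIV. \<xi>$i * raise12 g a $ i $ j $ p) = (ginv g ** contract3 (ginv g *v \<xi>) a) $ j $ p"
proof -
  have s: "ginv g $ i $ k = ginv g $ k $ i" for i k
    using arg_cong[OF assms, of "\<lambda>M. M $ k $ i"] by (simp add: transpose_def)
  have "(\<Sum>i\<in>UNIV. \<xi>$i * raise12 g a $ i $ j $ p)
      = (\<Sum>i\<in>UNIV. \<Sum>k\<in>UNIV. \<Sum>l\<in>UNIV. ginv g $ j $ l * (ginv g $ k $ i * \<xi>$i) * a$k$l$p)"
    unfolding raise12_def vec_lambda_beta sum_distrib_left by (intro sum.cong refl) (simp add: s mult_ac)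
  also have "\<dots> = (\<Sum>l\<in>UNIV. \<Sum>k\<in>UNIV. \<Sum>i\<in>UNIV. ginv g $ j $ l * (ginv g $ k $ i * \<xi>$i) * a$k$l$p)"
    by (rule sum_reverse3)
  also have "\<dots> = (ginv g ** contract3 (ginv g *v \<xi>) a) $ j $ p"
    by (simp add: matrix_matrix_mult_def contract3_def matrix_vector_mult_def sum_distrib_left sum_distrib_right mult_ac)
  finally show ?thesis .
qed

context G2_form_on
begin

text \<open>The endomorphism \<open>M\<close> of the overview: the first index of
  \<open>\<xi>\<^sup>\<sharp> \<lrcorner> \<phi>\<close> is raised, so that \<open>h\<close> with
  its lower indices can be multiplied on both sides.\<close>

definition symbol_matrix :: "real^7 \<Rightarrow> covec \<Rightarrow> real^7^7" where
  "symbol_matrix y \<xi> = ginv (G2_metric (\<Phi> y)) ** contract3 (ginv (G2_metric (\<Phi> y)) *v \<xi>) (\<Phi> y)"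

lemma symbol_DF_matrix:
  assumes y: "y \<in> \<Omega>" and e: "e \<in> sym2_covec"
  shows "symbol_DF \<Omega> \<Phi> y \<xi> e = 4 *\<^sub>R (transpose (symbol_matrix y \<xi>) ** fst e ** symbol_matrix y \<xi>)"
proof -
  let ?g = "G2_metric (\<Phi> y)" and ?M = "symbol_matrix y \<xi>" and ?h = "fst e"
  let ?A = "raise12 ?g (\<Phi> y)"
  have sym: "transpose ?g = ?g" using metric_vol[OF y] by (simp add: G2_metric_vol_def)
  note I = transpose_ginv[OF sym G2_metric_vol_det[OF metric_vol[OF y]]]
  \<comment> \<open>The terms with \<open>\<xi>$i * \<xi>$j\<close> cancel by symmetry, and the 2
    from the variation \<open>2 h\<close> of the metric cancels the division by 2.\<close>
  have R: "riemann_symbol (\<chi> i j. (\<xi>$i * \<xi>$j) *\<^sub>R 2 *\<^sub>R ?h) $ i $ j $ k $ l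
      = \<xi>$i * \<xi>$k * ?h$j$l - \<xi>$i * \<xi>$l * ?h$j$k - \<xi>$j * \<xi>$k * ?h$i$l + \<xi>$j * \<xi>$l * ?h$i$k" for i j k l
    by (simp add: riemann_symbol_def christoffel1_def field_simps)
  have skew: "(\<chi> i j. ?A$i$j$p)$i$j = - (\<chi> i j. ?A$i$j$p)$j$i" for p i j
    using raise12_skew[OF alternating_\<Phi>[OF y], of ?g i j p] by simp
  have "symbol_DF \<Omega> \<Phi> y \<xi> e $ p $ q = 4 * (\<Sum>j\<in>UNIV. \<Sum>l\<in>UNIV. ?M$j$p * ?h$j$l * ?M$l$q)" for p q
  proof -
    have "symbol_DF \<Omega> \<Phi> y \<xi> e $ p $ q = 4 * (\<Sum>j\<in>UNIV. \<Sum>l\<in>UNIV. (\<Sum>i\<in>UNIV. \<xi>$i * (\<chi> i j. ?A$i$j$p)$i$j) * ?h$j$l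
        * (\<Sum>k\<in>UNIV. \<xi>$k * (\<chi> k l. ?A$k$l$q)$k$l))"
      unfolding symbol_contraction[of "\<chi> i j. ?A$i$j$p" "\<chi> k l. ?A$k$l$q" \<xi> ?h, symmetric, OF skew skew]
      by (simp only: symbol_DF_eq[OF y e] F_symbol_def vec_lambda_beta R)
    then show ?thesis by (simp add: raise12_contract[OF I] symbol_matrix_def)
  qed
  moreover have "(transpose ?M ** ?h ** ?M) $ p $ q = (\<Sum>j\<in>UNIV. \<Sum>l\<in>UNIV. ?M$j$p * ?h$j$l * ?M$l$q)" for p q
    by (simp add: pullback2_eq_matrix[symmetric] pullback2_def mult_ac)
  ultimately show ?thesis by (simp add: vec_eq_iff)
qed

lemma symbol_eigenspaces:
  fixes \<xi> :: covec
  assumes y: "y \<in> \<Omega>" and \<xi>: "\<xi> \<noteq> 0"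
  defines "g \<equiv> G2_metric (\<Phi> y)"
  defines "\<sigma> \<equiv> symbol_DF \<Omega> \<Phi> y \<xi>" and "\<sigma>0 \<equiv> symbol_DF_0 \<Omega> \<Phi> y \<xi>" and "\<mu> \<equiv> covec_inner g \<xi> \<xi>"
    and "N \<equiv> {(h, X) \<in> sym2_covec. X = 0 \<and> ten2_apply g h \<xi> = 0}"
  shows "{u \<in> sym2_covec. \<sigma> u = 0} = {(tensor_prod \<xi> V + tensor_prod V \<xi>, X) | V X. True}"
    and "\<sigma>0 ` N \<subseteq> N"
    and "cubic_self_adjoint sym2_covec \<sigma>0 (pair_inner g) (4 * \<mu>)"
    and "{u \<in> sym2_covec. c *\<^sub>R u = \<sigma>0 u} \<subseteq> N \<or> c = 0"
proof -
  define I where "I = ginv g"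
  define M where "M = symbol_matrix y \<xi>"
  define \<eta> where "\<eta> = I *v \<xi>"
  note vol = metric_vol[OF y, folded g_def]
  note En = G2_endomorphism(1-4)[OF alternating_\<Phi>[OF y] vol, of \<xi>, folded I_def, folded \<eta>_def]
    G2_endomorphism(5)[OF alternating_\<Phi>[OF y] vol, folded I_def]
  have M_eq: "M = I ** contract3 \<eta> (\<Phi> y)" by (simp add: M_def symbol_matrix_def I_def \<eta>_def g_def)
  have gsym: "transpose g = g" using vol by (simp add: G2_metric_vol_def)
  have I: "transpose I = I" unfolding I_def by (rule transpose_ginv[OF gsym G2_metric_vol_det[OF vol]])
  obtain R where R: "I = R ** transpose R" "det R \<noteq> 0" using En(5) by blast
  have \<mu>: "\<mu> = \<xi> \<bullet> \<eta>" by (simp add: \<mu>_def covec_inner_eq I_def \<eta>_def)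
  have cov: "covec_inner g X X = (X v* R) \<bullet> (X v* R)" for X
    unfolding covec_inner_eq I_def[symmetric] R(1)
    by (simp add: matrix_vector_mul_assoc[symmetric] dot_lmul_matrix)
  have "\<xi> v* R \<noteq> 0"
  proof
    assume "\<xi> v* R = 0"
    then have "\<xi> v* (R ** matrix_inv R) = 0" by (simp add: vector_matrix_mul_assoc[symmetric])
    then show False using \<xi> by (simp add: matrix_inv_right_left[OF R(2)])
  qed
  then have \<mu>0: "\<mu> > 0" by (simp add: \<mu>_def cov)
  have MM: "M ** M = tensor_prod \<eta> \<xi> + (- \<mu>) *\<^sub>R mat 1" using En(1) by (simp add: M_eq \<mu>)
  have M\<eta>: "M *v \<eta> = 0" and \<xi>M: "\<xi> v* M = 0" using En(2,3) by (simp_all add: M_eq)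
  define T where "T h = 4 *\<^sub>R (transpose M ** h ** M)" for h
  have \<sigma>: "\<sigma> u = T (fst u)" if "u \<in> sym2_covec" for u
    unfolding \<sigma>_def T_def M_def by (rule symbol_DF_matrix[OF y that])
  have \<sigma>0: "\<sigma>0 u = (T (fst u), 0)" if "u \<in> sym2_covec" for u
    using \<sigma>[OF that] by (simp add: \<sigma>0_def symbol_DF_0_def \<sigma>_def)
  have T_sym: "transpose (T h) = T h" if "transpose h = h" for h
    using that by (simp add: T_def transpose_scalar matrix_transpose_mul matrix_mul_assoc)
  have T\<eta>: "T h *v \<eta> = 0" for h
    by (simp add: T_def scaleR_matrix_vector_assoc[symmetric] matrix_vector_mul_assoc[symmetric] M\<eta>)
  have ten_apply: "ten2_apply g h \<xi> = h *v \<eta>" for h by (simp add: ten2_apply_eq I_def \<eta>_def)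
  have mem: "(h, X) \<in> sym2_covec \<longleftrightarrow> transpose h = h" for h X by (simp add: sym2_covec_def)
  have fst_sym: "transpose (fst u) = fst u" if "u \<in> sym2_covec" for u using that by (auto simp: sym2_covec_def)
  \<comment> \<open>The rank-one part of \<open>M ** M\<close> is annihilated because
    \<open>M *v \<eta> = 0\<close>.\<close>
  have M3: "M ** M ** M = (- \<mu>) *\<^sub>R M"
  proof -
    have "M ** M ** M = M ** (M ** M)" by (simp add: matrix_mul_assoc)
    also have "\<dots> = tensor_prod (M *v \<eta>) \<xi> + (- \<mu>) *\<^sub>R M"
      unfolding MM matrix_mult_add matrix_mult_scaleR tensor_prod_mult by simp
    finally show ?thesis by (simp add: M\<eta> tensor_prod_def vec_eq_iff)
  qed
  \<comment> \<open>\<open>4^3 \<mu>^2 = (4 \<mu>)^2 4\<close>, and the last 4 belongs to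
    \<open>T h\<close>.\<close>
  have T3: "T (T (T h)) = (4 * \<mu>)\<^sup>2 *\<^sub>R T h" for h
  proof -
    have "T (T (T h)) = 64 *\<^sub>R (transpose (M ** M ** M) ** h ** (M ** M ** M))"
      by (simp add: T_def matrix_mult_scaleR matrix_transpose_mul matrix_mul_assoc)
    also have "\<dots> = (64 * \<mu>\<^sup>2) *\<^sub>R (transpose M ** h ** M)"
      unfolding M3 transpose_scalar matrix_mult_scaleR by (simp add: power2_eq_square)
    finally show ?thesis by (simp add: T_def power2_eq_square)
  qed
  show "{u \<in> sym2_covec. \<sigma> u = 0} = {(tensor_prod \<xi> V + tensor_prod V \<xi>, X) | V X. True}"
  proof (intro set_eqI iffI)
    fix u assume "u \<in> {u \<in> sym2_covec. \<sigma> u = 0}"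
    then have u: "u \<in> sym2_covec" "\<sigma> u = 0" by simp_all
    then have "T (fst u) = 0" using \<sigma>[OF u(1)] by simp
    define h where "h = fst u"
    have h: "transpose h = h" "transpose M ** h ** M = 0" using fst_sym[OF u(1)] \<open>T (fst u) = 0\<close> by (simp_all add: h_def T_def)
    \<comment> \<open>If \<open>h = \<xi> \<otimes> V + V \<otimes> \<xi>\<close>, then applying
      \<open>h\<close> to \<open>\<eta>\<close> gives \<open>\<mu> V\<close> plus
      \<open>V \<bullet> \<eta>\<close> times \<open>\<xi>\<close>, and pairing with
      \<open>\<eta>\<close> once more gives \<open>2 \<mu> (V \<bullet> \<eta>)\<close>. Solving for
      \<open>V\<close> yields this formula.\<close>
    define V where "V = (1 / \<mu>) *\<^sub>R (h *v \<eta>) - ((\<eta> \<bullet> (h *v \<eta>)) / (2 * \<mu>\<^sup>2)) *\<^sub>R \<xi>"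
    \<comment> \<open>Both factors of the hypothesis are completed to \<open>M ** M\<close> and its
      transpose, whose explicit form lets \<open>h\<close> be solved for.\<close>
    have "0 = transpose M ** (transpose M ** h ** M) ** M" by (simp add: h(2))
    also have "\<dots> = transpose (M ** M) ** h ** (M ** M)" by (simp add: matrix_transpose_mul matrix_mul_assoc)
    also have "transpose (M ** M) = tensor_prod \<xi> \<eta> + (- \<mu>) *\<^sub>R mat 1"
      unfolding MM transpose_add transpose_scalar by (simp add: transpose_def tensor_prod_def vec_eq_iff mat_def mult.commute)
    also have "(tensor_prod \<xi> \<eta> + (- \<mu>) *\<^sub>R mat 1) ** h ** (M ** M)
        = tensor_prod \<xi> \<eta> ** h ** tensor_prod \<eta> \<xi> + (- \<mu>) *\<^sub>R (tensor_prod \<xi> \<eta> ** h) + (- \<mu>) *\<^sub>R (h ** tensor_prod \<eta> \<xi>) + \<mu>\<^sup>2 *\<^sub>R h"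
      unfolding MM matrix_mult_add matrix_mult_scaleR by (simp add: power2_eq_square algebra_simps)
    also have "tensor_prod \<xi> \<eta> ** h = tensor_prod \<xi> (h *v \<eta>)"
      using h(1) by (metis tensor_prod_mult(2) transpose_matrix_vector)
    also have "tensor_prod \<xi> (h *v \<eta>) ** tensor_prod \<eta> \<xi> = (\<eta> \<bullet> (h *v \<eta>)) *\<^sub>R tensor_prod \<xi> \<xi>"
      by (simp add: vec_eq_iff matrix_matrix_mult_def tensor_prod_def inner_vec_def sum_distrib_left sum_distrib_right mult_ac)
    also have "h ** tensor_prod \<eta> \<xi> = tensor_prod (h *v \<eta>) \<xi>" by (rule tensor_prod_mult)
    finally have eq: "\<mu>\<^sup>2 * h$i$j = \<mu> * (\<xi>$i * (h *v \<eta>)$j) + \<mu> * ((h *v \<eta>)$i * \<xi>$j) - (\<eta> \<bullet> (h *v \<eta>)) * (\<xi>$i * \<xi>$j)" for i j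
      by (simp add: vec_eq_iff tensor_prod_def algebra_simps)
    have "h$i$j = \<xi>$i * V$j + V$i * \<xi>$j" for i j
    proof -
      have "\<mu>\<^sup>2 * (\<xi>$i * V$j + V$i * \<xi>$j) = \<mu>\<^sup>2 * h$i$j"
        unfolding eq V_def using \<mu>0 by (simp add: field_simps power2_eq_square)
      then show ?thesis using \<mu>0 by simp
    qed
    then have "h = tensor_prod \<xi> V + tensor_prod V \<xi>" by (simp add: vec_eq_iff tensor_prod_def)
    then have "u = (tensor_prod \<xi> V + tensor_prod V \<xi>, snd u)" unfolding h_def by (simp add: prod_eq_iff)
    then show "u \<in> {(tensor_prod \<xi> V + tensor_prod V \<xi>, X) | V X. True}" by blast
  next
    fix u :: "ten2 \<times> covec" assume "u \<in> {(tensor_prod \<xi> V + tensor_prod V \<xi>, X) | V X. True}"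
    then obtain V X where u: "u = (tensor_prod \<xi> V + tensor_prod V \<xi>, X)" by blast
    have "transpose (tensor_prod \<xi> V + tensor_prod V \<xi>) = tensor_prod \<xi> V + tensor_prod V \<xi>"
      by (simp add: vec_eq_iff transpose_def tensor_prod_def mult.commute)
    then have S: "(tensor_prod \<xi> V + tensor_prod V \<xi>, X) \<in> sym2_covec" by (simp add: mem)
    have z: "tensor_prod 0 x = 0" "tensor_prod x 0 = 0" for x by (simp_all add: tensor_prod_def vec_eq_iff)
    have "transpose M ** (tensor_prod \<xi> V + tensor_prod V \<xi>) ** M = 0"
      unfolding matrix_mult_add tensor_prod_mult by (simp add: \<xi>M z)
    then show "u \<in> {u \<in> sym2_covec. \<sigma> u = 0}" using S \<sigma>[OF S] by (simp add: u T_def)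
  qed
  \<comment> \<open>\<open>T h\<close> annihilates \<open>\<eta>\<close> for every \<open>h\<close>,
    because its last factor is \<open>M\<close>.\<close>
  show "\<sigma>0 ` N \<subseteq> N"
    by (auto simp: N_def \<sigma>0 mem T_sym T\<eta> ten_apply)
  show "{u \<in> sym2_covec. c *\<^sub>R u = \<sigma>0 u} \<subseteq> N \<or> c = 0"
  proof (cases "c = 0")
    case False
    have "u \<in> N" if u: "u \<in> sym2_covec" "c *\<^sub>R u = \<sigma>0 u" for u
    proof -
      have 1: "c *\<^sub>R fst u = T (fst u)" "c *\<^sub>R snd u = 0" using u \<sigma>0[OF u(1)] by (simp_all add: prod_eq_iff)
      have "c *\<^sub>R (fst u *v \<eta>) = (c *\<^sub>R fst u) *v \<eta>" by (simp add: scaleR_matrix_vector_assoc)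
      also have "\<dots> = 0" unfolding 1(1) by (rule T\<eta>)
      finally show ?thesis using 1(2) False u(1) by (cases u) (simp add: N_def ten_apply)
    qed
    then show ?thesis by blast
  qed simp
  show "cubic_self_adjoint sym2_covec \<sigma>0 (pair_inner g) (4 * \<mu>)"
  proof
    have sandwich: "(A ** h ** B) \<bullet> k = h \<bullet> (transpose A ** k ** transpose B)" for A h B k :: "real^7^7"
      by (rule trans[OF inner_matrix_mult_right]) (simp add: inner_matrix_mult_left matrix_mul_assoc)
    note ip = ten2_inner_eq[of g, folded I_def, unfolded I]
    show "subspace (sym2_covec :: (ten2 \<times> covec) set)" by (rule subspace_sym2_covec)
    show "\<sigma>0 u \<in> sym2_covec" if "u \<in> sym2_covec" for u
      by (simp add: \<sigma>0[OF that] mem T_sym[OF fst_sym[OF that]])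
    show "\<sigma>0 (u + w) = \<sigma>0 u + \<sigma>0 w" if "u \<in> sym2_covec" "w \<in> sym2_covec" for u w
      using that subspace_add[OF subspace_sym2_covec that]
      by (simp add: \<sigma>0 T_def matrix_mult_add scaleR_add_right)
    show "\<sigma>0 (r *\<^sub>R u) = r *\<^sub>R \<sigma>0 u" if "u \<in> sym2_covec" for r u
      using that subspace_scale[OF subspace_sym2_covec that]
      by (simp add: \<sigma>0 T_def matrix_mult_scaleR mult.commute)
    have mem': "(T h, X) \<in> sym2_covec" if "transpose h = h" for h X by (simp add: mem T_sym[OF that])
    show "\<sigma>0 (\<sigma>0 (\<sigma>0 u)) = (4 * \<mu>)\<^sup>2 *\<^sub>R \<sigma>0 u" if "u \<in> sym2_covec" for u
      using fst_sym[OF that] by (simp add: \<sigma>0[OF that] \<sigma>0[OF mem'] T_sym T3)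
    show "4 * \<mu> > 0" using \<mu>0 by simp
    show "pair_inner g (u + v) w = pair_inner g u w + pair_inner g v w" for u v w
      by (simp add: pair_inner_def ip covec_inner_eq inner_add_left)
    show "pair_inner g (r *\<^sub>R u) w = r * pair_inner g u w" for r u w
      by (simp add: pair_inner_def ip covec_inner_eq algebra_simps)
    show "pair_inner g u w = pair_inner g w u" for u w
    proof -
      have "ten2_inner g (fst u) (fst w) = (I ** fst u ** I) \<bullet> fst w"
        by (simp add: ip sandwich I)
      moreover have "covec_inner g (snd u) (snd w) = covec_inner g (snd w) (snd u)"
        unfolding covec_inner_eq I_def[symmetric]
        by (metis I dot_lmul_matrix inner_commute transpose_matrix_vector)
      ultimately show ?thesis by (simp add: pair_inner_def ip inner_commute)
    qed
    show "pair_inner g u u \<ge> 0" for u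
    proof -
      \<comment> \<open>With \<open>I = R ** transpose R\<close> the value becomes the Euclidean
        square norm of \<open>transpose R ** fst u ** R\<close>.\<close>
      have "ten2_inner g (fst u) (fst u) = fst u \<bullet> (R ** (transpose R ** fst u ** R) ** transpose R)"
        unfolding ip R(1) by (simp add: matrix_mul_assoc)
      also have "\<dots> = (transpose R ** fst u ** R) \<bullet> (transpose R ** fst u ** R)"
        unfolding sandwich by simp
      finally show ?thesis by (simp add: pair_inner_def cov)
    qed
    show "pair_inner g (\<sigma>0 u) w = pair_inner g u (\<sigma>0 w)" if "u \<in> sym2_covec" "w \<in> sym2_covec" for u w
    proof -
      \<comment> \<open>Up to the choice of index positions this is the 2-form
        \<open>\<xi>\<^sup>\<sharp> \<lrcorner> \<phi>\<close> with both indices raised, hence skew.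
        It occurs twice in the pairing, so the two signs cancel and the operator is
        self-adjoint.\<close>
      define B where "B = M ** I"
      have B: "transpose B = - B" using En(4) by (simp add: B_def M_eq)
      have IM: "I ** transpose M = transpose B" by (simp add: B_def matrix_transpose_mul I)
      have "T h \<bullet> (I ** k ** I) = h \<bullet> (I ** T k ** I)" for h k
      proof -
        have "T h \<bullet> (I ** k ** I) = 4 * (h \<bullet> ((M ** I) ** k ** (I ** transpose M)))"
          by (simp add: T_def sandwich matrix_mul_assoc)
        also have "\<dots> = 4 * (h \<bullet> ((I ** transpose M) ** k ** (M ** I)))"
          unfolding IM B_def[symmetric] B using matrix_mult_scaleR(1)[of "B ** k" "-1" B]
            matrix_mult_scaleR(2)[of "-1" B k] matrix_mult_scaleR(2)[of "-1" "B ** k" B] by simp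
        also have "\<dots> = h \<bullet> (I ** T k ** I)"
          by (simp add: T_def matrix_mult_scaleR matrix_mul_assoc)
        finally show ?thesis .
      qed
      then show ?thesis
        by (simp add: \<sigma>0 that pair_inner_def ip covec_inner_eq)
    qed
  qed
qed

end

theorem proposition6p47:
  fixes M :: "'m topology" and \<A> :: "'m chart set"
    and \<phi> :: "'m chart \<Rightarrow> real^7 \<Rightarrow> ten3"
    and U :: "'m set" and \<kappa> :: "'m \<Rightarrow> real^7" and x :: 'm and \<xi> :: covec
  assumes "smooth_7_manifold M \<A>"
    and "G2_structure \<A> \<phi>"
    and "(U, \<kappa>) \<in> \<A>" and "x \<in> U"
    and "\<xi> \<noteq> 0"
  shows "let g = G2_metric (\<phi> (U, \<kappa>) (\<kappa> x));
             \<sigma> = symbol_DF (\<kappa> ` U) (\<phi> (U, \<kappa>)) (\<kappa> x) \<xi>;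
             \<sigma>0 = symbol_DF_0 (\<kappa> ` U) (\<phi> (U, \<kappa>)) (\<kappa> x) \<xi>;
             \<mu> = covec_inner g \<xi> \<xi>;
             K = {u \<in> sym2_covec. \<sigma> u = 0};
             N = {(h, X) \<in> sym2_covec. X = 0 \<and> ten2_apply g h \<xi> = 0};
             Ep = {u \<in> sym2_covec. (4 * \<mu>) *\<^sub>R u - \<sigma>0 u = 0};
             Em = {u \<in> sym2_covec. (4 * \<mu>) *\<^sub>R u + \<sigma>0 u = 0}
         in K = {(tensor_prod \<xi> V + tensor_prod V \<xi>, X) | V X. True}
          \<and> \<sigma>0 ` N \<subseteq> N
          \<and> orthogonal_decomposition3 (pair_inner g) sym2_covec K Ep Em
          \<and> Ep \<subseteq> N \<and> Em \<subseteq> N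
          \<and> (\<forall>h. (h, 0) \<in> Ep \<longrightarrow> \<sigma> (h, 0) = (4 * \<mu>) *\<^sub>R h)
          \<and> (\<forall>h. (h, 0) \<in> Em \<longrightarrow> \<sigma> (h, 0) = - (4 * \<mu>) *\<^sub>R h)
          \<and> (\<forall>u\<in>sym2_covec. \<bar>pair_inner g (\<sigma>0 u) u\<bar> \<le> 4 * \<mu> * pair_inner g u u)"
proof -
  let ?\<Omega> = "\<kappa> ` U" and ?\<Phi> = "\<phi> (U, \<kappa>)"
  have "open ?\<Omega>" using assms(1,3) by (auto simp: smooth_7_manifold_def)
  moreover have "smooth_on ?\<Omega> ?\<Phi>" "\<forall>z\<in>?\<Omega>. alternating3 (?\<Phi> z)" "\<forall>z\<in>?\<Omega>. nondegenerate3 (?\<Phi> z)"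
    using assms(2,3) by (fastforce simp: G2_structure_def smooth_3_form_def)+
  ultimately interpret G2_form_on ?\<Omega> ?\<Phi> by unfold_locales auto
  define g where "g = G2_metric (?\<Phi> (\<kappa> x))"
  define \<sigma> where "\<sigma> = symbol_DF ?\<Omega> ?\<Phi> (\<kappa> x) \<xi>"
  define \<sigma>0 where "\<sigma>0 = symbol_DF_0 ?\<Omega> ?\<Phi> (\<kappa> x) \<xi>"
  define \<mu> where "\<mu> = covec_inner g \<xi> \<xi>"
  define N where "N = {(h, X) \<in> sym2_covec. X = 0 \<and> ten2_apply g h \<xi> = 0}"
  have "\<kappa> x \<in> ?\<Omega>" using assms(4) by simp
  note E = symbol_eigenspaces[OF this assms(5), folded g_def, folded \<sigma>_def \<sigma>0_def \<mu>_def N_def]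
  interpret cubic_self_adjoint sym2_covec \<sigma>0 "pair_inner g" "4 * \<mu>" by (rule E(3))
  have \<sigma>0: "\<sigma>0 u = (\<sigma> u, 0)" for u by (simp add: \<sigma>0_def \<sigma>_def symbol_DF_0_def)
  \<comment> \<open>The second component of \<open>\<sigma>0\<close> is 0, so its eigenspace for 0
    is the kernel of \<open>\<sigma>\<close>.\<close>
  have K: "{u \<in> sym2_covec. \<sigma> u = 0} = eigenspace 0"
    by (auto simp: eigenspace_def \<sigma>0 zero_prod_def)
  have Ep: "{u \<in> sym2_covec. (4 * \<mu>) *\<^sub>R u - \<sigma>0 u = 0} = eigenspace (4 * \<mu>)"
    by (auto simp: eigenspace_def)
  have Em: "{u \<in> sym2_covec. (4 * \<mu>) *\<^sub>R u + \<sigma>0 u = 0} = eigenspace (- (4 * \<mu>))"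
    by (auto simp: eigenspace_def eq_neg_iff_add_eq_0 add.commute)
  have sub: "eigenspace c \<subseteq> N" if "c \<noteq> 0" for c
    using E(4)[of c] that by (auto simp: eigenspace_def)
  have "\<sigma> (h, 0) = c *\<^sub>R h" if "(h, 0) \<in> eigenspace c" for h c
    using eigenspaceD(2)[OF that] by (simp add: \<sigma>0)
  moreover have "eigenspace (4 * \<mu>) \<subseteq> N" "eigenspace (- (4 * \<mu>)) \<subseteq> N" using c by (auto intro!: sub)
  ultimately show ?thesis
    unfolding Let_def g_def[symmetric] \<sigma>_def[symmetric] \<sigma>0_def[symmetric] \<mu>_def[symmetric] N_def[symmetric] Ep Em
    using E(1,2) orthogonal_decomposition3_eigenspaces ip_bound unfolding K by blast
qed

end
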